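(* Fix $p\in(0,1)\setminus\{1/2\}$ and $c>0$, and let $m_n=\lfloor cn^{3/2}\rfloor$. Let $\nu_n$ be the uniform measure on $S_n$. Then $$\operatorname{TV}\big(\nu_{n, m_n}^{(p)}, \nu_n\big) = 1- 2\Phi\left(-\frac{|2p-1|}{4\sqrt{3}\,c}\right)+O_{c, p}(n^{-1/2}).$$
   Context: $(m,p)$-shelf shuffle: a deck of cards labelled $1,\ldots,n$, arranged in increasing order from top to bottom, is dealt sequentially from the bottom (so the cards are dealt in the order $n,n-1,\ldots,1$). Each card is assigned one of $m$ labelled shelves, independently and uniformly at random, and is placed at the top of the existing pile on that shelf with probability $p$ and at the bottom of it with probability $1-p$, independently of everything else (a card assigned to an empty shelf simply starts the pile). The shuffled deck is formed by joining the piles in the order of the shelves $1,\ldots,m$, and is read from top to bottom as a permutation $\pi=(\pi_1,\ldots,\pi_n)\in S_n$ in one-line notation. The law of this random permutation is denoted $\nu_{n,m}^{(p)}$. $\operatorname{TV}(\mu,\nu)=\frac12\sum_{\pi\in S_n}|\mu(\pi)-\nu(\pi)|$ is the total variation distance, and $\Phi(t)=\frac1{\sqrt{2\pi}}\int_{-\infty}^t e^{-x^2/2}\,dx$. The notation $f_n=O_{c,p}(g_n)$ means $|f_n|\le C|g_n|$ for a constant $C$ depending only on $c$ and $p$, for all $n$ for which the quantities are defined (here $m_n\ge1$). *)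

theory Defs
  imports "HOL-Probability.Probability" "HOL-Combinatorics.Multiset_Permutations"
begin

text \<open>
  A pile (and the shuffled deck) is the list of its cards from top to bottom, so its
  head is its top card. A permutation in one-line notation is the list of its values, and
  the symmetric group is \<open>permutations_of_set {1..n}\<close>.
\<close>

definition place_card ::
    "real \<Rightarrow> nat \<Rightarrow> nat \<Rightarrow> (nat \<Rightarrow> nat list) \<Rightarrow> (nat \<Rightarrow> nat list) pmf" where
  "place_card p m k piles =
     bind_pmf (pmf_of_set {1..m}) (\<lambda>s.
     bind_pmf (bernoulli_pmf p) (\<lambda>top.
     return_pmf (piles(s := (if top then k # piles s else piles s @ [k])))))"

text \<open>The cards \<open>k, k - 1, \<dots>, 1\<close> are dealt in this order onto the given piles.\<close>

fun deal_cards ::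
    "real \<Rightarrow> nat \<Rightarrow> nat \<Rightarrow> (nat \<Rightarrow> nat list) \<Rightarrow> (nat \<Rightarrow> nat list) pmf" where
  "deal_cards p m 0 piles = return_pmf piles"
| "deal_cards p m (Suc k) piles =
     bind_pmf (place_card p m (Suc k) piles) (deal_cards p m k)"

text \<open>Meaningful for \<open>m \<ge> 1\<close> and \<open>0 \<le> p \<le> 1\<close> only.\<close>

definition shelf_shuffle :: "real \<Rightarrow> nat \<Rightarrow> nat \<Rightarrow> nat list pmf" where
  "shelf_shuffle p n m =
     map_pmf (\<lambda>piles. concat (map piles [1..<Suc m])) (deal_cards p m n (\<lambda>_. []))"

definition uniform_perm :: "nat \<Rightarrow> nat list pmf" where
  "uniform_perm n = pmf_of_set (permutations_of_set {1..n})"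

definition tv_dist :: "nat \<Rightarrow> nat list pmf \<Rightarrow> nat list pmf \<Rightarrow> real" where
  "tv_dist n \<mu> \<nu> =
     1 / 2 * (\<Sum>\<pi>\<in>permutations_of_set {1..n}. \<bar>pmf \<mu> \<pi> - pmf \<nu> \<pi>\<bar>)"

definition std_normal_cdf :: "real \<Rightarrow> real" where
  "std_normal_cdf t = 1 / sqrt (2 * pi) * (LINT x:{..t}|lborel. exp (- (x\<^sup>2 / 2)))"

end

theory Submission
  imports Defs "HOL-Computational_Algebra.Polynomial"
begin

text \<open>
  Write \<open>A\<close>, \<open>D\<close>, \<open>V\<close> for the numbers of ascents, descents and valleys of a permutation \<open>\<pi>\<close>.
  The pile on a shelf is an increasing run (the cards placed on top) followed by a decreasing
  run (the cards placed at the bottom), so the probability of \<open>\<pi>\<close> is a weighted count of the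
  ways to cut \<open>\<pi>\<close> into \<open>m\<close> such blocks. A cut is omitted at an ascent with weight \<open>p\<close>, at a
  descent with weight \<open>1 - p\<close>, and never on both sides of a valley; hence
  (\<open>pmf_shelf_shuffle_eq_coeff\<close>) the probability of \<open>\<pi>\<close> is \<open>m\<^sup>-\<^sup>n\<close> times the coefficient of \<open>X\<^sup>n\<close> in
  \<open>(1 + X)\<^sup>m\<^sup>+\<^sup>V (1 + p X)\<^sup>A\<^sup>-\<^sup>V (1 + (1 - p) X)\<^sup>D\<^sup>-\<^sup>V\<close>.

  Neighbouring coefficients of such a product have the ratio \<open>n / m\<close> up to \<open>O(1 / n)\<close> when \<open>m\<close> is
  of the order \<open>n\<^sup>3\<^sup>/\<^sup>2\<close> (\<open>newton_bounds_ratio\<close>). So one more ascent multiplies the probability by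
  \<open>exp (\<theta> + O(1 / n))\<close> with \<open>\<theta> = (2 p - 1) / (c \<surd>n)\<close>, and one more valley by \<open>exp (O(1 / n))\<close>
  (\<open>shelf_coeff_ratio\<close>). For a uniform permutation both counts deviate from their means by \<open>\<surd>n\<close>
  only. Therefore the density of the shuffle with respect to the uniform law is, up to
  \<open>O(n\<^sup>-\<^sup>1\<^sup>/\<^sup>2)\<close> in \<open>L\<^sup>1\<close>, the normalised exponential tilt \<open>exp (\<theta> X) / E (exp (\<theta> X))\<close> with
  \<open>X = A - (n - 1) / 2\<close> (\<open>shelf_density\<close>, \<open>perm_avg_tilt_perturbation\<close>). As \<open>X / \<surd>(n / 12)\<close> is nearly
  standard normal, the distance is nearly that of a standard normal law from its tilt by
  \<open>\<sigma> = |2 p - 1| / (2 \<surd>3 c)\<close>, namely the expectation of \<open>max 0 (1 - exp (\<sigma> N - \<sigma>\<^sup>2 / 2))\<close> for a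
  standard normal \<open>N\<close>, which is \<open>1 - 2 \<Phi>(- \<sigma> / 2)\<close>.

  It remains to see that the normal approximation costs \<open>O(n\<^sup>-\<^sup>1\<^sup>/\<^sup>2)\<close> as well. Inserting a new
  smallest entry makes the number of ascents a Markov chain: the centred count \<open>X\<close> of a
  permutation of length \<open>k - 1\<close> moves up by \<open>1 / 2\<close> with probability \<open>1 / 2 - X / k\<close> and down by
  \<open>1 / 2\<close> otherwise (\<open>perm_avg_ascents_step\<close>), so the length times the centred count is a martingale.
  The payoff above is that of a put option, and its expectation at \<open>y + \<surd>\<tau> N\<close> is given by the
      explicit Black-Scholes formula
  \<open>put \<sigma> y \<tau>\<close>, which solves the heat equation. Evaluating this solution along the martingale, with
  the remaining variance as time, changes its mean in the step to \<open>k\<close> essentially by a fourth-order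
  Taylor error, because the variances agree and the third moments almost vanish; it is of the order
  \<open>n\<^sup>-\<^sup>1\<^sup>/\<^sup>2 j\<^sup>-\<^sup>3\<^sup>/\<^sup>2\<close> with \<open>j = n - k + 1\<close>, and the sum over \<open>j\<close> converges
  (\<open>put_step\<close>, \<open>put_perm_avg\<close>).
  The same argument with \<open>exp (\<sigma> y + \<sigma>\<^sup>2 \<tau> / 2)\<close> in place of the put shows that the normalising
  constant \<open>E (exp (\<theta> X))\<close> is \<open>exp (\<sigma>\<^sup>2 / 2) + O(n\<^sup>-\<^sup>1\<^sup>/\<^sup>2)\<close> (\<open>mgf_perm_avg\<close>).
\<close>

section \<open>Ascents, valleys and insertion of a smallest entry\<close>

fun ascents :: "nat list \<Rightarrow> nat" where
  "ascents (x # y # r) = (if x < y then 1 else 0) + ascents (y # r)"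
| "ascents _ = 0"

fun valleys :: "nat list \<Rightarrow> nat" where
  "valleys (x # y # z # r) = (if y < x \<and> y < z then 1 else 0) + valleys (y # z # r)"
| "valleys _ = 0"

definition insert_at :: "nat \<Rightarrow> 'a \<Rightarrow> 'a list \<Rightarrow> 'a list" where
  "insert_at i x ys = take i ys @ x # drop i ys"

lemma insert_at_0 [simp]: "insert_at 0 x ys = x # ys"
  and insert_at_Suc [simp]: "insert_at (Suc i) x (y # ys) = y # insert_at i x ys"
  by (simp_all add: insert_at_def)

lemma ascents_le: "ascents xs \<le> length xs - 1"
  by (induction xs rule: ascents.induct) auto

text \<open>
  A new smallest entry leaves the number of ascents unchanged when it is put at the end or into
  an ascent, and creates one ascent when it is put in front or into a descent.
\<close>
lemma sum_ascents_insert_min: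
  fixes f :: "nat \<Rightarrow> real"
  assumes "\<And>y. y \<in> set ys \<Longrightarrow> x < y"
  shows "(\<Sum>i\<le>length ys. f (ascents (insert_at i x ys)))
    = (real (ascents ys) + 1) * f (ascents ys)
      + (real (length ys) - real (ascents ys)) * f (ascents ys + 1)"
  using assms
proof (induction ys arbitrary: f rule: ascents.induct)
  case (1 a b r)
  define e :: nat where "e = (if a < b then 1 else 0)"
  define A where "A = ascents (b # r)"
  define S where "S = (\<Sum>i\<le>length r. f (e + ascents (b # insert_at i x r)))"
  have x: "x < a" "x < b" using 1 by auto
  have IH: "(\<Sum>i\<le>length (b # r). f (e + ascents (insert_at i x (b # r))))
     = (real A + 1) * f (e + A) + (real (length (b # r)) - real A) * f (e + (A + 1))"
    unfolding A_def by (rule 1(1)) (use 1 in auto)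
  hence IH': "f (e + (1 + A)) + S = (real A + 1) * f (e + A) + (real (length r) + 1 - real A) * f (e
      + (A + 1))"
    unfolding S_def using x by (simp add: sum.atMost_Suc_shift A_def del: sum.atMost_Suc)
  have "(\<Sum>i\<le>length (a # b # r). f (ascents (insert_at i x (a # b # r))))
      = f (1 + (e + A)) + f (1 + A) + S"
    unfolding S_def using x by (simp add: sum.atMost_Suc_shift A_def e_def del: sum.atMost_Suc)
  also have "S = (real A + 1) * f (e + A) + (real (length r) + 1 - real A) * f (e + (A + 1)) - f (e
      + (1 + A))"
    using IH' by simp
  finally show ?case
    by (simp add: A_def[symmetric] e_def[symmetric]) (simp add: e_def algebra_simps)
qed auto

text \<open>
  A new smallest entry is itself a valley unless it stands at one of the two ends, and it
  destroys a valley exactly when it is put next to one. Two valleys are never adjacent, so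
  \<open>2 * valleys ys + 2\<close> positions keep the number of valleys and all others increase it by one.
\<close>
lemma sum_valleys_insert_min:
  fixes f :: "nat \<Rightarrow> real"
  assumes "\<And>y. y \<in> set ys \<Longrightarrow> x < y" "distinct ys" "ys \<noteq> []"
  shows "(\<Sum>i\<le>length ys. f (valleys (insert_at i x ys)))
    = (2 * real (valleys ys) + 2) * f (valleys ys)
      + (real (length ys) - 1 - 2 * real (valleys ys)) * f (valleys ys + 1)"
  using assms
proof (induction ys arbitrary: f rule: valleys.induct)
  case (1 a b c r)
  define v :: nat where "v = (if b < a \<and> b < c then 1 else 0)"
  define w where "w = valleys (b # c # r)"
  define w' where "w' = valleys (c # r)"
  have x: "x < a" "x < b" "x < c" using 1 by auto
  have bc: "b \<noteq> c" using 1 by auto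
  define S where "S = (\<Sum>i\<le>length r. f (v + valleys (b # c # insert_at i x r)))"
  have IH: "(\<Sum>i\<le>length (b # c # r). f (v + valleys (insert_at i x (b # c # r))))
     = (2 * real w + 2) * f (v + w) + (real (length (b # c # r)) - 1 - 2 * real w) * f (v + (w + 1))"
    unfolding w_def by (rule 1(1)) (use 1 in auto)
  have first: "valleys (x # b # c # r) = w" "valleys (b # x # c # r) = 1 + w'"
    using x by (cases r; simp add: w_def w'_def)+
  have IH': "f (v + w) + f (v + (1 + w')) + S
     = (2 * real w + 2) * f (v + w) + (real (length r) + 1 - 2 * real w) * f (v + (w + 1))"
    using IH unfolding S_def by (simp add: sum.atMost_Suc_shift first add_ac del: sum.atMost_Suc
        valleys.simps(1))
  have second: "valleys (x # a # b # c # r) = v + w" "valleys (a # x # b # c # r) = 1 + w"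
       "valleys (a # b # x # c # r) = 1 + (w')"
    using x by (cases r; simp add: w_def w'_def v_def)+
  have third: "valleys (a # b # c # insert_at i x r) = v + valleys (b # c # insert_at i x r)" for i
    by (simp add: v_def)
  have "(\<Sum>i\<le>length (a # b # c # r). f (valleys (insert_at i x (a # b # c # r))))
      = f (v + w) + f (1 + w) + f (1 + w') + S"
    unfolding S_def by (simp add: sum.atMost_Suc_shift second third del: sum.atMost_Suc
        valleys.simps(1))
  also have "S = (2 * real w + 2) * f (v + w) + (real (length r) + 1 - 2 * real w) * f (v + (w + 1))
     - f (v + w) - f (v + (1 + w'))" using IH' by simp
  finally have main: "(\<Sum>i\<le>length (a # b # c # r). f (valleys (insert_at i x (a # b # c # r))))
      = f (1 + w) + f (1 + w') - f (v + (1 + w'))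
       + (2 * real w + 2) * f (v + w) + (real (length r) + 1 - 2 * real w) * f (v + (w + 1))" by simp
  have vs: "valleys (a # b # c # r) = v + w" by (simp add: v_def w_def)
  have "w' = w" if "v = 1"
    using that bc unfolding v_def w_def w'_def by (cases r) (auto split: if_splits)
  thus ?case unfolding main vs
    by (cases "v = 1") (auto simp: algebra_simps v_def split: if_splits)
next
  case ("2_1")
  thus ?case by simp
next
  case ("2_2" a)
  thus ?case by simp
next
  case ("2_3" a b)
  hence "x < a" "x < b" by auto
  thus ?case by (simp add: numeral_2_eq_2)
qed

lemma insert_at_remove1:
  assumes "i \<le> length ys" "x \<notin> set ys"
  shows "remove1 x (insert_at i x ys) = ys"
  using assms by (auto simp: insert_at_def remove1_append dest: in_set_takeD)

text \<open>
  The inverse removes \<open>x\<close> and remembers its position.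
\<close>
lemma bij_betw_insert_at:
  assumes "finite S" "x \<notin> S"
  shows "bij_betw (\<lambda>(ys, i). insert_at i x ys) (permutations_of_set S \<times> {..card S})
    (permutations_of_set (insert x S))"
proof (rule bij_betwI')
  fix a b assume ab: "a \<in> permutations_of_set S \<times> {..card S}" "b \<in> permutations_of_set S \<times> {..card S}"
  obtain ys i zs j where e: "a = (ys, i)" "b = (zs, j)" by fastforce
  have l: "length ys = card S" "length zs = card S" "x \<notin> set ys" "x \<notin> set zs" "i \<le> card S" "j \<le> card S"
    using ab assms by (auto simp: e length_finite_permutations_of_set dest: permutations_of_setD)
  show "(case a of (ys, i) \<Rightarrow> insert_at i x ys) = (case b of (ys, i) \<Rightarrow> insert_at i x ys) \<longleftrightarrow> a = b"
  proof
    assume "(case a of (ys, i) \<Rightarrow> insert_at i x ys) = (case b of (ys, i) \<Rightarrow> insert_at i x ys)"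
    hence eq: "insert_at i x ys = insert_at j x zs" by (simp add: e)
    have 1: "ys = zs" using insert_at_remove1[of i ys x] insert_at_remove1[of j zs x] l eq by simp
    have "takeWhile (\<lambda>y. y \<noteq> x) (insert_at i x ys) = take i ys"
         "takeWhile (\<lambda>y. y \<noteq> x) (insert_at j x zs) = take j zs"
      using l unfolding insert_at_def by (subst takeWhile_append2; auto dest: in_set_takeD)+
    hence "length (take i ys) = length (take j zs)" using eq by simp
    thus "a = b" using 1 l by (simp add: e)
  qed auto
next
  fix a assume "a \<in> permutations_of_set S \<times> {..card S}"
  then obtain ys i where a: "a = (ys, i)" "set ys = S" "distinct ys"
    by (auto dest: permutations_of_setD)
  have "set (insert_at i x ys) = insert x (set (take i ys @ drop i ys))"
    unfolding insert_at_def by (simp del: append_take_drop_id)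
  moreover have "distinct (take i ys @ drop i ys)" using a by simp
  hence "distinct (insert_at i x ys)"
    using a assms unfolding insert_at_def distinct_append
    by (auto dest: in_set_takeD in_set_dropD)
  ultimately show "(case a of (ys, i) \<Rightarrow> insert_at i x ys) \<in> permutations_of_set (insert x S)"
    using a by (auto intro: permutations_of_setI)
next
  fix zs assume "zs \<in> permutations_of_set (insert x S)"
  hence zs: "set zs = insert x S" "distinct zs" by (auto dest: permutations_of_setD)
  then obtain us vs where uv: "zs = us @ x # vs" by (metis insertI1 split_list)
  have s: "set (us @ vs) = S" "distinct (us @ vs)" using zs uv assms by auto
  hence "us @ vs \<in> permutations_of_set S" by (intro permutations_of_setI)
  moreover have "length us \<le> card S"
    using distinct_card[OF s(2)] s(1) by simp
  moreover have "zs = insert_at (length us) x (us @ vs)" by (simp add: insert_at_def uv)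
  ultimately show "\<exists>a\<in>permutations_of_set S \<times> {..card S}. zs = (case a of (ys, i) \<Rightarrow> insert_at i x ys)"
    by (intro bexI[of _ "(us @ vs, length us)"]) auto
qed

lemma sum_permutations_insert:
  fixes F :: "'a list \<Rightarrow> 'b::comm_monoid_add"
  assumes "finite S" "x \<notin> S"
  shows "(\<Sum>zs\<in>permutations_of_set (insert x S). F zs)
    = (\<Sum>ys\<in>permutations_of_set S. \<Sum>i\<le>card S. F (insert_at i x ys))"
  using sum.reindex_bij_betw[OF bij_betw_insert_at[OF assms], of F, symmetric]
  by (simp add: sum.cartesian_product case_prod_unfold)

text \<open>
  A statistic that reacts to the insertion of a smallest entry in a way that depends on its
  value and on the length only has the same distribution on all sets of the same size. That is
  why sums over the permutations of \<open>{1..n}\<close> are enough, although removing the minimum from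
  \<open>{1..Suc n}\<close> leaves another set.
\<close>
lemma sum_permutations_insert_min:
  fixes s :: "nat list \<Rightarrow> nat" and T :: "nat \<Rightarrow> (nat \<Rightarrow> real) \<Rightarrow> nat \<Rightarrow> real"
  assumes T: "\<And>f x ys. (\<And>y. y \<in> set ys \<Longrightarrow> x < y) \<Longrightarrow> distinct ys \<Longrightarrow>
    (\<Sum>i\<le>length ys. f (s (insert_at i x ys))) = T (length ys) f (s ys)"
  shows "(\<Sum>\<pi>\<in>permutations_of_set {1..Suc n}. f (s \<pi>))
    = (\<Sum>\<pi>\<in>permutations_of_set {1..n}. T n f (s \<pi>))"
proof -
  \<comment> \<open>\<open>G k f\<close> is the sum of \<open>f \<circ> s\<close> over the permutations of any set of \<open>k\<close> numbers.\<close>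
  define G where "G = rec_nat (\<lambda>f. f (s [])) (\<lambda>k g f. g (T k f))"
  have G0: "G 0 f = f (s [])" and GS: "G (Suc k) f = G k (T k f)" for k f
    by (simp_all add: G_def)
  have sum_G: "(\<Sum>\<pi>\<in>permutations_of_set S. f (s \<pi>)) = G (card S) f"
    if "finite S" for S :: "nat set" and f
    using that
  proof (induction "card S" arbitrary: S f)
    case 0
    thus ?case by (simp add: G0)
  next
    case (Suc k)
    define x where "x = Min S"
    define S' where "S' = S - {x}"
    have S: "S = insert x S'" "x \<notin> S'" "finite S'" "k = card S'"
    proof -
      have "S \<noteq> {}" using Suc(2) by auto
      hence "x \<in> S" unfolding x_def using Suc(3) by (rule Min_in[rotated])
      thus "S = insert x S'" "x \<notin> S'" "finite S'" "k = card S'"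
        using Suc(2,3) by (auto simp: S'_def)
    qed
    have lt: "x < y" if "y \<in> S'" for y
      using that Suc(3) Min_le[of S y] by (auto simp: S'_def x_def less_le)
    have "(\<Sum>\<pi>\<in>permutations_of_set S. f (s \<pi>))
        = (\<Sum>ys\<in>permutations_of_set S'. \<Sum>i\<le>card S'. f (s (insert_at i x ys)))"
      unfolding S(1) using S by (intro sum_permutations_insert) auto
    also have "\<dots> = (\<Sum>ys\<in>permutations_of_set S'. T (card S') f (s ys))"
    proof (rule sum.cong[OF refl])
      fix ys assume ys: "ys \<in> permutations_of_set S'"
      hence l: "length ys = card S'" "set ys = S'" "distinct ys"
        using S by (auto simp: length_finite_permutations_of_set dest: permutations_of_setD)
      thus "(\<Sum>i\<le>card S'. f (s (insert_at i x ys))) = T (card S') f (s ys)"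
        using T[of ys x f] lt by simp
    qed
    also have "\<dots> = G (card S) f"
      unfolding Suc(1)[OF S(4,3)] using S by (simp add: GS)
    finally show ?case .
  qed
  show ?thesis by (simp add: sum_G GS)
qed

definition perm_avg :: "nat \<Rightarrow> (nat list \<Rightarrow> real) \<Rightarrow> real" where
  "perm_avg n F = (\<Sum>\<pi>\<in>permutations_of_set {1..n}. F \<pi>) / fact n"

text \<open>
  The constants subtracted here and in \<open>centred_valleys\<close> are the means for a uniform
  permutation, for lengths at least 1 and at least 2, respectively.
\<close>
definition centred_ascents :: "nat list \<Rightarrow> real" where
  "centred_ascents \<pi> = real (ascents \<pi>) - (real (length \<pi>) - 1) / 2"

definition centred_valleys :: "nat list \<Rightarrow> real" where
  "centred_valleys \<pi> = real (valleys \<pi>) - (real (length \<pi>) - 2) / 3"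

lemma length_perm: "\<pi> \<in> permutations_of_set {1..n} \<Longrightarrow> length \<pi> = n"
  by (simp add: length_finite_permutations_of_set)

lemma perm_avg_cong:
  "(\<And>\<pi>. \<pi> \<in> permutations_of_set {1..n} \<Longrightarrow> F \<pi> = G \<pi>) \<Longrightarrow> perm_avg n F = perm_avg n G"
  unfolding perm_avg_def by (simp cong: sum.cong)

lemma perm_avg_mono:
  "(\<And>\<pi>. \<pi> \<in> permutations_of_set {1..n} \<Longrightarrow> F \<pi> \<le> G \<pi>) \<Longrightarrow> perm_avg n F \<le> perm_avg n G"
  unfolding perm_avg_def by (intro divide_right_mono sum_mono) auto

lemma perm_avg_const [simp]: "perm_avg n (\<lambda>_. a) = a"
  by (simp add: perm_avg_def)

lemma perm_avg_add: "perm_avg n (\<lambda>\<pi>. F \<pi> + G \<pi>) = perm_avg n F + perm_avg n G"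
  by (simp add: perm_avg_def sum.distrib add_divide_distrib)

lemma perm_avg_diff: "perm_avg n (\<lambda>\<pi>. F \<pi> - G \<pi>) = perm_avg n F - perm_avg n G"
  by (simp add: perm_avg_def sum_subtractf diff_divide_distrib)

lemma perm_avg_cmult: "perm_avg n (\<lambda>\<pi>. a * F \<pi>) = a * perm_avg n F"
  by (simp add: perm_avg_def sum_distrib_left[symmetric])

lemma perm_avg_abs: "\<bar>perm_avg n F\<bar> \<le> perm_avg n (\<lambda>\<pi>. \<bar>F \<pi>\<bar>)"
  by (simp add: perm_avg_def divide_right_mono)

text \<open>
  Averages over longer permutations reduce to averages over shorter ones. This is the transition
  rule of the Markov chain formed by the centred number of ascents; its drift towards 0 is what
  makes the variance \<open>(n + 1) / 12\<close> instead of \<open>n / 4\<close>.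
\<close>
lemma perm_avg_ascents_step:
  "perm_avg (Suc n) (\<lambda>\<pi>. f (centred_ascents \<pi>))
   = perm_avg n (\<lambda>\<pi>. (1 / 2 - centred_ascents \<pi> / real (Suc n)) * f (centred_ascents \<pi> + 1 / 2)
                     + (1 / 2 + centred_ascents \<pi> / real (Suc n)) * f (centred_ascents \<pi> - 1 / 2))"
proof -
  define g where "g = (\<lambda>a::nat. f (real a - real n / 2))"
  define T :: "nat \<Rightarrow> (nat \<Rightarrow> real) \<Rightarrow> nat \<Rightarrow> real" where
    "T = (\<lambda>k f a. (real a + 1) * f a + (real k - real a) * f (a + 1))"
  have "perm_avg (Suc n) (\<lambda>\<pi>. f (centred_ascents \<pi>)) = perm_avg (Suc n) (\<lambda>\<pi>. g (ascents \<pi>))"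
    by (rule perm_avg_cong) (simp add: g_def centred_ascents_def length_perm)
  also have "\<dots> = (\<Sum>\<pi>\<in>permutations_of_set {1..n}. T n g (ascents \<pi>)) / fact (Suc n)"
    unfolding perm_avg_def T_def
    by (subst sum_permutations_insert_min[where s=ascents and T=T and n=n and f=g, unfolded T_def])
       (rule sum_ascents_insert_min, auto)
  also have "\<dots> = perm_avg n (\<lambda>\<pi>. T n g (ascents \<pi>) / real (Suc n))"
    by (simp add: perm_avg_def sum_divide_distrib[symmetric])
  also have "\<dots> = perm_avg n (\<lambda>\<pi>. (1 / 2 - centred_ascents \<pi> / real (Suc n)) * f (centred_ascents \<pi> +
      1 / 2)
                     + (1 / 2 + centred_ascents \<pi> / real (Suc n)) * f (centred_ascents \<pi> - 1 / 2))"
  proof (rule perm_avg_cong)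
    fix \<pi> assume p: "\<pi> \<in> permutations_of_set {1..n}"
    define a where "a = real (ascents \<pi>)"
    have X: "centred_ascents \<pi> = a - (real n - 1) / 2" by (simp add: centred_ascents_def
        length_perm[OF p] a_def)
    have c: "(a + 1) / real (Suc n) = 1 / 2 + centred_ascents \<pi> / real (Suc n)"
      "(real n - a) / real (Suc n) = 1 / 2 - centred_ascents \<pi> / real (Suc n)"
      unfolding X by (simp_all add: field_simps)
    have d: "real (ascents \<pi>) - real n / 2 = centred_ascents \<pi> - 1 / 2"
       "real (ascents \<pi> + 1) - real n / 2 = centred_ascents \<pi> + 1 / 2"
      unfolding X a_def by (simp_all add: field_simps)
    have "T n g (ascents \<pi>) / real (Suc n)
       = (a + 1) / real (Suc n) * g (ascents \<pi>) + (real n - a) / real (Suc n) * g (ascents \<pi> + 1)"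
      unfolding T_def a_def by (subst add_divide_distrib) (simp only: times_divide_eq_left)
    thus "T n g (ascents \<pi>) / real (Suc n) = (1 / 2 - centred_ascents \<pi> / real (Suc n)) * f
        (centred_ascents \<pi> + 1 / 2)
                     + (1 / 2 + centred_ascents \<pi> / real (Suc n)) * f (centred_ascents \<pi> - 1 / 2)"
      unfolding c g_def d by simp
  qed
  finally show ?thesis .
qed

lemma perm_avg_valleys_step:
  assumes "n \<ge> 1"
  shows "perm_avg (Suc n) (\<lambda>\<pi>. f (centred_valleys \<pi>))
   = perm_avg n (\<lambda>\<pi>. (2 / 3 + 2 * centred_valleys \<pi> / real (Suc n)) * f (centred_valleys \<pi> - 1 / 3)
                     + (1 / 3 - 2 * centred_valleys \<pi> / real (Suc n)) * f (centred_valleys \<pi> + 2 / 3))"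
proof -
  have n0: "n \<noteq> 0" using assms by simp
  define g where "g = (\<lambda>a::nat. f (real a - (real n - 1) / 3))"
  define T :: "nat \<Rightarrow> (nat \<Rightarrow> real) \<Rightarrow> nat \<Rightarrow> real" where
    "T = (\<lambda>k f v. if k = 0 then f v
        else (2 * real v + 2) * f v + (real k - 1 - 2 * real v) * f (v + 1))"
  have T: "(\<Sum>i\<le>length ys. f (valleys (insert_at i x ys))) = T (length ys) f (valleys ys)"
    if "\<And>y. y \<in> set ys \<Longrightarrow> x < y" "distinct ys" for f x ys
    using sum_valleys_insert_min[of ys x f] that by (cases ys) (auto simp: T_def)
  have "perm_avg (Suc n) (\<lambda>\<pi>. f (centred_valleys \<pi>)) = perm_avg (Suc n) (\<lambda>\<pi>. g (valleys \<pi>))"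
    by (rule perm_avg_cong) (simp add: g_def centred_valleys_def length_perm)
  also have "\<dots> = (\<Sum>\<pi>\<in>permutations_of_set {1..n}. T n g (valleys \<pi>)) / fact (Suc n)"
    unfolding perm_avg_def by (subst sum_permutations_insert_min[where s=valleys and T=T and n=n and
        f=g, OF T]) auto
  also have "\<dots> = perm_avg n (\<lambda>\<pi>. T n g (valleys \<pi>) / real (Suc n))"
    by (simp add: perm_avg_def sum_divide_distrib[symmetric])
  also have "\<dots> = perm_avg n (\<lambda>\<pi>. (2 / 3 + 2 * centred_valleys \<pi> / real (Suc n)) * f (centred_valleys
      \<pi> - 1 / 3)
                     + (1 / 3 - 2 * centred_valleys \<pi> / real (Suc n)) * f (centred_valleys \<pi> + 2 / 3))"
  proof (rule perm_avg_cong)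
    fix \<pi> assume p: "\<pi> \<in> permutations_of_set {1..n}"
    define a where "a = real (valleys \<pi>)"
    have X: "centred_valleys \<pi> = a - (real n - 2) / 3" by (simp add: centred_valleys_def
        length_perm[OF p] a_def)
    have c: "(2 * a + 2) / real (Suc n) = 2 / 3 + 2 * centred_valleys \<pi> / real (Suc n)"
      "(real n - 1 - 2 * a) / real (Suc n) = 1 / 3 - 2 * centred_valleys \<pi> / real (Suc n)"
      unfolding X by (simp_all add: field_simps)
    have d: "real (valleys \<pi>) - (real n - 1) / 3 = centred_valleys \<pi> - 1 / 3"
       "real (valleys \<pi> + 1) - (real n - 1) / 3 = centred_valleys \<pi> + 2 / 3"
      unfolding X a_def by (simp_all add: field_simps)
    have "T n g (valleys \<pi>) / real (Suc n)
       = (2 * a + 2) / real (Suc n) * g (valleys \<pi>) + (real n - 1 - 2 * a) / real (Suc n) * g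
           (valleys \<pi> + 1)"
      unfolding T_def if_not_P[OF n0] a_def by (subst add_divide_distrib) (simp only:
          times_divide_eq_left)
    thus "T n g (valleys \<pi>) / real (Suc n) = (2 / 3 + 2 * centred_valleys \<pi> / real (Suc n)) * f
        (centred_valleys \<pi> - 1 / 3)
                     + (1 / 3 - 2 * centred_valleys \<pi> / real (Suc n)) * f (centred_valleys \<pi> + 2 / 3)"
      unfolding c g_def d by simp
  qed
  finally show ?thesis .
qed

text \<open>
  The drift can only decrease the second moment, and each step adds \<open>1 / 4\<close>; the true value is
  \<open>(n + 1) / 12\<close> for \<open>n \<ge> 2\<close>, but only the order matters below.
\<close>
lemma perm_avg_ascents_square: "perm_avg n (\<lambda>\<pi>. (centred_ascents \<pi>)\<^sup>2) \<le> (real n + 1) / 4"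
proof (induction n)
  case 0
  thus ?case by (simp add: perm_avg_def centred_ascents_def power2_eq_square)
next
  case (Suc n)
  have "perm_avg (Suc n) (\<lambda>\<pi>. (centred_ascents \<pi>)\<^sup>2) \<le> perm_avg n (\<lambda>\<pi>. (centred_ascents \<pi>)\<^sup>2 + 1 / 4)"
    unfolding perm_avg_ascents_step[where f="\<lambda>x. x\<^sup>2"]
  proof (rule perm_avg_mono)
    fix \<pi>
    define x where "x = centred_ascents \<pi>"
    have "(1 / 2 - x / real (Suc n)) * (x + 1 / 2)\<^sup>2 + (1 / 2 + x / real (Suc n)) * (x - 1 / 2)\<^sup>2
       = x\<^sup>2 + 1 / 4 - 2 * (x\<^sup>2 / real (Suc n))"
      by (simp add: power2_eq_square field_simps del: of_nat_Suc)
    also have "\<dots> \<le> x\<^sup>2 + 1 / 4" by simp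
    finally show "(1 / 2 - centred_ascents \<pi> / real (Suc n)) * (centred_ascents \<pi> + 1 / 2)\<^sup>2 +
         (1 / 2 + centred_ascents \<pi> / real (Suc n)) * (centred_ascents \<pi> - 1 / 2)\<^sup>2
         \<le> (centred_ascents \<pi>)\<^sup>2 + 1 / 4" by (simp add: x_def)
  qed
  with Suc show ?case by (simp add: perm_avg_add)
qed

lemma perm_avg_ascents_mean: "n \<ge> 1 \<Longrightarrow> perm_avg n centred_ascents = 0"
proof (induction n)
  case (Suc n)
  have "(1 / 2 - x / real (Suc n)) * (x + 1 / 2) + (1 / 2 + x / real (Suc n)) * (x - 1 / 2)
      = (1 - 1 / real (Suc n)) * x" for x
    by (simp add: field_simps del: of_nat_Suc)
  hence "perm_avg (Suc n) centred_ascents = perm_avg n (\<lambda>\<pi>. (1 - 1 / real (Suc n)) * centred_ascents \<pi>)"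
    using perm_avg_ascents_step[where f="\<lambda>x. x" and n=n] by simp
  thus ?case using Suc by (cases n) (simp_all add: perm_avg_cmult)
qed simp

text \<open>
  As for ascents: the valley chain drifts to its mean, so each step adds at most a constant.
\<close>
lemma perm_avg_valleys_square: "n \<ge> 1 \<Longrightarrow> perm_avg n (\<lambda>\<pi>. (centred_valleys \<pi>)\<^sup>2) \<le> real n"
proof (induction n rule: dec_induct)
  case base
  show ?case by (simp add: perm_avg_def centred_valleys_def power2_eq_square
      permutations_of_set_singleton)
next
  case (step n)
  have "perm_avg (Suc n) (\<lambda>\<pi>. (centred_valleys \<pi>)\<^sup>2) \<le> perm_avg n (\<lambda>\<pi>. (centred_valleys \<pi>)\<^sup>2 + 1)"
    unfolding perm_avg_valleys_step[OF step(1), where f="\<lambda>x. x\<^sup>2"]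
  proof (rule perm_avg_mono)
    fix \<pi>
    define z where "z = centred_valleys \<pi>"
    have "0 \<le> (z + 1)\<^sup>2 + 11 * z\<^sup>2" by simp
    hence s: "- (2 / 3 * z) - 4 * z\<^sup>2 \<le> 1 / 3" by (simp add: power2_eq_square algebra_simps)
    have "(2 / 3 + 2 * z / real (Suc n)) * (z - 1 / 3)\<^sup>2 + (1 / 3 - 2 * z / real (Suc n)) * (z + 2 /
        3)\<^sup>2
       = z\<^sup>2 + 2 / 9 + (- (2 / 3 * z) - 4 * z\<^sup>2) / real (Suc n)"
      by (simp add: power2_eq_square field_simps del: of_nat_Suc)
    also have "\<dots> \<le> z\<^sup>2 + 2 / 9 + (1 / 3) / real (Suc n)"
      using s by (intro add_left_mono divide_right_mono) auto
    also have "(1 / 3) / real (Suc n) \<le> 1 / 3" by (simp add: field_simps)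
    finally show "(2 / 3 + 2 * centred_valleys \<pi> / real (Suc n)) * (centred_valleys \<pi> - 1 / 3)\<^sup>2 +
         (1 / 3 - 2 * centred_valleys \<pi> / real (Suc n)) * (centred_valleys \<pi> + 2 / 3)\<^sup>2
         \<le> (centred_valleys \<pi>)\<^sup>2 + 1" by (simp add: z_def)
  qed
  with step show ?case by (simp add: perm_avg_add)
qed

lemma centred_ascents_bound:
  assumes "\<pi> \<in> permutations_of_set {1..n}" "n \<ge> 1"
  shows "\<bar>centred_ascents \<pi>\<bar> \<le> (real n - 1) / 2"
  using ascents_le[of \<pi>] assms by (auto simp: centred_ascents_def length_perm abs_le_iff field_simps)

text \<open>
  The transition rule is invariant under \<open>x \<mapsto> - x\<close>, hence so is the distribution.
\<close>
lemma perm_avg_minus_ascents: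
  "n \<ge> 1 \<Longrightarrow> perm_avg n (\<lambda>\<pi>. f (- centred_ascents \<pi>)) = perm_avg n (\<lambda>\<pi>. f (centred_ascents \<pi>))"
proof (induction n arbitrary: f rule: dec_induct)
  case base
  show ?case by (simp add: perm_avg_def centred_ascents_def permutations_of_set_singleton)
next
  case (step n)
  define g where "g = (\<lambda>x. (1 / 2 - x / real (Suc n)) * f (x + 1 / 2) + (1 / 2 + x / real (Suc n)) *
      f (x - 1 / 2))"
  show ?case
    unfolding perm_avg_ascents_step[where f="\<lambda>x. f (- x)"] perm_avg_ascents_step[where f=f]
    using step(3)[of g] unfolding g_def by (simp add: algebra_simps)
qed

section \<open>The law of the shuffle\<close>

text \<open>
  The probability, shelf choices apart, that dealing those of the cards \<open>k, \<dots>, 1\<close> that occur in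
  \<open>b\<close> turns the pile \<open>a\<close> into \<open>b\<close>.
\<close>
fun pile_weight :: "real \<Rightarrow> nat \<Rightarrow> nat list \<Rightarrow> nat list \<Rightarrow> real" where
  "pile_weight p 0 a b = (if a = b then 1 else 0)"
| "pile_weight p (Suc k) a b = (if Suc k \<in> set b
     then p * pile_weight p k (Suc k # a) b + (1 - p) * pile_weight p k (a @ [Suc k]) b
     else pile_weight p k a b)"

lemma pile_weight_eq_0: "\<not> set a \<subseteq> set b \<Longrightarrow> pile_weight p k a b = 0"
  by (induction p k a b rule: pile_weight.induct) auto

lemma pmf_deal_cards_Suc:
  assumes "m \<ge> 1" "0 \<le> p" "p \<le> 1"
  shows "pmf (deal_cards p m (Suc k) piles) g
    = (\<Sum>s=1..m. p * pmf (deal_cards p m k (piles(s := Suc k # piles s))) g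
        + (1 - p) * pmf (deal_cards p m k (piles(s := piles s @ [Suc k]))) g) / real m"
proof -
  have "deal_cards p m (Suc k) piles = bind_pmf (pmf_of_set {1..m}) (\<lambda>s. bind_pmf (bernoulli_pmf p)
     (\<lambda>top. deal_cards p m k (piles(s := (if top then Suc k # piles s else piles s @ [Suc k])))))"
    by (simp add: place_card_def bind_assoc_pmf bind_return_pmf)
  also have "pmf \<dots> g = (\<Sum>s\<in>{1..m}. pmf (bind_pmf (bernoulli_pmf p)
     (\<lambda>top. deal_cards p m k (piles(s := (if top then Suc k # piles s else piles s @ [Suc k]))))) g)
         / real (card {1..m})"
    by (rule pmf_bind_pmf_of_set) (use assms in auto)
  also have "\<dots> = (\<Sum>s=1..m. p * pmf (deal_cards p m k (piles(s := Suc k # piles s))) g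
        + (1 - p) * pmf (deal_cards p m k (piles(s := piles s @ [Suc k]))) g) / real m"
    using assms by (simp add: pmf_bind mult.commute)
  finally show ?thesis .
qed

text \<open>
  Once the final piles \<open>g\<close> are fixed, the shelf of every card is known, so the sum over shelves
  has a single nonzero term in every step and the probability factors over the shelves.
\<close>
lemma pmf_deal_cards:
  assumes "m \<ge> 1" "0 \<le> p" "p \<le> 1"
  assumes "\<And>s. s \<notin> {1..m} \<Longrightarrow> g s = piles s"
    and "\<And>j. j \<in> {1..k} \<Longrightarrow> \<exists>!s. s \<in> {1..m} \<and> j \<in> set (g s)"
  shows "pmf (deal_cards p m k piles) g = (\<Prod>s=1..m. pile_weight p k (piles s) (g s)) / real m ^ k"
  using assms(4,5)
proof (induction k arbitrary: piles)
  case 0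
  have "(\<Prod>s=1..m. pile_weight p 0 (piles s) (g s)) = (if piles = g then 1 else 0)"
  proof (cases "piles = g")
    case False
    then obtain s where "piles s \<noteq> g s" by auto
    moreover from this have "s \<in> {1..m}" using 0(1)[of s] by metis
    ultimately show ?thesis using False by (auto intro!: prod_zero bexI[of _ s])
  qed auto
  thus ?case by (auto simp: pmf_return indicator_def)
next
  case (Suc k)
  obtain t where t: "t \<in> {1..m}" "Suc k \<in> set (g t)"
    and u: "\<And>s. s \<in> {1..m} \<Longrightarrow> Suc k \<in> set (g s) \<Longrightarrow> s = t"
    using Suc.prems(2)[of "Suc k"] by auto
  define W where "W = (\<lambda>q. \<Prod>s=1..m. pile_weight p k (q s) (g s))"
  have IH: "pmf (deal_cards p m k (piles(s := x))) g = W (piles(s := x)) / real m ^ k"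
    if "s \<in> {1..m}" for s x
    unfolding W_def using that Suc.prems by (intro Suc.IH) auto
  have W0: "W (piles(s := x)) = 0" if "s \<in> {1..m}" "s \<noteq> t" "Suc k \<in> set x" for s x
    unfolding W_def using that u[of s]
    by (intro prod_zero bexI[of _ s]) (auto intro!: pile_weight_eq_0)
  have Wt: "W (piles(t := x)) = pile_weight p k x (g t) * (\<Prod>s\<in>{1..m}-{t}. pile_weight p (Suc k)
      (piles s) (g s))" for x
  proof -
    have "W (piles(t := x)) = pile_weight p k x (g t) * (\<Prod>s\<in>{1..m}-{t}. pile_weight p k ((piles(t :=
        x)) s) (g s))"
      unfolding W_def using t by (subst prod.remove[of _ t]) auto
    also have "(\<Prod>s\<in>{1..m}-{t}. pile_weight p k ((piles(t := x)) s) (g s))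
        = (\<Prod>s\<in>{1..m}-{t}. pile_weight p (Suc k) (piles s) (g s))"
      using u by (intro prod.cong) auto
    finally show ?thesis .
  qed
  have "pmf (deal_cards p m (Suc k) piles) g
    = (\<Sum>s=1..m. p * (W (piles(s := Suc k # piles s)) / real m ^ k)
        + (1 - p) * (W (piles(s := piles s @ [Suc k])) / real m ^ k)) / real m"
    unfolding pmf_deal_cards_Suc[OF assms(1-3)] using IH by simp
  also have "(\<Sum>s=1..m. p * (W (piles(s := Suc k # piles s)) / real m ^ k)
        + (1 - p) * (W (piles(s := piles s @ [Suc k])) / real m ^ k))
      = (\<Sum>s\<in>{t}. p * (W (piles(s := Suc k # piles s)) / real m ^ k)
        + (1 - p) * (W (piles(s := piles s @ [Suc k])) / real m ^ k))"
    using t W0 by (intro sum.mono_neutral_right) auto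
  also have "\<dots> = (p * W (piles(t := Suc k # piles t)) + (1 - p) * W (piles(t := piles t @ [Suc k])))
      / real m ^ k"
    by (simp add: add_divide_distrib)
  also have "p * W (piles(t := Suc k # piles t)) + (1 - p) * W (piles(t := piles t @ [Suc k]))
     = pile_weight p (Suc k) (piles t) (g t) * (\<Prod>s\<in>{1..m}-{t}. pile_weight p (Suc k) (piles s) (g s))"
    unfolding Wt using t by (simp add: algebra_simps)
  also have "\<dots> = (\<Prod>s=1..m. pile_weight p (Suc k) (piles s) (g s))"
    using t by (subst prod.remove[of _ t]) auto
  finally show ?case by simp
qed

fun descending :: "nat list \<Rightarrow> bool" where
  "descending (x # y # r) \<longleftrightarrow> y < x \<and> descending (y # r)"
| "descending _ \<longleftrightarrow> True"

text \<open>
  The weight of an increasing run followed by a decreasing run: one factor \<open>p\<close> per ascent and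
  \<open>1 - p\<close> per descent. The card at the peak contributes \<open>p + (1 - p) = 1\<close>, since it may belong
  to either run.
\<close>
fun block_weight :: "real \<Rightarrow> nat list \<Rightarrow> real" where
  "block_weight p (x # y # r) = (if x < y then p * block_weight p (y # r)
      else if descending (x # y # r) then (1 - p) * block_weight p (y # r) else 0)"
| "block_weight p _ = 1"

lemma descending_snoc:
  "descending (a @ [x]) \<longleftrightarrow> descending a \<and> (a = [] \<or> x < last a)"
  by (induction a rule: descending.induct) auto

lemma block_weight_snoc_min:
  assumes "a \<noteq> []" "\<And>y. y \<in> set a \<Longrightarrow> x < y"
  shows "block_weight p (a @ [x]) = (1 - p) * block_weight p a"
  using assms
proof (induction p a rule: block_weight.induct)
  case (1 p u v r)
  have "x < last (v # r)" using 1(4) by (metis last_ConsR last_in_set list.distinct(1)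
      set_subset_Cons subsetD)
  hence "descending (u # v # r @ [x]) = descending (u # v # r)"
    using descending_snoc[of "u # v # r" x] by simp
  thus ?case using 1 by auto
next
  case ("2_2" p v)
  thus ?case by (auto simp: not_less_iff_gr_or_eq)
qed auto

lemma block_weight_cons_min:
  assumes "a \<noteq> []" "\<And>y. y \<in> set a \<Longrightarrow> x < y"
  shows "block_weight p (x # a) = p * block_weight p a"
  using assms by (cases a) auto

text \<open>
  A minimum in the interior would have a descent before it and an ascent after it, which no pile
  has.
\<close>
lemma block_weight_interior_min:
  assumes "a \<noteq> []" "c \<noteq> []" "\<And>y. y \<in> set (a @ c) \<Longrightarrow> x < y"
  shows "block_weight p (a @ x # c) = 0"
  using assms
proof (induction p a rule: block_weight.induct)
  case (1 p u v r)
  have "\<not> descending (u # v # r @ x # c)"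
  proof
    assume "descending (u # v # r @ x # c)"
    hence "descending ((u # v # r) @ [x] @ c)" by simp
    moreover have "descending (l @ c') \<Longrightarrow> descending c'" for l c'
      by (induction l rule: descending.induct) (auto elim: descending.elims)
    ultimately have "descending (x # c)" by (metis append_Cons append_Nil)
    thus False using 1(4) 1(5)[of "hd c"] by (cases c) auto
  qed
  thus ?case using 1 by auto
next
  case ("2_2" p v)
  have "x < v" using "2_2" by auto
  moreover have "x < hd c" using "2_2"(2) "2_2"(3)[of "hd c"] by simp
  ultimately show ?case using "2_2"(2) by (cases c) auto
qed auto

text \<open>
  Dealing small cards does not change the relative order of the large ones.
\<close>
lemma pile_weight_nonzero_filter:
  "pile_weight p k a b \<noteq> 0 \<Longrightarrow> filter (\<lambda>y. k < y) b = filter (\<lambda>y. k < y) a"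
proof (induction p k a b rule: pile_weight.induct)
  case (2 p k a b)
  have ff: "filter ((<) (Suc k)) (filter ((<) k) l) = filter ((<) (Suc k)) l" for l
    by (auto simp: filter_filter intro: filter_cong)
  from 2(4) consider "pile_weight p k (Suc k # a) b \<noteq> 0" "Suc k \<in> set b" | "pile_weight p k (a @
      [Suc k]) b \<noteq> 0" "Suc k \<in> set b"
    | "pile_weight p k a b \<noteq> 0" "Suc k \<notin> set b"
    by (metis add_0 mult_zero_right pile_weight.simps(2))
  thus ?case
  proof cases
    case 1
    from 2(1)[OF 1(2,1)] show ?thesis using ff[of b] ff[of "Suc k # a"] by simp
  next
    case c: 2
    from 2(2)[OF c(2,1)] show ?thesis using ff[of b] ff[of "a @ [Suc k]"] by simp
  next
    case 3
    from 2(3)[OF 3(2,1)] show ?thesis using ff[of b] ff[of a] by simp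
  qed
qed (auto split: if_splits)

text \<open>
  When the cards above \<open>k\<close> have been dealt, the only pile that can still lead to \<open>b\<close> is the
  restriction of \<open>b\<close> to these cards. The next card, being the smallest so far, must then be at
  an end of the next restriction: at the left end it was placed on top, at the right end at the
  bottom, and in an empty pile both cases count.
\<close>
lemma pile_weight_block_weight:
  assumes "distinct b" "a = filter (\<lambda>y. k < y) b" "0 \<notin> set b"
  shows "block_weight p a * pile_weight p k a b = block_weight p b"
  using assms(2)
proof (induction k arbitrary: a)
  case 0
  have "filter ((<) 0) b = b" using assms(3) by (auto simp: filter_id_conv intro: gr0I)
  thus ?case using 0 by simp
next
  case (Suc k)
  define b' where "b' = filter (\<lambda>y. k < y) b"
  have IH: "block_weight p b' * pile_weight p k b' b = block_weight p b"
    by (rule Suc.IH) (simp add: b'_def)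
  have db: "distinct b'" using assms(1) by (simp add: b'_def)
  have a: "a = filter (\<lambda>y. y \<noteq> Suc k) b'"
    unfolding Suc.prems b'_def filter_filter by (rule filter_cong) auto
  have zero: "pile_weight p k l b = 0" if "l \<noteq> b'" "\<And>y. y \<in> set l \<Longrightarrow> k < y" for l
  proof (rule ccontr)
    assume "pile_weight p k l b \<noteq> 0"
    from pile_weight_nonzero_filter[OF this] have "b' = filter (\<lambda>y. k < y) l" by (simp add: b'_def)
    also have "\<dots> = l" using that(2) by (simp add: filter_id_conv)
    finally show False using that(1) by simp
  qed
  show ?case
  proof (cases "Suc k \<in> set b")
    case False
    have "filter (\<lambda>y. y \<noteq> Suc k) b' = b'" by (intro filter_True) (use False in \<open>auto simp: b'_def\<close>)
    hence "a = b'" unfolding a .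
    thus ?thesis using IH False by simp
  next
    case True
    hence "Suc k \<in> set b'" by (simp add: b'_def)
    then obtain u v where uv: "b' = u @ Suc k # v" by (meson split_list)
    have nin: "Suc k \<notin> set u" "Suc k \<notin> set v" using db uv by auto
    have "filter (\<lambda>y. y \<noteq> Suc k) u = u" "filter (\<lambda>y. y \<noteq> Suc k) v = v"
      by (intro filter_True; use nin in auto)+
    hence a2: "a = u @ v" unfolding a uv by simp
    have gt: "Suc k < y" if "y \<in> set u \<union> set v" for y
    proof -
      have "set a = {y \<in> set b. Suc k < y}" by (simp add: Suc.prems)
      moreover have "set a = set u \<union> set v" by (simp add: a2)
      ultimately show ?thesis using that by blast
    qed
    have st: "pile_weight p (Suc k) a b = p * pile_weight p k (Suc k # a) b + (1 - p) * pile_weight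
        p k (a @ [Suc k]) b"
      using True by simp
    have za: "pile_weight p k (Suc k # a) b = 0" if "Suc k # a \<noteq> b'"
      by (rule zero[OF that]) (use gt in \<open>auto simp: a2 dest: Suc_lessD\<close>)
    have zb: "pile_weight p k (a @ [Suc k]) b = 0" if "a @ [Suc k] \<noteq> b'"
      by (rule zero[OF that]) (use gt in \<open>auto simp: a2 dest: Suc_lessD\<close>)
    consider "u = []" "v = []" | "u = []" "v \<noteq> []" | "u \<noteq> []" "v = []" | "u \<noteq> []" "v \<noteq> []" by blast
    thus ?thesis
    proof cases
      case 1
      thus ?thesis using IH True unfolding st a2 uv by (simp add: algebra_simps)
    next
      case 2
      have ne: "a @ [Suc k] \<noteq> b'" unfolding uv a2 using 2 nin by (cases v) auto
      have "block_weight p b' = p * block_weight p a"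
        unfolding uv a2 using 2 gt by (simp add: block_weight_cons_min)
      moreover have eb: "b' = Suc k # a" unfolding uv a2 using 2 by simp
      ultimately have "p * block_weight p a * pile_weight p k (Suc k # a) b = block_weight p b"
        using IH by simp
      thus ?thesis unfolding st zb[OF ne] by (simp add: mult_ac)
    next
      case 3
      have ne: "Suc k # a \<noteq> b'" unfolding uv a2 using 3 nin by (cases u) auto
      have "block_weight p b' = (1 - p) * block_weight p a"
        unfolding uv a2 using 3 gt by (simp add: block_weight_snoc_min)
      moreover have eb: "b' = a @ [Suc k]" unfolding uv a2 using 3 by simp
      ultimately have "(1 - p) * block_weight p a * pile_weight p k (a @ [Suc k]) b = block_weight p b"
        using IH by simp
      thus ?thesis unfolding st za[OF ne] by (simp add: mult_ac)
    next
      case 4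
      have ne: "Suc k # a \<noteq> b'" unfolding uv a2 using 4 nin by (cases u) auto
      have ne': "a @ [Suc k] \<noteq> b'"
      proof
        assume "a @ [Suc k] = b'"
        hence "last (u @ Suc k # v) = Suc k" unfolding uv by (metis last_snoc)
        thus False using 4 nin by (auto split: if_splits dest: last_in_set)
      qed
      have "block_weight p b' = 0"
        unfolding uv using 4 gt by (intro block_weight_interior_min) auto
      thus ?thesis using IH za[OF ne] zb[OF ne'] unfolding st by simp
    qed
  qed
qed

lemma pile_weight_Nil:
  assumes "distinct b" "set b \<subseteq> {1..n}"
  shows "pile_weight p n [] b = block_weight p b"
proof -
  have "filter (\<lambda>y. n < y) b = []" using assms by (auto simp: filter_empty_conv not_less)
  hence "[] = filter (\<lambda>y. n < y) b" by simp
  from pile_weight_block_weight[OF assms(1) this, of p] show ?thesis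
    using assms(2) by (metis atLeastAtMost_iff block_weight.simps(2) mult_1 not_one_le_zero subsetD)
qed

text \<open>
  A way to deal \<open>\<pi>\<close> to \<open>m\<close> shelves is a list of \<open>m\<close> possibly empty blocks.
\<close>
definition deals :: "nat \<Rightarrow> 'a list \<Rightarrow> 'a list list set" where
  "deals m \<pi> = {gs. length gs = m \<and> concat gs = \<pi>}"

definition deal_weight :: "real \<Rightarrow> nat \<Rightarrow> nat list \<Rightarrow> real" where
  "deal_weight p m \<pi> = (\<Sum>gs\<in>deals m \<pi>. \<Prod>g\<leftarrow>gs. block_weight p g)"

lemma finite_deals: "finite (deals m \<pi>)"
proof (rule finite_subset)
  have "length g \<le> length (concat gs)" if "g \<in> set gs" for g and gs :: "'a list list"
    using that by (induction gs) auto
  thus "deals m \<pi> \<subseteq> {gs. set gs \<subseteq> {g. set g \<subseteq> set \<pi> \<and> length g \<le> length \<pi>} \<and> length gs = m}"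
    by (auto simp: deals_def)
  show "finite {gs. set gs \<subseteq> {g. set g \<subseteq> set \<pi> \<and> length g \<le> length \<pi>} \<and> length gs = m}"
    by (intro finite_lists_length_eq finite_lists_length_le) auto
qed

lemma set_pmf_deal_cards_Suc:
  assumes "g \<in> set_pmf (deal_cards p m (Suc k) piles)" "m \<ge> 1"
  obtains t x where "t \<in> {1..m}" "mset x = add_mset (Suc k) (mset (piles t))"
    "g \<in> set_pmf (deal_cards p m k (piles(t := x)))"
proof -
  obtain t b where t: "t \<in> {1..m}"
    and "g \<in> set_pmf (deal_cards p m k (piles(t := (if b then Suc k # piles t else piles t @ [Suc
        k]))))"
    using assms by (auto simp: place_card_def set_pmf_of_set simp del: fun_upd_apply)
  thus thesis using that[OF t, of "if b then Suc k # piles t else piles t @ [Suc k]"] by auto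
qed

lemma deal_cards_outside:
  assumes "g \<in> set_pmf (deal_cards p m k piles)" "m \<ge> 1" "s \<notin> {1..m}"
  shows "g s = piles s"
  using assms(1)
proof (induction k arbitrary: piles)
  case (Suc k)
  obtain t x where t: "t \<in> {1..m}" "g \<in> set_pmf (deal_cards p m k (piles(t := x)))"
    using set_pmf_deal_cards_Suc[OF Suc.prems assms(2)] by blast
  have "g s = (piles(t := x)) s" by (rule Suc.IH[OF t(2)])
  thus ?case using t(1) assms(3) by (auto split: if_splits)
qed simp

text \<open>
  No card is lost or duplicated; this is why the shuffled deck is a permutation.
\<close>
lemma mset_deal_cards:
  fixes piles g :: "nat \<Rightarrow> nat list"
  assumes "g \<in> set_pmf (deal_cards p m k piles)" "m \<ge> 1"
  shows "(\<Sum>s=1..m. mset (g s)) = (\<Sum>s=1..m. mset (piles s)) + mset [1..<Suc k]"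
  using assms(1)
proof (induction k arbitrary: piles)
  case (Suc k)
  obtain t x where t: "t \<in> {1..m}" "mset x = add_mset (Suc k) (mset (piles t))"
      "g \<in> set_pmf (deal_cards p m k (piles(t := x)))"
    using set_pmf_deal_cards_Suc[OF Suc.prems assms(2)] by blast
  have "(\<Sum>s=1..m. mset ((piles(t := x)) s)) = mset x + (\<Sum>s\<in>{1..m}-{t}. mset (piles s))"
    using t(1) by (subst sum.remove[of _ t]) (auto intro!: sum.cong)
  moreover have "(\<Sum>s=1..m. mset (piles s)) = mset (piles t) + (\<Sum>s\<in>{1..m}-{t}. mset (piles s))"
    using t(1) by (subst sum.remove[of _ t]) auto
  ultimately have "(\<Sum>s=1..m. mset ((piles(t := x)) s)) = add_mset (Suc k) (\<Sum>s=1..m. mset (piles s))"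
    using t(2) by simp
  thus ?case using Suc.IH[OF t(3)] by simp
qed simp

lemma mset_join: "mset (concat (map h [1..<Suc m])) = (\<Sum>s=1..m. mset (h s))"
  by (induction m) (simp_all add: add.commute)

lemma set_pmf_shelf_shuffle:
  assumes "m \<ge> 1" shows "set_pmf (shelf_shuffle p n m) \<subseteq> permutations_of_set {1..n}"
proof
  fix \<pi> assume "\<pi> \<in> set_pmf (shelf_shuffle p n m)"
  then obtain g where g: "g \<in> set_pmf (deal_cards p m n (\<lambda>_. []))" "\<pi> = concat (map g [1..<Suc m])"
    by (auto simp: shelf_shuffle_def)
  hence "mset \<pi> = mset [1..<Suc n]" using mset_deal_cards[OF g(1) assms] unfolding g(2) mset_join by
      simp
  hence "set \<pi> = {1..n}" "distinct \<pi>"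
    by (metis set_mset_mset set_upt atLeastLessThanSuc_atLeastAtMost, metis mset_eq_imp_distinct_iff
        distinct_upt)
  thus "\<pi> \<in> permutations_of_set {1..n}" by (intro permutations_of_setI)
qed

lemma concat_nth_unique:
  assumes "distinct (concat gs)" "i < length gs" "j < length gs" "x \<in> set (gs ! i)" "x \<in> set (gs ! j)"
  shows "i = j"
proof -
  have *: False if "i < j" "j < length gs" "x \<in> set (gs ! i)" "x \<in> set (gs ! j)" for i j
  proof -
    have "concat gs = concat (take j gs) @ concat (drop j gs)"
      by (metis append_take_drop_id concat_append)
    moreover have "gs ! i \<in> set (take j gs)" using that by (auto simp: in_set_conv_nth)
    moreover have "gs ! j \<in> set (drop j gs)" using that by (metis Cons_nth_drop_Suc list.set_intros(1))
    ultimately show False using assms(1) that by auto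
  qed
  show ?thesis using *[of i j] *[of j i] assms by (cases i j rule: linorder_cases) auto
qed

text \<open>
  The decks that equal \<open>\<pi>\<close> arise from the final piles that cut \<open>\<pi>\<close> into \<open>m\<close> blocks; the
  probability of each of them is given by \<open>pmf_deal_cards\<close> and \<open>pile_weight_Nil\<close>.
\<close>
lemma pmf_shelf_shuffle_deal_weight:
  assumes "m \<ge> 1" "0 \<le> p" "p \<le> 1" "\<pi> \<in> permutations_of_set {1..n}"
  shows "pmf (shelf_shuffle p n m) \<pi> = deal_weight p m \<pi> / real m ^ n"
proof -
  define D where "D = deal_cards p m n (\<lambda>_. [])"
  define joined where "joined = (\<lambda>g :: nat \<Rightarrow> nat list. concat (map g [1..<Suc m]))"
  define piles where "piles = (\<lambda>gs :: nat list list. \<lambda>s. if s \<in> {1..m} then gs ! (s - 1) else [])"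
  have \<pi>: "set \<pi> = {1..n}" "distinct \<pi>" using assms(4) by (auto dest: permutations_of_setD)
  have map_piles: "map (piles gs) [1..<Suc m] = gs" if "length gs = m" for gs
    using that by (intro nth_equalityI) (auto simp: piles_def simp del: upt_Suc)
  have inj: "inj_on piles (deals m \<pi>)"
    by (rule inj_onI) (metis (mono_tags, lifting) deals_def map_piles mem_Collect_eq)
  have pre: "joined -` {\<pi>} \<inter> set_pmf D = piles ` deals m \<pi> \<inter> set_pmf D"
  proof (intro equalityI subsetI)
    fix g assume g: "g \<in> joined -` {\<pi>} \<inter> set_pmf D"
    define gs where "gs = map g [1..<Suc m]"
    have "gs \<in> deals m \<pi>" using g by (auto simp: deals_def gs_def joined_def simp del: upt_Suc)
    moreover have "g = piles gs"
    proof
      fix s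
      show "g s = piles gs s"
      proof (cases "s \<in> {1..m}")
        case False
        thus ?thesis using deal_cards_outside[of g p m n "\<lambda>_. []" s] g assms
          by (auto simp: piles_def D_def)
      qed (auto simp: piles_def gs_def simp del: upt_Suc)
    qed
    ultimately show "g \<in> piles ` deals m \<pi> \<inter> set_pmf D" using g by auto
  next
    fix g assume "g \<in> piles ` deals m \<pi> \<inter> set_pmf D"
    thus "g \<in> joined -` {\<pi>} \<inter> set_pmf D"
      using map_piles by (auto simp: joined_def deals_def simp del: upt_Suc)
  qed
  have one: "pmf D (piles gs) = (\<Prod>g\<leftarrow>gs. block_weight p g) / real m ^ n" if "gs \<in> deals m \<pi>" for gs
  proof -
    have gs: "length gs = m" "concat gs = \<pi>" using that by (auto simp: deals_def)
    have sub: "set (gs ! i) \<subseteq> {1..n}" "distinct (gs ! i)" if "i < m" for i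
    proof -
      have "gs ! i \<in> set gs" using that gs by simp
      moreover have "set (concat gs) = {1..n}" "distinct (concat gs)" using \<pi> gs by simp_all
      ultimately show "set (gs ! i) \<subseteq> {1..n}" "distinct (gs ! i)" by (auto simp: distinct_concat_iff)
    qed
    have "pmf D (piles gs) = (\<Prod>s=1..m. pile_weight p n [] (piles gs s)) / real m ^ n"
      unfolding D_def
    proof (rule pmf_deal_cards[OF assms(1-3)])
      fix j assume "j \<in> {1..n}"
      hence "j \<in> set (concat gs)" using gs \<pi> by simp
      then obtain g where "g \<in> set gs" "j \<in> set g" by auto
      then obtain i where i: "i < m" "j \<in> set (gs ! i)" using gs by (metis in_set_conv_nth)
      show "\<exists>!s. s \<in> {1..m} \<and> j \<in> set (piles gs s)"
      proof (rule ex1I[of _ "Suc i"])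
        fix s assume s: "s \<in> {1..m} \<and> j \<in> set (piles gs s)"
        hence "s - 1 = i" using i \<pi> gs by (intro concat_nth_unique[of gs]) (auto simp: piles_def)
        thus "s = Suc i" using s by auto
      qed (use i in \<open>auto simp: piles_def\<close>)
    qed (auto simp: piles_def)
    also have "(\<Prod>s=1..m. pile_weight p n [] (piles gs s)) = (\<Prod>s=1..m. block_weight p (gs ! (s - 1)))"
    proof (rule prod.cong[OF refl])
      fix s assume "s \<in> {1..m}"
      hence "s - 1 < m" "piles gs s = gs ! (s - 1)" by (auto simp: piles_def)
      thus "pile_weight p n [] (piles gs s) = block_weight p (gs ! (s - 1))"
        using pile_weight_Nil[OF sub(2,1)] by simp
    qed
    also have "\<dots> = (\<Prod>i=0..<m. block_weight p (gs ! i))"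
      by (rule prod.reindex_bij_witness[of _ Suc "\<lambda>s. s - 1"]) auto
    also have "\<dots> = (\<Prod>g\<leftarrow>gs. block_weight p g)"
      using gs by (simp add: prod.list_conv_set_nth)
    finally show ?thesis .
  qed
  have "pmf (shelf_shuffle p n m) \<pi> = measure (measure_pmf D) (joined -` {\<pi>})"
    by (simp add: shelf_shuffle_def pmf_map D_def joined_def)
  also have "\<dots> = measure (measure_pmf D) (piles ` deals m \<pi>)"
    using pre by (metis measure_Int_set_pmf)
  also have "\<dots> = (\<Sum>g\<in>piles ` deals m \<pi>. pmf D g)"
    by (intro measure_measure_pmf_finite finite_imageI finite_deals)
  also have "\<dots> = (\<Sum>gs\<in>deals m \<pi>. pmf D (piles gs))"
    using inj by (simp add: sum.reindex)
  also have "\<dots> = deal_weight p m \<pi> / real m ^ n"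
    by (simp add: one deal_weight_def sum_divide_distrib)
  finally show ?thesis .
qed

lemma deal_weight_0: "deal_weight p 0 \<pi> = (if \<pi> = [] then 1 else 0)"
proof -
  have "deals 0 \<pi> = (if \<pi> = [] then {[]} else {})" by (auto simp: deals_def)
  thus ?thesis by (simp add: deal_weight_def)
qed

lemma deal_weight_Suc:
  "deal_weight p (Suc m) \<pi> = (\<Sum>i\<le>length \<pi>. block_weight p (take i \<pi>) * deal_weight p m (drop i \<pi>))"
proof -
  have "deal_weight p (Suc m) \<pi>
      = (\<Sum>(i, gs)\<in>(SIGMA i:{..length \<pi>}. deals m (drop i \<pi>)). \<Prod>g\<leftarrow>take i \<pi> # gs. block_weight p g)"
    unfolding deal_weight_def
  proof (rule sum.reindex_bij_witness[of _ "\<lambda>(i, gs). take i \<pi> # gs" "\<lambda>gs. (length (hd gs), tl gs)"])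
    fix gs assume "gs \<in> deals (Suc m) \<pi>"
    then obtain g gs' where gs: "gs = g # gs'" "length gs' = m" "g @ concat gs' = \<pi>"
      by (cases gs) (auto simp: deals_def)
    thus "(case (length (hd gs), tl gs) of (i, gs) \<Rightarrow> take i \<pi> # gs) = gs"
      "(length (hd gs), tl gs) \<in> (SIGMA i:{..length \<pi>}. deals m (drop i \<pi>))"
      "(case (length (hd gs), tl gs) of (i, gs) \<Rightarrow> \<Prod>g\<leftarrow>take i \<pi> # gs. block_weight p g) = (\<Prod>g\<leftarrow>gs.
          block_weight p g)"
      by (auto simp: deals_def)
  qed (auto simp: deals_def)
  also have "\<dots> = (\<Sum>i\<le>length \<pi>. \<Sum>gs\<in>deals m (drop i \<pi>). \<Prod>g\<leftarrow>take i \<pi> # gs. block_weight p g)"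
    by (subst sum.Sigma) (auto intro: finite_deals)
  also have "\<dots> = (\<Sum>i\<le>length \<pi>. block_weight p (take i \<pi>) * deal_weight p m (drop i \<pi>))"
    by (simp add: deal_weight_def sum_distrib_left)
  finally show ?thesis .
qed

text \<open>
  The coefficient of \<open>X\<^sup>j\<close> in \<open>join_poly p \<pi>\<close> is the total weight of the ways to write \<open>\<pi>\<close> as a
  sequence of \<open>length \<pi> - j\<close> nonempty blocks, that is, to join neighbours at \<open>j\<close> places. The
  second polynomial counts only the ways whose first block is decreasing, as required when a
  larger entry is to be joined to it from the left.
\<close>
fun join_poly desc_join_poly :: "real \<Rightarrow> nat list \<Rightarrow> real poly" where
  "join_poly p (x # y # r) = join_poly p (y # r)
     + (if x < y then [:0, p:] * join_poly p (y # r) else [:0, 1 - p:] * desc_join_poly p (y # r))"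
| "join_poly p _ = 1"
| "desc_join_poly p (x # y # r) = join_poly p (y # r)
     + (if x < y then 0 else [:0, 1 - p:] * desc_join_poly p (y # r))"
| "desc_join_poly p _ = 1"

lemma sum_Suc_shift: "(\<Sum>i=1..Suc n. f i) = f 1 + (\<Sum>i=1..n. f (Suc i))"
  for f :: "nat \<Rightarrow> 'a::comm_monoid_add"
proof -
  have "(\<Sum>i=1..Suc n. f i) = f 1 + (\<Sum>i=Suc 1..Suc n. f i)"
    by (rule sum.atLeast_Suc_atMost) simp
  thus ?thesis by (simp only: sum.shift_bounds_cl_Suc_ivl)
qed

lemma smult_sum_right: "smult c (\<Sum>x\<in>A. f x) = (\<Sum>x\<in>A. smult c (f x))"
  by (induction A rule: infinite_finite_induct) (auto simp: smult_add_right)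

text \<open>
  Splitting off the first block; the factor \<open>X\<close> accounts for the fact that a block of length \<open>i\<close>
  has only \<open>i - 1\<close> joins.
\<close>
lemma join_poly_first_block:
  assumes "\<pi> \<noteq> []" "distinct \<pi>"
  shows "[:0, 1:] * join_poly p \<pi>
      = (\<Sum>i=1..length \<pi>. smult (block_weight p (take i \<pi>)) (monom 1 i * join_poly p (drop i \<pi>)))
    \<and> [:0, 1:] * desc_join_poly p \<pi>
      = (\<Sum>i=1..length \<pi>. if descending (take i \<pi>)
          then smult (block_weight p (take i \<pi>)) (monom 1 i * join_poly p (drop i \<pi>)) else 0)"
  using assms
proof (induction \<pi> rule: ascents.induct)
  case (1 x y r)
  define t where "t = (\<lambda>i. smult (block_weight p (take i (y # r))) (monom 1 i * join_poly p (drop i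
      (y # r))))"
  define d where "d = (\<lambda>i. descending (take i (y # r)))"
  define u where "u = (\<lambda>i. if d i then t i else 0)"
  have IH: "[:0, 1:] * join_poly p (y # r) = (\<Sum>i=1..length (y # r). t i)"
     "[:0, 1:] * desc_join_poly p (y # r) = (\<Sum>i=1..length (y # r). u i)"
  proof -
    have "y # r \<noteq> []" "distinct (y # r)" using 1(3) by auto
    from 1(1)[OF this] show "[:0, 1:] * join_poly p (y # r) = (\<Sum>i=1..length (y # r). t i)"
      "[:0, 1:] * desc_join_poly p (y # r) = (\<Sum>i=1..length (y # r). u i)"
      unfolding t_def d_def u_def by blast+
  qed
  have step: "smult (block_weight p (take (Suc i) (x # y # r))) (monom 1 (Suc i) * join_poly p (drop
      (Suc i) (x # y # r)))
      = [:0, 1:] * (if x < y then smult p (t i) else smult (1 - p) (u i))"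
    if "i \<in> {1..length (y # r)}" for i
    using that 1(3)
    by (cases i) (auto simp: t_def d_def u_def monom_Suc mult.assoc)
  have dstep: "descending (take (Suc i) (x # y # r)) \<longleftrightarrow> \<not> x < y \<and> d i" if "i \<in> {1..length (y # r)}" for i
    using that 1(3) by (cases i) (auto simp: d_def)
  have c: "smult a ([:0, 1:] * q) = [:0, a:] * q" for a :: real and q by simp
  have len: "length (x # y # r) = Suc (length (y # r))" by simp
  have first: "smult (block_weight p (take 1 (x # y # r))) (monom 1 1 * join_poly p (drop 1 (x # y #
      r)))
     = [:0, 1:] * join_poly p (y # r)" by (simp add: monom_Suc monom_0)
  show ?case unfolding len sum_Suc_shift first
  proof (intro conjI)
    have "(\<Sum>i = 1..length (y # r). smult (block_weight p (take (Suc i) (x # y # r))) (monom 1 (Suc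
        i) * join_poly p (drop (Suc i) (x # y # r))))
      = (\<Sum>i = 1..length (y # r). [:0, 1:] * (if x < y then smult p (t i) else smult (1 - p) (u i)))"
      by (rule sum.cong[OF refl step])
    also have "\<dots> = [:0, 1:] * (if x < y then smult p (\<Sum>i=1..length (y # r). t i)
         else smult (1 - p) (\<Sum>i=1..length (y # r). u i))"
      by (cases "x < y") (simp_all only: if_True if_False smult_sum_right sum_distrib_left
          mult_zero_right sum.neutral_const)
    also have "\<dots> = [:0, 1:] * (join_poly p (x # y # r) - join_poly p (y # r))"
      unfolding IH[symmetric] by (cases "x < y")
        (simp_all only: c if_True if_False join_poly.simps desc_join_poly.simps add_diff_cancel_left')
    finally show "[:0, 1:] * join_poly p (x # y # r) = [:0, 1:] * join_poly p (y # r)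
       + (\<Sum>i = 1..length (y # r). smult (block_weight p (take (Suc i) (x # y # r))) (monom 1 (Suc i)
           * join_poly p (drop (Suc i) (x # y # r))))"
      by (simp only: right_diff_distrib add_diff_cancel_left' diff_add_eq_diff_diff_swap add_diff_eq
          descending.simps take_Suc_Cons take_0 One_nat_def if_True)
    have "(\<Sum>i = 1..length (y # r). if descending (take (Suc i) (x # y # r)) then smult (block_weight
        p (take (Suc i) (x # y # r))) (monom 1 (Suc i) * join_poly p (drop (Suc i) (x # y # r))) else 0)
      = (\<Sum>i = 1..length (y # r). [:0, 1:] * (if x < y then 0 else smult (1 - p) (u i)))"
      by (rule sum.cong[OF refl], subst step, assumption, subst dstep, assumption) (auto simp: u_def)
    also have "\<dots> = [:0, 1:] * (if x < y then 0
         else smult (1 - p) (\<Sum>i=1..length (y # r). u i))"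
      by (cases "x < y") (simp_all only: if_True if_False smult_sum_right sum_distrib_left
          mult_zero_right sum.neutral_const)
    also have "\<dots> = [:0, 1:] * (desc_join_poly p (x # y # r) - join_poly p (y # r))"
      unfolding IH[symmetric] by (cases "x < y")
        (simp_all only: c if_True if_False join_poly.simps desc_join_poly.simps add_diff_cancel_left')
    finally show "[:0, 1:] * desc_join_poly p (x # y # r) =
      (if descending (take 1 (x # y # r)) then [:0, 1:] * join_poly p (y # r) else 0)
       + (\<Sum>i = 1..length (y # r). if descending (take (Suc i) (x # y # r)) then smult (block_weight
           p (take (Suc i) (x # y # r))) (monom 1 (Suc i) * join_poly p (drop (Suc i) (x # y # r)))
               else 0)"
      by (simp only: right_diff_distrib add_diff_cancel_left' diff_add_eq_diff_diff_swap add_diff_eq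
          descending.simps take_Suc_Cons take_0 One_nat_def if_True)
  qed
qed (auto simp: monom_Suc monom_0)

lemma degree_join_poly: "degree (join_poly p \<pi>) \<le> length \<pi> - 1" "degree (desc_join_poly p \<pi>) \<le>
    length \<pi> - 1"
proof (induction p \<pi> and p \<pi> rule: join_poly_desc_join_poly.induct)
  have lin: "degree ([:0, a:] * q) \<le> Suc k" if "degree q \<le> k" for a :: real and q k
    using degree_mult_le[of "[:0, a:]" q] degree_pCons_le[of 0 "[:a:]"] that by simp
  case (1 p x y r)
  thus ?case using lin by (auto intro!: degree_add_le intro: le_SucI)
next
  have lin: "degree ([:0, a:] * q) \<le> Suc k" if "degree q \<le> k" for a :: real and q k
    using degree_mult_le[of "[:0, a:]" q] degree_pCons_le[of 0 "[:a:]"] that by simp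
  case (3 p x y r)
  thus ?case using lin by (auto intro!: degree_add_le intro: le_SucI)
qed auto

text \<open>
  An allocation to \<open>m\<close> shelves is a sequence of \<open>j\<close> nonempty blocks together with a choice of
  the \<open>j\<close> nonempty shelves, and \<open>m choose j\<close> is a coefficient of \<open>(1 + X)\<^sup>m\<close>. The induction on
  \<open>m\<close> adds one shelf, which stays empty or receives the first block.
\<close>
lemma deal_weight_eq_coeff:
  assumes "distinct \<pi>"
  shows "deal_weight p m \<pi> = coeff ([:1, 1:] ^ m * join_poly p \<pi>) (length \<pi>)"
  using assms
proof (induction m arbitrary: \<pi>)
  case 0
  show ?case
  proof (cases "\<pi> = []")
    case False
    have "degree (join_poly p \<pi>) < length \<pi>" using degree_join_poly(1)[of p \<pi>] False by (cases \<pi>) auto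
    thus ?thesis using False by (simp add: deal_weight_0 coeff_eq_0)
  qed (simp add: deal_weight_0)
next
  case (Suc m)
  define n where "n = length \<pi>"
  show ?case
  proof (cases "\<pi> = []")
    case True
    thus ?thesis using Suc.IH[of "[]"] by (simp add: deal_weight_Suc coeff_mult)
  next
    case False
    have "deal_weight p (Suc m) \<pi> = deal_weight p m \<pi>
        + (\<Sum>i=1..n. block_weight p (take i \<pi>) * deal_weight p m (drop i \<pi>))"
      unfolding deal_weight_Suc n_def[symmetric]
      by (simp add: sum.atLeast_Suc_atMost atMost_atLeast0)
    also have "deal_weight p m \<pi> = coeff ([:1, 1:] ^ m * join_poly p \<pi>) n"
      using Suc by (simp add: n_def)
    also have "(\<Sum>i=1..n. block_weight p (take i \<pi>) * deal_weight p m (drop i \<pi>))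
      = (\<Sum>i=1..n. coeff ([:1, 1:] ^ m * smult (block_weight p (take i \<pi>)) (monom 1 i * join_poly p
          (drop i \<pi>))) n)"
    proof (rule sum.cong[OF refl])
      fix i assume i: "i \<in> {1..n}"
      have "deal_weight p m (drop i \<pi>) = coeff ([:1, 1:] ^ m * join_poly p (drop i \<pi>)) (n - i)"
        using Suc by (simp add: n_def)
      also have "\<dots> = coeff (monom 1 i * ([:1, 1:] ^ m * join_poly p (drop i \<pi>))) n"
        using i by (simp add: coeff_monom_mult)
      finally show "block_weight p (take i \<pi>) * deal_weight p m (drop i \<pi>)
        = coeff ([:1, 1:] ^ m * smult (block_weight p (take i \<pi>)) (monom 1 i * join_poly p (drop i
            \<pi>))) n"
        by (simp add: mult.left_commute)
    qed
    also have "\<dots> = coeff ([:1, 1:] ^ m * (\<Sum>i=1..n. smult (block_weight p (take i \<pi>)) (monom 1 i *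
        join_poly p (drop i \<pi>)))) n"
      by (simp only: sum_distrib_left coeff_sum)
    also have "(\<Sum>i=1..n. smult (block_weight p (take i \<pi>)) (monom 1 i * join_poly p (drop i \<pi>))) =
        [:0, 1:] * join_poly p \<pi>"
      using join_poly_first_block[OF False Suc.prems, of p] by (simp add: n_def)
    also have "coeff ([:1, 1:] ^ m * join_poly p \<pi>) n + coeff ([:1, 1:] ^ m * ([:0, 1:] * join_poly
        p \<pi>)) n
      = coeff ([:1, 1:] ^ m * (([:1:] + [:0, 1:]) * join_poly p \<pi>)) n"
      by (simp only: coeff_add[symmetric] distrib_left[symmetric] distrib_right) simp
    also have "[:1:] + [:0, 1:] = [:1, 1 :: real:]" by simp
    finally show ?thesis by (simp only: n_def power_Suc2 mult.assoc)
  qed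
qed

text \<open>
  The joins are independent of each other except at a valley, where the two neighbouring joins
  exclude each other. So a valley contributes \<open>1 + p X + (1 - p) X = 1 + X\<close>, and every other
  ascent or descent its own factor. The equations for the exponents also show that there are at
  most as many valleys as ascents, and as descents.
\<close>
lemma join_poly_factors:
  assumes "distinct \<pi>" "\<pi> \<noteq> []"
  shows "\<exists>a d. join_poly p \<pi> = [:1, 1:] ^ valleys \<pi> * [:1, p:] ^ a * [:1, 1 - p:] ^ d
     \<and> a + valleys \<pi> = ascents \<pi> \<and> d + valleys \<pi> + ascents \<pi> + 1 = length \<pi>"
  using assms
proof (induction \<pi> rule: length_induct)
  case (1 \<pi>)
  consider x where "\<pi> = [x]" | x y r where "\<pi> = x # y # r" "x < y" | x y where "\<pi> = [x, y]" "y < x"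
    | x y z r where "\<pi> = x # y # z # r" "y < x" "y < z" | x y z r where "\<pi> = x # y # z # r" "y < x"
        "z < y"
    using 1(2,3) by (metis distinct_length_2_or_more linorder_neqE_nat neq_Nil_conv)
  thus ?case
  proof cases
    case (2 x y r)
    have v: "valleys \<pi> = valleys (y # r)" using 2 by (cases r) auto
    have "\<exists>a d. join_poly p (y # r) = [:1, 1:] ^ valleys (y # r) * [:1, p:] ^ a * [:1, 1 - p:] ^ d
       \<and> a + valleys (y # r) = ascents (y # r) \<and> d + valleys (y # r) + ascents (y # r) + 1 = length
           (y # r)"
      using 1 2 by (intro 1(1)[rule_format]) auto
    then obtain a d where ad: "join_poly p (y # r) = [:1, 1:] ^ valleys (y # r) * [:1, p:] ^ a *
        [:1, 1 - p:] ^ d"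
       "a + valleys (y # r) = ascents (y # r)" "d + valleys (y # r) + ascents (y # r) + 1 = length
           (y # r)" by blast
    have "join_poly p \<pi> = ([:1:] + [:0, p:]) * join_poly p (y # r)"
      using 2 by (simp only: join_poly.simps distrib_right) simp
    also have "[:1:] + [:0, p:] = [:1, p:]" by simp
    finally have "join_poly p \<pi> = [:1, 1:] ^ valleys \<pi> * [:1, p:] ^ Suc a * [:1, 1 - p:] ^ d"
      by (simp only: ad v power_Suc mult_ac)
    moreover have "Suc a + valleys \<pi> = ascents \<pi>" "d + valleys \<pi> + ascents \<pi> + 1 = length \<pi>"
      using ad(2,3) 2 unfolding v by simp_all
    ultimately show ?thesis by blast
  next
    case (3 x y)
    hence "join_poly p \<pi> = [:1, 1:] ^ valleys \<pi> * [:1, p:] ^ 0 * [:1, 1 - p:] ^ 1" by (simp add: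
        one_pCons)
    moreover have "0 + valleys \<pi> = ascents \<pi>" "1 + valleys \<pi> + ascents \<pi> + 1 = length \<pi>"
      using 3 by simp_all
    ultimately show ?thesis by blast
  next
    case (4 x y z r)
    define w where "w = valleys (z # r)"
    have v: "valleys \<pi> = Suc w" using 4 unfolding w_def by (cases r) auto
    have a: "ascents \<pi> = Suc (ascents (z # r))" using 4 by simp
    have "\<exists>a d. join_poly p (z # r) = [:1, 1:] ^ valleys (z # r) * [:1, p:] ^ a * [:1, 1 - p:] ^ d
       \<and> a + valleys (z # r) = ascents (z # r) \<and> d + valleys (z # r) + ascents (z # r) + 1 = length
           (z # r)"
      using 1 4 by (intro 1(1)[rule_format]) auto
    then obtain a d where ad: "join_poly p (z # r) = [:1, 1:] ^ w * [:1, p:] ^ a * [:1, 1 - p:] ^ d"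
       "a + w = ascents (z # r)" "d + w + ascents (z # r) + 1 = length (z # r)"  unfolding w_def by
           blast
    have "join_poly p \<pi> = ([:1:] + [:0, p:] + [:0, 1 - p:]) * join_poly p (z # r)"
      using 4 by (simp only: join_poly.simps desc_join_poly.simps distrib_right) simp
    also have "[:1:] + [:0, p:] + [:0, 1 - p:] = [:1, 1:]" by simp
    finally have "join_poly p \<pi> = [:1, 1:] ^ valleys \<pi> * [:1, p:] ^ a * [:1, 1 - p:] ^ d"
      by (simp only: ad v power_Suc mult_ac)
    moreover have "a + valleys \<pi> = ascents \<pi>" "d + valleys \<pi> + ascents \<pi> + 1 = length \<pi>"
      using ad(2,3) 4 unfolding v a by simp_all
    ultimately show ?thesis by blast
  next
    case (5 x y z r)
    have v: "valleys \<pi> = valleys (y # z # r)" using 5 by auto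
    have "\<exists>a d. join_poly p (y # z # r) = [:1, 1:] ^ valleys (y # z # r) * [:1, p:] ^ a * [:1, 1 -
        p:] ^ d
       \<and> a + valleys (y # z # r) = ascents (y # z # r) \<and> d + valleys (y # z # r) + ascents (y # z #
           r) + 1 = length (y # z # r)"
      using 1 5 by (intro 1(1)[rule_format]) auto
    then obtain a d where ad: "join_poly p (y # z # r) = [:1, 1:] ^ valleys (y # z # r) * [:1, p:] ^
        a * [:1, 1 - p:] ^ d"
       "a + valleys (y # z # r) = ascents (y # z # r)" "d + valleys (y # z # r) + ascents (y # z #
           r) + 1 = length (y # z # r)" by blast
    have "desc_join_poly p (y # z # r) = join_poly p (y # z # r)" using 5 by simp
    hence "join_poly p \<pi> = ([:1:] + [:0, 1 - p:]) * join_poly p (y # z # r)"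
      using 5 by (simp only: join_poly.simps(1)[of p x] distrib_right) simp
    also have "[:1:] + [:0, 1 - p:] = [:1, 1 - p:]" by simp
    finally have "join_poly p \<pi> = [:1, 1:] ^ valleys \<pi> * [:1, p:] ^ a * [:1, 1 - p:] ^ Suc d"
      by (simp only: ad v power_Suc mult_ac)
    moreover have "a + valleys \<pi> = ascents \<pi>" "Suc d + valleys \<pi> + ascents \<pi> + 1 = length \<pi>"
      using ad(2,3) 5 unfolding v by simp_all
    ultimately show ?thesis by blast
  qed simp
qed

theorem pmf_shelf_shuffle_eq_coeff:
  assumes "m \<ge> 1" "0 \<le> p" "p \<le> 1" "\<pi> \<in> permutations_of_set {1..n}" "n \<ge> 1"
  obtains a d where "a + valleys \<pi> = ascents \<pi>" "d + valleys \<pi> + ascents \<pi> + 1 = n"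
    "pmf (shelf_shuffle p n m) \<pi>
     = coeff ([:1, 1:] ^ (m + valleys \<pi>) * [:1, p:] ^ a * [:1, 1 - p:] ^ d) n / real m ^ n"
proof -
  have "distinct \<pi>" "length \<pi> = n" using assms(4) by (auto dest: permutations_of_setD simp: length_perm)
  moreover from this have "\<pi> \<noteq> []" using assms(5) by auto
  ultimately obtain a d where "join_poly p \<pi> = [:1, 1:] ^ valleys \<pi> * [:1, p:] ^ a * [:1, 1 - p:] ^ d"
     "a + valleys \<pi> = ascents \<pi>" "d + valleys \<pi> + ascents \<pi> + 1 = n"
    using join_poly_factors[of \<pi> p] by blast
  thus thesis using that[of a d] pmf_shelf_shuffle_deal_weight[OF assms(1-4)]
    deal_weight_eq_coeff[OF \<open>distinct \<pi>\<close>, of p m] \<open>length \<pi> = n\<close>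
    by (simp add: power_add mult_ac)
qed

section \<open>Ratios of the likelihood\<close>

text \<open>
  The bounds hold for the coefficients of a product of factors \<open>1 + x X\<close> with \<open>0 \<le> x \<le> 1\<close> and
  sum \<open>s\<close> of the \<open>x\<close>: adjoining one of the factors to a \<open>k\<close>-subset produces each
  \<open>(k + 1)\<close>-subset \<open>k + 1\<close> times, and the \<open>x\<close> of the unused factors add up to at most \<open>s\<close> and at
  least \<open>s - k\<close>.
\<close>
definition newton_bounds :: "real poly \<Rightarrow> real \<Rightarrow> bool" where
  "newton_bounds G s \<longleftrightarrow> coeff G 0 = 1 \<and> (\<forall>k. 0 \<le> coeff G k
     \<and> (s - real k) * coeff G k \<le> (real k + 1) * coeff G (Suc k)
     \<and> (real k + 1) * coeff G (Suc k) \<le> s * coeff G k)"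

lemma newton_bounds_1: "newton_bounds 1 0"
  by (auto simp: newton_bounds_def)

lemma coeff_linear_mult: "coeff ([:1, x:] * G) 0 = coeff G 0"
  "coeff ([:1, x:] * G) (Suc k) = coeff G (Suc k) + x * coeff G k" for x :: real
  by simp_all

lemma newton_bounds_mult:
  assumes "newton_bounds G s" "0 \<le> x" "x \<le> 1"
  shows "newton_bounds ([:1, x:] * G) (s + x)"
proof -
  define e where "e = coeff G"
  have e0: "e 0 = 1" and enn: "\<And>k. 0 \<le> e k"
    and lo: "\<And>k. (s - real k) * e k \<le> (real k + 1) * e (Suc k)"
    and hi: "\<And>k. (real k + 1) * e (Suc k) \<le> s * e k"
    using assms(1) by (auto simp: newton_bounds_def e_def)
  show ?thesis unfolding newton_bounds_def
  proof (intro conjI allI)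
    fix k
    have c: "coeff ([:1, x:] * G) (Suc k) = e (Suc k) + x * e k" for k by (simp add: e_def)
    have c0: "coeff ([:1, x:] * G) 0 = 1" using e0 by (simp add: e_def)
    show "0 \<le> coeff ([:1, x:] * G) k"
      by (cases k) (use c c0 enn assms in \<open>auto simp del: mult_pCons_left\<close>)
    show "(s + x - real k) * coeff ([:1, x:] * G) k \<le> (real k + 1) * coeff ([:1, x:] * G) (Suc k)"
    proof (cases k)
      case 0
      thus ?thesis using lo[of 0] e0 by (simp only: c c0) simp
    next
      case (Suc j)
      have "x * ((s - real j) * e j) \<le> x * ((real j + 1) * e (Suc j))"
        using lo[of j] assms(2) by (rule mult_left_mono)
      moreover have "(x - 1) * (x * e j) \<le> 0"
        using assms enn[of j] by (intro mult_nonpos_nonneg) auto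
      ultimately show ?thesis using lo[of k] unfolding c unfolding Suc c by (simp add: algebra_simps)
    qed
    show "(real k + 1) * coeff ([:1, x:] * G) (Suc k) \<le> (s + x) * coeff ([:1, x:] * G) k"
    proof (cases k)
      case 0
      thus ?thesis using hi[of 0] e0 by (simp only: c c0) simp
    next
      case (Suc j)
      have "x * ((real j + 1) * e (Suc j)) \<le> x * (s * e j)"
        using hi[of j] assms(2) by (rule mult_left_mono)
      moreover have "0 \<le> x * (x * e j)" using assms enn[of j] by simp
      ultimately show ?thesis using hi[of k] unfolding c unfolding Suc c by (simp add: algebra_simps)
    qed
  qed (use e0 in \<open>simp add: e_def\<close>)
qed

lemma newton_bounds_power_mult:
  assumes "newton_bounds G s" "0 \<le> x" "x \<le> 1"
  shows "newton_bounds ([:1, x:] ^ j * G) (s + real j * x)"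
proof (induction j)
  case (Suc j)
  from newton_bounds_mult[OF Suc assms(2,3)] show ?case
    by (simp only: power_Suc mult.assoc of_nat_Suc distrib_right mult_1_left add_ac)
qed (use assms in simp)

text \<open>
  With \<open>s\<close> between \<open>m\<close> and \<open>m + n\<close> the ratio of the last coefficients is \<open>n / m\<close> up to a
  relative error of the order \<open>n / m\<close>.
\<close>
lemma newton_bounds_ratio:
  assumes nb: "newton_bounds G s" and s: "real m \<le> s" "s \<le> real m + real n" and n: "1 \<le> n" "n < m"
  shows "0 < coeff G n"
    and "real n / (real m + real n) * coeff G n \<le> coeff G (n - 1)"
    and "coeff G (n - 1) \<le> real n / (real m - real n) * coeff G n"
    and "n \<ge> 2 \<Longrightarrow> coeff G (n - 2) \<le> (real n / (real m - real n))\<^sup>2 * coeff G n"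
proof -
  define e where "e = coeff G"
  have e0: "e 0 = 1" and enn: "\<And>k. 0 \<le> e k"
    and lo: "\<And>k. (s - real k) * e k \<le> (real k + 1) * e (Suc k)"
    and hi: "\<And>k. (real k + 1) * e (Suc k) \<le> s * e k"
    using nb by (auto simp: newton_bounds_def e_def)
  have pos: "0 < e k" if "k \<le> n" for k
    using that
  proof (induction k)
    case (Suc k)
    have "0 < (s - real k) * e k" using Suc s n by (intro mult_pos_pos) auto
    hence "0 < (real k + 1) * e (Suc k)" using lo[of k] by linarith
    thus ?case by (simp add: zero_less_mult_iff)
  qed (simp add: e0)
  show "0 < coeff G n" using pos[of n] by (simp add: e_def)
  have up: "e (k - 1) \<le> real n / (real m - real n) * e k" if "1 \<le> k" "k \<le> n" for k
  proof -
    have "(real m - real n) * e (k - 1) \<le> (s - real (k - 1)) * e (k - 1)"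
      using that s enn by (intro mult_right_mono) auto
    also have "\<dots> \<le> real k * e k" using lo[of "k - 1"] that by (simp add: of_nat_diff)
    also have "\<dots> \<le> real n * e k" using that enn by (intro mult_right_mono) auto
    finally show ?thesis using n by (simp add: field_simps)
  qed
  show u1: "coeff G (n - 1) \<le> real n / (real m - real n) * coeff G n" using up[of n] n by (simp add:
      e_def)
  have "real n * e n \<le> s * e (n - 1)" using hi[of "n - 1"] n by (simp add: of_nat_diff)
  also have "\<dots> \<le> (real m + real n) * e (n - 1)" using s enn by (intro mult_right_mono) auto
  finally show "real n / (real m + real n) * coeff G n \<le> coeff G (n - 1)"
    using n by (simp add: e_def field_simps)
  assume n2: "n \<ge> 2"
  have "e (n - 2) \<le> real n / (real m - real n) * e (n - 1)"
    using up[of "n - 1"] n2 by (simp add: numeral_2_eq_2)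
  also have "\<dots> \<le> real n / (real m - real n) * (real n / (real m - real n) * e n)"
    using up[of n] n by (intro mult_left_mono) auto
  finally show "coeff G (n - 2) \<le> (real n / (real m - real n))\<^sup>2 * coeff G n"
    by (simp add: e_def power2_eq_square)
qed

definition shelf_coeff :: "real \<Rightarrow> nat \<Rightarrow> nat \<Rightarrow> nat \<Rightarrow> nat \<Rightarrow> real" where
  "shelf_coeff p n m a v = coeff ([:1, 1:] ^ (m + v) * [:1, p:] ^ (a - v) * [:1, 1 - p:] ^ (n - 1 -
      a - v)) n"

lemma newton_bounds_product:
  assumes "0 \<le> p" "p \<le> 1"
  shows "newton_bounds ([:1, 1:] ^ \<alpha> * [:1, p:] ^ a * [:1, 1 - p:] ^ d)
     (real \<alpha> + real a * p + real d * (1 - p))"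
proof -
  have "newton_bounds ([:1, 1:] ^ \<alpha> * ([:1, p:] ^ a * ([:1, 1 - p:] ^ d * 1)))
     (0 + real d * (1 - p) + real a * p + real \<alpha> * 1)"
    by (intro newton_bounds_power_mult newton_bounds_1) (use assms in auto)
  thus ?thesis by (simp add: mult_ac add_ac)
qed

text \<open>
  \<open>\<delta>\<close> is an approximation to the ratio \<open>n / m\<close>, and \<open>K / n\<close> bounds both the error of this
  approximation and the square of the ratio. For \<open>m \<approx> c n\<^sup>3\<^sup>/\<^sup>2\<close> this is possible with
  \<open>\<delta> = 1 / (c \<surd>n)\<close>, see \<open>shelf_ratio_holds\<close>.
\<close>
locale shelf_ratio =
  fixes p \<delta> K :: real and n m :: nat
  assumes p: "0 \<le> p" "p \<le> 1" and n: "1 \<le> n" and m: "2 * n \<le> m"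
    and lower: "\<delta> - K / real n \<le> real n / (real m + real n)"
    and upper: "real n / (real m - real n) \<le> \<delta> + K / real n"
    and square: "(real n / (real m - real n))\<^sup>2 \<le> K / real n"
begin

lemma factor_bounds:
  assumes "v \<le> n" "v + a + d \<le> n"
  shows "newton_bounds ([:1, 1:] ^ (m + v) * [:1, p:] ^ a * [:1, 1 - p:] ^ d) (real (m + v) + real a
      * p + real d * (1 - p))"
    "real m \<le> real (m + v) + real a * p + real d * (1 - p)"
    "real (m + v) + real a * p + real d * (1 - p) \<le> real m + real n"
proof -
  show "newton_bounds ([:1, 1:] ^ (m + v) * [:1, p:] ^ a * [:1, 1 - p:] ^ d) (real (m + v) + real a
      * p + real d * (1 - p))"
    by (rule newton_bounds_product[OF p])
  have "0 \<le> real a * p" "0 \<le> real d * (1 - p)" "real a * p \<le> real a * 1" "real d * (1 - p) \<le> real d * 1"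
    using p by (intro mult_nonneg_nonneg mult_left_mono; simp)+
  thus "real m \<le> real (m + v) + real a * p + real d * (1 - p)"
    "real (m + v) + real a * p + real d * (1 - p) \<le> real m + real n"
    using assms by auto
qed

lemma n_less_m: "n < m" using n m by auto

lemma shelf_coeff_pos:
  assumes "v \<le> a" "a + v \<le> n - 1" shows "0 < shelf_coeff p n m a v"
  unfolding shelf_coeff_def
  by (rule newton_bounds_ratio(1)[OF factor_bounds(1-3) n n_less_m]) (use assms n in auto)

lemma K_nonneg: "0 \<le> K / real n" using square zero_le_power2 order_trans by blast

text \<open>
  Turning a descent into an ascent replaces a factor \<open>1 + (1 - p) X\<close> by \<open>1 + p X\<close>, so with the
  coefficient ratio \<open>r\<close> the value changes by the factor
  \<open>(1 + p r) / (1 + (1 - p) r) \<approx> exp ((2 p - 1) r)\<close>.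
\<close>
lemma ascent_step:
  assumes "v \<le> a" "a + 1 + v \<le> n - 1"
  shows "\<bar>ln (shelf_coeff p n m (a + 1) v) - ln (shelf_coeff p n m a v) - (2 * p - 1) * \<delta>\<bar> \<le> 2 * K /
      real n"
proof -
  define d where "d = n - 2 - a - v"
  define G where "G = [:1, 1:] ^ (m + v) * [:1, p:] ^ (a - v) * [:1, 1 - p:] ^ d"
  have fb: "v \<le> n" "v + (a - v) + d \<le> n" using assms by (auto simp: d_def)
  note R = newton_bounds_ratio[OF factor_bounds[OF fb] n n_less_m, folded G_def]
  obtain k where k: "n = Suc k" using n by (cases n) auto
  have e1: "a + 1 - v = Suc (a - v)" "n - 1 - (a + 1) - v = d" "n - 1 - a - v = Suc d"
    using assms by (auto simp: d_def)
  have c: "coeff ([:1, x:] * G) n = coeff G n + x * coeff G (n - 1)" for x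
    unfolding k by (simp add: coeff_linear_mult)
  have s1: "shelf_coeff p n m (a + 1) v = coeff G n + p * coeff G (n - 1)"
  proof -
    have "shelf_coeff p n m (a + 1) v = coeff ([:1, p:] * G) n"
      unfolding shelf_coeff_def e1 G_def by (simp only: power_Suc mult_ac)
    thus ?thesis unfolding c .
  qed
  have s0: "shelf_coeff p n m a v = coeff G n + (1 - p) * coeff G (n - 1)"
  proof -
    have "shelf_coeff p n m a v = coeff ([:1, 1 - p:] * G) n"
      unfolding shelf_coeff_def e1 G_def by (simp only: power_Suc mult_ac)
    thus ?thesis unfolding c .
  qed
  define r where "r = coeff G (n - 1) / coeff G n"
  have r: "real n / (real m + real n) \<le> r" "r \<le> real n / (real m - real n)"
    using R(1-3) by (auto simp: r_def field_simps)
  have r0: "0 \<le> r" using r(1) by (rule order_trans[rotated]) auto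
  have "real n / (real m - real n) \<le> 1" using m n by (simp add: field_simps)
  hence r1: "r \<le> 1" using r by linarith
  have "r\<^sup>2 \<le> (real n / (real m - real n))\<^sup>2" by (rule power_mono[OF r(2) r0])
  hence rr: "r\<^sup>2 \<le> K / real n" using square by linarith
  have pr: "0 \<le> p * r" "p * r \<le> 1" "0 \<le> (1 - p) * r" "(1 - p) * r \<le> 1"
    using p r0 r1 by (auto intro: mult_le_one)
  have f: "coeff G n + x * coeff G (n - 1) = coeff G n * (1 + x * r)" for x
    using R(1) by (simp add: r_def field_simps)
  have "ln (shelf_coeff p n m (a + 1) v) - ln (shelf_coeff p n m a v) = ln (1 + p * r) - ln (1 + (1
      - p) * r)"
    unfolding s1 s0 f using R(1) pr by (subst (1 2) ln_mult_pos) auto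
  moreover have "\<bar>ln (1 + p * r) - p * r\<bar> \<le> (p * r)\<^sup>2" "\<bar>ln (1 + (1 - p) * r) - (1 - p) * r\<bar> \<le> ((1 -
      p) * r)\<^sup>2"
    using pr by (intro abs_ln_one_plus_x_minus_x_bound_nonneg; simp)+
  moreover have "(p * r)\<^sup>2 + ((1 - p) * r)\<^sup>2 \<le> r\<^sup>2"
  proof -
    have "p\<^sup>2 + (1 - p)\<^sup>2 \<le> 1" using mult_nonneg_nonneg[of p "1 - p"] p
      by (simp add: power2_eq_square algebra_simps)
    from mult_right_mono[OF this zero_le_power2[of r]] show ?thesis by (simp only:
        power_mult_distrib distrib_right mult_1_left)
  qed
  moreover have "\<bar>(2 * p - 1) * (r - \<delta>)\<bar> \<le> 1 * (K / real n)"
    unfolding abs_mult using p r lower upper by (intro mult_mono) auto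
  moreover have "p * r - (1 - p) * r - (2 * p - 1) * \<delta> = (2 * p - 1) * (r - \<delta>)"
    by (simp add: algebra_simps)
  ultimately show ?thesis using rr by linarith
qed

text \<open>
  A further valley replaces \<open>(1 + p X) (1 + (1 - p) X)\<close> by \<open>1 + X\<close>. The two differ by
  \<open>p (1 - p) X\<^sup>2\<close> only, so the relative change is of second order in the coefficient ratio.
\<close>
lemma valley_step:
  assumes "v + 1 \<le> a" "a + v + 1 \<le> n - 1"
  shows "\<bar>ln (shelf_coeff p n m a (v + 1)) - ln (shelf_coeff p n m a v)\<bar> \<le> 2 * K / real n"
proof -
  define b where "b = a - v - 1"
  define d where "d = n - 2 - a - v"
  define G where "G = [:1, 1:] ^ (m + v) * [:1, p:] ^ b * [:1, 1 - p:] ^ d"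
  have fb: "v \<le> n" "v + b + d \<le> n" using assms by (auto simp: d_def b_def)
  note R = newton_bounds_ratio[OF factor_bounds[OF fb] n n_less_m, folded G_def]
  obtain k where k: "n = Suc (Suc k)" using assms by (cases n; cases "n - 1") auto
  have e1: "m + (v + 1) = Suc (m + v)" "a - (v + 1) = b" "a - v = Suc b"
     "n - 1 - a - (v + 1) = d" "n - 1 - a - v = Suc d"
    using assms by (auto simp: d_def b_def)
  have s1: "shelf_coeff p n m a (v + 1) = coeff G n + coeff G (n - 1)"
  proof -
    have "shelf_coeff p n m a (v + 1) = coeff ([:1, 1:] * G) n"
      unfolding shelf_coeff_def e1(1,2,4) G_def by (simp only: power_Suc mult_ac)
    thus ?thesis unfolding k coeff_linear_mult by simp
  qed
  have s0: "shelf_coeff p n m a v = coeff G n + coeff G (n - 1) + p * (1 - p) * coeff G (n - 2)"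
  proof -
    have "shelf_coeff p n m a v = coeff ([:1, p:] * ([:1, 1 - p:] * G)) n"
      unfolding shelf_coeff_def e1(3,5) G_def by (simp only: power_Suc mult_ac)
    thus ?thesis unfolding k coeff_linear_mult by (simp add: algebra_simps)
  qed
  have nn: "0 \<le> coeff G j" for j using factor_bounds(1)[OF fb] by (simp add: G_def newton_bounds_def)
  define x where "x = p * (1 - p) * coeff G (n - 2) / (coeff G n + coeff G (n - 1))"
  have x0: "0 \<le> x" unfolding x_def using nn p by auto
  have "p * (1 - p) * coeff G (n - 2) \<le> 1 * coeff G (n - 2)"
    using p nn by (intro mult_right_mono mult_le_one) auto
  also have "\<dots> \<le> (real n / (real m - real n))\<^sup>2 * coeff G n" using R(4) k by simp
  also have "\<dots> \<le> (real n / (real m - real n))\<^sup>2 * (coeff G n + coeff G (n - 1))"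
    using nn by (intro mult_left_mono) auto
  finally have "x \<le> (real n / (real m - real n))\<^sup>2"
    unfolding x_def using R(1) nn[of "n - 1"] by (simp add: divide_le_eq)
  hence x1: "x \<le> K / real n" using square by linarith
  have f: "shelf_coeff p n m a v = shelf_coeff p n m a (v + 1) * (1 + x)"
    unfolding s0 s1 x_def using R(1) nn[of "n - 1"] by (simp add: field_simps)
  have "ln (shelf_coeff p n m a v) = ln (shelf_coeff p n m a (v + 1)) + ln (1 + x)"
    unfolding f using R(1) nn[of "n - 1"] x0 s1 by (intro ln_mult_pos) auto
  moreover have "0 \<le> ln (1 + x)" "ln (1 + x) \<le> x" using x0 by (auto intro: ln_add_one_self_le_self)
  ultimately show ?thesis using x1 K_nonneg by auto
qed

lemma valley_steps:
  assumes "v \<le> v'" "v' \<le> a" "a + v' \<le> n - 1"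
  shows "\<bar>ln (shelf_coeff p n m a v') - ln (shelf_coeff p n m a v)\<bar> \<le> 2 * K / real n * (real v' -
      real v)"
  using assms
proof (induction v' rule: dec_induct)
  case (step w)
  have "\<bar>ln (shelf_coeff p n m a (w + 1)) - ln (shelf_coeff p n m a w)\<bar> \<le> 2 * K / real n"
    by (rule valley_step) (use step in auto)
  moreover have "\<bar>ln (shelf_coeff p n m a w) - ln (shelf_coeff p n m a v)\<bar> \<le> 2 * K / real n * (real
      w - real v)"
    using step by simp
  moreover have "2 * K / real n * (real (Suc w) - real v) = 2 * K / real n * (real w - real v) + 2 *
      K / real n"
    by (simp only: of_nat_Suc right_diff_distrib distrib_left mult_1_right)
  ultimately show ?case by simp
qed simp

lemma ascent_steps:
  assumes "a \<le> a'" "v \<le> a" "a' + v \<le> n - 1"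
  shows "\<bar>ln (shelf_coeff p n m a' v) - ln (shelf_coeff p n m a v) - (2 * p - 1) * \<delta> * (real a' -
      real a)\<bar>
    \<le> 2 * K / real n * (real a' - real a)"
  using assms
proof (induction a' rule: dec_induct)
  case (step b)
  have "\<bar>ln (shelf_coeff p n m (b + 1) v) - ln (shelf_coeff p n m b v) - (2 * p - 1) * \<delta>\<bar> \<le> 2 * K /
      real n"
    by (rule ascent_step) (use step in auto)
  moreover have "\<bar>ln (shelf_coeff p n m b v) - ln (shelf_coeff p n m a v) - (2 * p - 1) * \<delta> * (real
      b - real a)\<bar>
    \<le> 2 * K / real n * (real b - real a)" using step by auto
  moreover have "x * (real (Suc b) - real a) = x * (real b - real a) + x" for x
    by (simp add: algebra_simps)
  ultimately show ?case by simp
qed simp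

text \<open>
  Two admissible points are joined by lowering the number of valleys to the smaller one of the
  two values, then changing the number of ascents, and raising the number of valleys again. In
  this order no intermediate point leaves the admissible region.
\<close>
lemma shelf_coeff_ratio:
  assumes "v \<le> a" "a + v \<le> n - 1" "v' \<le> a'" "a' + v' \<le> n - 1"
  shows "\<bar>ln (shelf_coeff p n m a v) - ln (shelf_coeff p n m a' v') - (2 * p - 1) * \<delta> * (real a -
      real a')\<bar>
    \<le> 2 * K / real n * (\<bar>real a - real a'\<bar> + \<bar>real v - real v'\<bar>)"
proof -
  \<comment> \<open>At the smaller number of valleys every number of ascents between \<open>a\<close> and \<open>a'\<close> is admissible.\<close>
  define w where "w = min v v'"
  have w: "w \<le> v" "w \<le> v'" by (auto simp: w_def)
  have 1: "\<bar>ln (shelf_coeff p n m a v) - ln (shelf_coeff p n m a w)\<bar> \<le> 2 * K / real n * (real v -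
      real w)"
    "\<bar>ln (shelf_coeff p n m a' v') - ln (shelf_coeff p n m a' w)\<bar> \<le> 2 * K / real n * (real v' - real w)"
    by (rule valley_steps; use assms w in simp)+
  have 2: "\<bar>ln (shelf_coeff p n m a w) - ln (shelf_coeff p n m a' w) - (2 * p - 1) * \<delta> * (real a -
      real a')\<bar>
    \<le> 2 * K / real n * \<bar>real a - real a'\<bar>"
  proof (cases "a \<le> a'")
    case True
    have *: "x * (real a - real a') = - (x * (real a' - real a))" for x by (simp add: algebra_simps)
    from ascent_steps[OF True, of w] assms w True show ?thesis unfolding * by simp
  next
    case False
    from ascent_steps[of a' a w] False assms w show ?thesis by simp
  qed
  have "(real v - real w) + (real v' - real w) = \<bar>real v - real v'\<bar>" by (auto simp: w_def)
  hence "2 * K / real n * (real v - real w) + 2 * K / real n * (real v' - real w) = 2 * K / real n *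
      \<bar>real v - real v'\<bar>"
    by (metis distrib_left)
  with 1 2 show ?thesis by (simp only: distrib_left)
qed

end

text \<open>
  Here \<open>m\<close> lies between \<open>x - 1\<close> and \<open>x = c n\<^sup>3\<^sup>/\<^sup>2\<close>, and the assumption means that \<open>x \<ge> 3 n\<close>.
\<close>
lemma shelf_ratio_holds:
  assumes p: "0 \<le> p" "p \<le> 1" and c: "c > 0" and n: "1 \<le> n" "3 \<le> c * sqrt (real n)"
  shows "shelf_ratio p (1 / (c * sqrt (real n))) (9 / c\<^sup>2) n (nat \<lfloor>c * real n powr (3 / 2)\<rfloor>)"
proof -
  define N where "N = real n"
  define r where "r = sqrt N"
  define x where "x = c * (N * r)"
  define m where "m = nat \<lfloor>c * real n powr (3 / 2)\<rfloor>"
  have N: "1 \<le> N" using n by (simp add: N_def)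
  have r: "1 \<le> r" "N = r * r" using N by (auto simp: r_def)
  have "N powr (3 / 2) = N powr 1 * N powr (1 / 2)" by (simp only: powr_add[symmetric]) simp
  also have "\<dots> = N * r" using N by (simp add: r_def powr_half_sqrt)
  finally have pw: "c * real n powr (3 / 2) = x" by (simp add: x_def N_def)
  have x3: "3 * N \<le> x"
  proof -
    have "N * 3 \<le> N * (c * r)" using n N by (intro mult_left_mono) (auto simp: r_def N_def)
    thus ?thesis by (simp add: x_def mult_ac)
  qed
  have x0: "0 < x" using x3 N by linarith
  have m: "real m \<le> x" "x - 1 < real m" using x0 unfolding m_def pw by linarith+
  have m2: "2 * N \<le> real m" using m x3 N by linarith
  have d: "1 / (c * r) = N / x" using c r(1) N by (simp add: x_def)
  have e: "1 / (c\<^sup>2 * N) = (N / x)\<^sup>2"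
    using c r by (simp add: x_def power2_eq_square)
  have K: "9 / c\<^sup>2 / N = 9 * (N / x)\<^sup>2" unfolding e[symmetric] by simp
  have "(N / x - (N / x)\<^sup>2) * (x + N) = N - N * (N / x)\<^sup>2"
    using x0 by (simp add: field_simps power2_eq_square)
  also have "\<dots> \<le> N" using N by simp
  finally have "N / x - (N / x)\<^sup>2 \<le> N / (x + N)" using x0 N by (simp add: pos_le_divide_eq)
  also have "\<dots> \<le> N / (real m + N)" using m N m2 by (intro divide_left_mono mult_pos_pos) auto
  finally have "N / x - (N / x)\<^sup>2 \<le> N / (real m + N)" .
  hence lo: "N / x - 9 * (N / x)\<^sup>2 \<le> N / (real m + N)" using zero_le_power2[of "N / x"] by linarith
  have b: "N / (real m - N) \<le> N / (x - 2 * N)" using m N x3 by (intro divide_left_mono mult_pos_pos)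
      auto
  have "N / (x - 2 * N) \<le> N / x + 9 * (N / x)\<^sup>2"
  proof -
    define y where "y = N / x"
    have y: "0 < y" "3 * y \<le> 1" "N = y * x" using x0 x3 N by (auto simp: y_def field_simps)
    have "y \<le> (y + 9 * y\<^sup>2) * (1 - 2 * y)"
    proof -
      have "18 * y * y\<^sup>2 \<le> 6 * y\<^sup>2" using y mult_right_mono[of "18 * y" 6 "y\<^sup>2"] by simp
      moreover have "(y + 9 * y\<^sup>2) * (1 - 2 * y) = y + 7 * y\<^sup>2 - 18 * y * y\<^sup>2" by (simp add:
          algebra_simps power2_eq_square)
      ultimately show ?thesis using zero_le_power2[of y] by linarith
    qed
    hence "y / (1 - 2 * y) \<le> y + 9 * y\<^sup>2" using y by (simp add: pos_divide_le_eq)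
    moreover have "N / (x - 2 * N) = y / (1 - 2 * y)"
    proof -
      have "x - 2 * N = x * (1 - 2 * y)" using y by (simp add: algebra_simps)
      thus ?thesis using x0 y(3) by simp
    qed
    ultimately show ?thesis unfolding y_def[symmetric] by linarith
  qed
  with b have up: "N / (real m - N) \<le> N / x + 9 * (N / x)\<^sup>2" by linarith
  have "N / (x - 2 * N) \<le> N / (x / 3)" using x3 x0 N by (intro divide_left_mono mult_pos_pos) auto
  hence "N / (real m - N) \<le> N / (x / 3)" using b by linarith
  also have "N / (x / 3) = 3 * (N / x)" by simp
  finally have "N / (real m - N) \<le> 3 * (N / x)" .
  hence "(N / (real m - N))\<^sup>2 \<le> (3 * (N / x))\<^sup>2" using m m2 N by (intro power_mono) auto
  hence sq: "(N / (real m - N))\<^sup>2 \<le> 9 * (N / x)\<^sup>2"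
    unfolding power_mult_distrib[of 3] by simp
  have mm: "2 * n \<le> m" using m2 by (simp add: N_def)
  show ?thesis
    unfolding shelf_ratio_def m_def[symmetric] unfolding N_def[symmetric] r_def[symmetric] d K
    by (intro conjI p n(1) mm lo up sq)
qed

lemma pmf_shelf_shuffle_shelf_coeff:
  assumes "m \<ge> 1" "0 \<le> p" "p \<le> 1" "\<pi> \<in> permutations_of_set {1..n}" "n \<ge> 1"
  shows "valleys \<pi> \<le> ascents \<pi>" "ascents \<pi> + valleys \<pi> \<le> n - 1"
    "pmf (shelf_shuffle p n m) \<pi> = shelf_coeff p n m (ascents \<pi>) (valleys \<pi>) / real m ^ n"
proof -
  obtain a d where ad: "a + valleys \<pi> = ascents \<pi>" "d + valleys \<pi> + ascents \<pi> + 1 = n"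
    "pmf (shelf_shuffle p n m) \<pi>
     = coeff ([:1, 1:] ^ (m + valleys \<pi>) * [:1, p:] ^ a * [:1, 1 - p:] ^ d) n / real m ^ n"
    by (rule pmf_shelf_shuffle_eq_coeff[OF assms])
  have "a = ascents \<pi> - valleys \<pi>" "d = n - 1 - ascents \<pi> - valleys \<pi>" using ad(1,2) by auto
  with ad(3) show "pmf (shelf_shuffle p n m) \<pi> = shelf_coeff p n m (ascents \<pi>) (valleys \<pi>) / real m ^ n"
    by (simp only: shelf_coeff_def)
  show "valleys \<pi> \<le> ascents \<pi>" "ascents \<pi> + valleys \<pi> \<le> n - 1" using ad(1,2) by auto
qed

text \<open>
  All likelihoods are compared with that of one admissible pair \<open>(a0, v0)\<close> close to the means.
  Its own value goes into the factor \<open>\<kappa>\<close>, which never has to be computed: the total mass 1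
  determines it.
\<close>
lemma shelf_density:
  assumes "shelf_ratio p \<delta> K n m" "2 \<le> n"
  obtains \<kappa> \<eta> where "\<And>\<pi>. \<pi> \<in> permutations_of_set {1..n} \<Longrightarrow>
      fact n * pmf (shelf_shuffle p n m) \<pi> = \<kappa> * exp ((2 * p - 1) * \<delta> * centred_ascents \<pi>) * exp (\<eta> \<pi>)"
    "\<And>\<pi>. \<pi> \<in> permutations_of_set {1..n} \<Longrightarrow>
      \<bar>\<eta> \<pi>\<bar> \<le> 2 * K / real n * (\<bar>centred_ascents \<pi>\<bar> + \<bar>centred_valleys \<pi>\<bar> + 2)"
    "\<kappa> > 0"
proof -
  interpret shelf_ratio p \<delta> K n m by fact
  \<comment> \<open>An admissible pair within distance 1 of the means \<open>(n - 1) / 2\<close> and \<open>(n - 2) / 3\<close>.\<close>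
  define a0 where "a0 = (n - 1) div 2"
  define v0 where "v0 = (n - 2) div 3"
  have v0: "v0 \<le> a0" "a0 + v0 \<le> n - 1" using assms(2) by (auto simp: a0_def v0_def)
  define \<theta> where "\<theta> = (2 * p - 1) * \<delta>"
  define c where "c = shelf_coeff p n m"
  define \<kappa> where "\<kappa> = fact n / real m ^ n * c a0 v0 * exp (\<theta> * ((real n - 1) / 2 - real a0))"
  define \<eta> where "\<eta> = (\<lambda>\<pi>. ln (c (ascents \<pi>) (valleys \<pi>)) - ln (c a0 v0) - \<theta> * (real (ascents \<pi>) -
      real a0))"
  have m1: "m \<ge> 1" using n_less_m by simp
  have c0: "c a0 v0 > 0" unfolding c_def by (rule shelf_coeff_pos[OF v0])
  show thesis
  proof (rule that[of \<kappa> \<eta>])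
    show "\<kappa> > 0" using c0 m1 by (simp add: \<kappa>_def)
  next
    fix \<pi> assume \<pi>: "\<pi> \<in> permutations_of_set {1..n}"
    note P = pmf_shelf_shuffle_shelf_coeff[OF m1 p \<pi> n]
    have cp: "c (ascents \<pi>) (valleys \<pi>) > 0" unfolding c_def by (rule shelf_coeff_pos[OF P(1,2)])
    have X: "centred_ascents \<pi> = real (ascents \<pi>) - (real n - 1) / 2"
      using length_perm[OF \<pi>] by (simp add: centred_ascents_def)
    have Z: "centred_valleys \<pi> = real (valleys \<pi>) - (real n - 2) / 3"
      using length_perm[OF \<pi>] by (simp add: centred_valleys_def)
    have "\<theta> * ((real n - 1) / 2 - real a0) + \<theta> * centred_ascents \<pi> + \<eta> \<pi>
        = ln (c (ascents \<pi>) (valleys \<pi>)) - ln (c a0 v0)"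
      unfolding X \<eta>_def by (simp add: algebra_simps)
    hence "exp (\<theta> * ((real n - 1) / 2 - real a0)) * exp (\<theta> * centred_ascents \<pi>) * exp (\<eta> \<pi>)
       = c (ascents \<pi>) (valleys \<pi>) / c a0 v0"
      unfolding exp_add[symmetric] using cp c0 by (simp add: exp_diff)
    hence "\<kappa> * exp (\<theta> * centred_ascents \<pi>) * exp (\<eta> \<pi>) = fact n / real m ^ n * c a0 v0 * (c (ascents
        \<pi>) (valleys \<pi>) / c a0 v0)"
      unfolding \<kappa>_def by (simp only: mult.assoc)
    also have "\<dots> = fact n * pmf (shelf_shuffle p n m) \<pi>"
      unfolding P(3) c_def[symmetric] using c0 by simp
    finally show "fact n * pmf (shelf_shuffle p n m) \<pi> = \<kappa> * exp ((2 * p - 1) * \<delta> * centred_ascents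
        \<pi>) * exp (\<eta> \<pi>)"
      by (simp add: \<theta>_def)
    have a0r: "real a0 \<le> (real n - 1) / 2" "(real n - 1) / 2 \<le> real a0 + 1"
    proof -
      have "2 * a0 \<le> n - 1" "n - 1 \<le> 2 * a0 + 1" by (auto simp: a0_def)
      hence "2 * real a0 \<le> real (n - 1)" "real (n - 1) \<le> 2 * real a0 + 1" by linarith+
      thus "real a0 \<le> (real n - 1) / 2" "(real n - 1) / 2 \<le> real a0 + 1" using assms(2) by (simp_all
          add: of_nat_diff)
    qed
    have v0r: "real v0 \<le> (real n - 2) / 3" "(real n - 2) / 3 \<le> real v0 + 1"
    proof -
      have "3 * v0 \<le> n - 2" "n - 2 \<le> 3 * v0 + 2" by (auto simp: v0_def)
      hence "3 * real v0 \<le> real (n - 2)" "real (n - 2) \<le> 3 * real v0 + 2" by linarith+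
      thus "real v0 \<le> (real n - 2) / 3" "(real n - 2) / 3 \<le> real v0 + 1" using assms(2) by (simp_all
          add: of_nat_diff)
    qed
    have "\<bar>\<eta> \<pi>\<bar> \<le> 2 * K / real n * (\<bar>real (ascents \<pi>) - real a0\<bar> + \<bar>real (valleys \<pi>) - real v0\<bar>)"
      unfolding \<eta>_def \<theta>_def c_def by (rule shelf_coeff_ratio[OF P(1,2) v0])
    also have "\<dots> \<le> 2 * K / real n * (\<bar>centred_ascents \<pi>\<bar> + \<bar>centred_valleys \<pi>\<bar> + 2)"
    proof (rule mult_left_mono)
      show "\<bar>real (ascents \<pi>) - real a0\<bar> + \<bar>real (valleys \<pi>) - real v0\<bar> \<le> \<bar>centred_ascents \<pi>\<bar> +
          \<bar>centred_valleys \<pi>\<bar> + 2"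
        unfolding X Z using a0r v0r by linarith
      show "0 \<le> 2 * K / real n" using K_nonneg by simp
    qed
    finally show "\<bar>\<eta> \<pi>\<bar> \<le> 2 * K / real n * (\<bar>centred_ascents \<pi>\<bar> + \<bar>centred_valleys \<pi>\<bar> + 2)" .
  qed
qed

section \<open>The normal distribution function\<close>

lemma std_normal_cdf_eq_cdf: "std_normal_cdf t = cdf std_normal_distribution t"
proof -
  have "emeasure std_normal_distribution {..t} = (\<integral>\<^sup>+ x. ennreal (std_normal_density x) * indicator
      {..t} x \<partial>lborel)"
    by (subst emeasure_density) auto
  also have "\<dots> = (\<integral>\<^sup>+ x. ennreal (indicator {..t} x * std_normal_density x) \<partial>lborel)"
    by (intro nn_integral_cong) (auto simp: indicator_def)
  also have "\<dots> = ennreal (\<integral> x. indicator {..t} x * std_normal_density x \<partial>lborel)"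
    by (intro nn_integral_eq_integral integrable_real_mult_indicator[unfolded mult.commute[of
        "indicator _ _"]])
       (auto intro!: integrable_mult_indicator[where 'b=real, simplified] integrable_normal_density)
  finally have "measure std_normal_distribution {..t} = (\<integral> x. indicator {..t} x * std_normal_density
      x \<partial>lborel)"
    by (simp add: measure_def)
  also have "\<dots> = std_normal_cdf t"
    unfolding std_normal_cdf_def set_lebesgue_integral_def std_normal_density_def
    by (subst integral_mult_right_zero[symmetric]) (auto intro!: Bochner_Integration.integral_cong)
  finally show ?thesis by (simp add: cdf_def)
qed

lemma std_normal_cdf_eq_LINT: "std_normal_cdf t = (LINT x:{..t}|lborel. std_normal_density x)"
  unfolding std_normal_cdf_def set_lebesgue_integral_def std_normal_density_def
  by (subst integral_mult_right_zero[symmetric]) (auto intro!: Bochner_Integration.integral_cong)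

lemma set_integrable_std_normal_density: "A \<in> sets borel \<Longrightarrow> set_integrable lborel A std_normal_density"
  unfolding set_integrable_def by (rule integrable_mult_indicator) auto

lemma std_normal_cdf_nonneg: "0 \<le> std_normal_cdf t"
  by (simp add: std_normal_cdf_eq_cdf cdf_def)

lemma std_normal_cdf_at_top: "(std_normal_cdf \<longlongrightarrow> 1) at_top"
proof -
  interpret real_distribution std_normal_distribution by (rule real_dist_normal_dist)
  show ?thesis using cdf_lim_at_top_prob by (simp add: std_normal_cdf_eq_cdf[abs_def])
qed

lemma std_normal_cdf_at_bot: "(std_normal_cdf \<longlongrightarrow> 0) at_bot"
proof -
  interpret real_distribution std_normal_distribution by (rule real_dist_normal_dist)
  show ?thesis using cdf_lim_at_bot by (simp add: std_normal_cdf_eq_cdf[abs_def])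
qed

lemma std_normal_cdf_has_derivative:
  "(std_normal_cdf has_real_derivative std_normal_density t) (at t)"
proof -
  let ?I = "\<lambda>x. integral {t - 1..x} std_normal_density"
  have cont: "continuous_on {t - 1..t + 1} std_normal_density"
    unfolding std_normal_density_def by (intro continuous_intros) auto
  have split: "std_normal_cdf x = std_normal_cdf (t - 1) + ?I x" if "x \<in> {t-1<..<t+1}" for x
  proof -
    have e: "{..x} = {..t - 1} \<union> {t - 1<..x}" using that by auto
    have "std_normal_cdf x = (LINT x:{..t - 1}|lborel. std_normal_density x) + (LINT
        x:{t-1<..x}|lborel. std_normal_density x)"
      unfolding std_normal_cdf_eq_LINT e
      by (rule set_integral_Un) (auto intro!: set_integrable_std_normal_density)
    also have "(LINT x:{t-1<..x}|lborel. std_normal_density x) = (LINT x:{t-1..x}|lborel.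
        std_normal_density x)"
      unfolding set_lebesgue_integral_def
      by (rule integral_cong_AE)
        (auto intro!: AE_I[where N="{t-1}"] simp: indicator_def)
    also have "\<dots> = ?I x"
      by (rule set_borel_integral_eq_integral(2)) (auto intro!: set_integrable_std_normal_density)
    finally show ?thesis by (simp add: std_normal_cdf_eq_LINT)
  qed
  have "(?I has_real_derivative std_normal_density t) (at t within {t-1..t+1})"
    by (rule integral_has_real_derivative[OF cont]) auto
  hence "(?I has_real_derivative std_normal_density t) (at t)"
    by (simp add: at_within_interior[where S="{t-1..t+1}"])
  hence "((\<lambda>x. std_normal_cdf (t - 1) + ?I x) has_real_derivative std_normal_density t) (at t)"
    by (auto intro!: derivative_eq_intros)
  thus ?thesis
    by (rule has_field_derivative_transform_within_open[where S="{t-1<..<t+1}"])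
       (use split in auto)
qed

text \<open>
  The function \<open>\<Phi>(x) + \<Phi>(- x)\<close> has derivative 0 and tends to 1 for \<open>x \<rightarrow> \<infinity>\<close>.
\<close>
lemma std_normal_cdf_minus: "std_normal_cdf (- t) = 1 - std_normal_cdf t"
proof -
  let ?f = "\<lambda>x. std_normal_cdf x + std_normal_cdf (- x)"
  have d: "(?f has_real_derivative 0) (at x)" for x
    by (auto intro!: derivative_eq_intros DERIV_chain2[where f=std_normal_cdf]
          std_normal_cdf_has_derivative simp: std_normal_density_def)
  have c: "?f x = ?f t" for x
    using DERIV_const_ratio_const[of x t ?f 0] DERIV_isconst_all[of ?f x t] d by blast
  have "(?f \<longlongrightarrow> 1 + 0) at_top"
    by (intro tendsto_add std_normal_cdf_at_top
         filterlim_compose[OF std_normal_cdf_at_bot filterlim_uminus_at_bot_at_top])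
  moreover have "(?f \<longlongrightarrow> ?f t) at_top"
    by (intro tendsto_eventually always_eventually allI c)
  ultimately have "?f t = 1 + 0" by (intro tendsto_unique[of at_top ?f]) auto
  thus ?thesis by simp
qed

text \<open>
  On \<open>x \<le> b\<close> the density is at most \<open>exp (t b + t\<^sup>2 / 2)\<close> times the normal density with mean
  \<open>- t\<close>.
\<close>
lemma std_normal_cdf_chernoff:
  assumes "0 \<le> t"
  shows "std_normal_cdf b \<le> exp (t * b + t\<^sup>2 / 2)"
proof -
  have "std_normal_cdf b \<le> (LINT x|lborel. exp (t * b + t\<^sup>2 / 2) * normal_density (- t) 1 x)"
    unfolding std_normal_cdf_eq_LINT set_lebesgue_integral_def
  proof (rule integral_mono)
    show "integrable lborel (\<lambda>x. indicat_real {..b} x *\<^sub>R std_normal_density x)"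
      using set_integrable_std_normal_density[of "{..b}"] by (simp add: set_integrable_def)
    fix x :: real
    have "exp (- x\<^sup>2 / 2) \<le> exp (t * b + t\<^sup>2 / 2) * exp (- (x + t)\<^sup>2 / 2)" if "x \<le> b"
    proof -
      have "t * x \<le> t * b" using that assms by (rule mult_left_mono)
      thus ?thesis by (simp add: exp_add[symmetric] power2_eq_square field_simps)
    qed
    thus "indicat_real {..b} x *\<^sub>R std_normal_density x \<le> exp (t * b + t\<^sup>2 / 2) * normal_density (-
        t) 1 x"
      by (auto simp: indicator_def normal_density_def divide_simps)
  qed auto
  thus ?thesis by simp
qed

section \<open>The price of a put as a solution of the heat equation\<close>

text \<open>
  The expectation of \<open>exp (\<sigma> (y + \<surd>\<tau> N) - \<sigma>\<^sup>2 / 2)\<close> for a standard normal \<open>N\<close>, restricted to the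
  event \<open>y + \<surd>\<tau> N < \<sigma> / 2\<close> that the exponent is negative (for \<open>\<sigma> > 0\<close>).
\<close>
definition put_tilt :: "real \<Rightarrow> real \<Rightarrow> real \<Rightarrow> real" where
  "put_tilt \<sigma> y \<tau> = exp (\<sigma> * y - \<sigma>\<^sup>2 / 2 + \<sigma>\<^sup>2 * \<tau> / 2)
     * std_normal_cdf ((\<sigma> / 2 - y) / sqrt \<tau> - \<sigma> * sqrt \<tau>)"

text \<open>
  The Black-Scholes formula for the expectation of \<open>max 0 (1 - exp (\<sigma> (y + \<surd>\<tau> N) - \<sigma>\<^sup>2 / 2))\<close>.
  Working with the formula instead of the expectation turns all smoothness questions into
  elementary calculus.
\<close>
definition put :: "real \<Rightarrow> real \<Rightarrow> real \<Rightarrow> real" where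
  "put \<sigma> y \<tau> = std_normal_cdf ((\<sigma> / 2 - y) / sqrt \<tau>) - put_tilt \<sigma> y \<tau>"

text \<open>
  The density of the normal law with mean \<open>y\<close> and variance \<open>\<tau>\<close> at \<open>\<sigma> / 2\<close>, the point where the
  payoff has its kink; \<open>\<sigma>\<close> times it is the singular part of the second derivative of \<open>put\<close>.
\<close>
definition put_gamma :: "real \<Rightarrow> real \<Rightarrow> real \<Rightarrow> real" where
  "put_gamma \<sigma> y \<tau> = std_normal_density ((\<sigma> / 2 - y) / sqrt \<tau>) / sqrt \<tau>"

lemma DERIV_std_normal_cdf [derivative_intros]:
  "(f has_real_derivative f') (at x) \<Longrightarrow>
   ((\<lambda>x. std_normal_cdf (f x)) has_real_derivative std_normal_density (f x) * f') (at x)"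
  by (rule DERIV_chain2[OF std_normal_cdf_has_derivative])

lemma DERIV_std_normal_density [derivative_intros]:
  "(f has_real_derivative f') (at x) \<Longrightarrow>
   ((\<lambda>x. std_normal_density (f x)) has_real_derivative - f x * std_normal_density (f x) * f') (at x)"
  unfolding std_normal_density_def
  by (auto intro!: derivative_eq_intros simp: field_simps)

text \<open>
  Completing the square. This identity is responsible for the cancellation of the density terms
  in \<open>DERIV_put\<close>.
\<close>
lemma tilt_density:
  assumes "\<tau> > 0"
  shows "exp (\<sigma> * y - \<sigma>\<^sup>2 / 2 + \<sigma>\<^sup>2 * \<tau> / 2)
      * std_normal_density ((\<sigma> / 2 - y) / sqrt \<tau> - \<sigma> * sqrt \<tau>)
    = sqrt \<tau> * put_gamma \<sigma> y \<tau>"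
proof -
  define s where "s = sqrt \<tau>"
  have s: "s > 0" "\<tau> = s\<^sup>2" using assms by (auto simp: s_def)
  have "(\<sigma> * y - \<sigma>\<^sup>2 / 2 + \<sigma>\<^sup>2 * s\<^sup>2 / 2) + - ((\<sigma> / 2 - y) / s - \<sigma> * s)\<^sup>2 / 2
      = - ((\<sigma> / 2 - y) / s)\<^sup>2 / 2"
    using s by (simp add: field_simps power2_eq_square)
  thus ?thesis using s unfolding put_gamma_def std_normal_density_def
    by (simp add: exp_add[symmetric] real_sqrt_mult)
qed

lemma DERIV_put_tilt:
  assumes "\<tau> > 0"
  shows "((\<lambda>y. put_tilt \<sigma> y \<tau>) has_real_derivative \<sigma> * put_tilt \<sigma> y \<tau> - put_gamma \<sigma> y \<tau>) (at y)"
proof -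
  have "sqrt \<tau> > 0" using assms by simp
  thus ?thesis using tilt_density[OF assms, of \<sigma> y] assms unfolding put_tilt_def
    by (auto intro!: derivative_eq_intros simp: field_simps)
qed

lemma DERIV_put:
  assumes "\<tau> > 0"
  shows "((\<lambda>y. put \<sigma> y \<tau>) has_real_derivative - \<sigma> * put_tilt \<sigma> y \<tau>) (at y)"
proof -
  have "((\<lambda>y. (\<sigma> / 2 - y) / sqrt \<tau>) has_real_derivative - 1 / sqrt \<tau>) (at y)"
    by (rule DERIV_cdivide) (auto intro!: derivative_eq_intros)
  from DERIV_diff[OF DERIV_std_normal_cdf[OF this] DERIV_put_tilt[OF assms, of \<sigma>]]
  show ?thesis unfolding put_def
    by (rule DERIV_cong) (simp add: put_gamma_def)
qed

lemma DERIV_put_gamma: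
  assumes "\<tau> > 0"
  shows "((\<lambda>y. put_gamma \<sigma> y \<tau>) has_real_derivative (\<sigma> / 2 - y) / \<tau> * put_gamma \<sigma> y \<tau>) (at y)"
proof -
  have "sqrt \<tau> * sqrt \<tau> = \<tau>" using assms by simp
  thus ?thesis using assms unfolding put_gamma_def
    by (auto intro!: derivative_eq_intros simp: field_simps)
qed

lemma DERIV_put_gamma2:
  assumes "\<tau> > 0"
  shows "((\<lambda>y. (\<sigma> / 2 - y) / \<tau> * put_gamma \<sigma> y \<tau>) has_real_derivative
     ((\<sigma> / 2 - y)\<^sup>2 / \<tau>\<^sup>2 - 1 / \<tau>) * put_gamma \<sigma> y \<tau>) (at y)"
  using assms
  by (auto intro!: derivative_eq_intros DERIV_put_gamma simp: field_simps power2_eq_square)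

lemma DERIV_time_aux:
  assumes "\<tau> > 0"
  shows "((\<lambda>\<tau>. b / sqrt \<tau>) has_real_derivative - (b / (2 * \<tau> * sqrt \<tau>))) (at \<tau>)"
proof -
  have "sqrt \<tau> * sqrt \<tau> = \<tau>" "sqrt \<tau> > 0" using assms by auto
  thus ?thesis using assms
    by (auto intro!: derivative_eq_intros simp: field_simps)
qed

lemma DERIV_put_tilt_time:
  assumes "\<tau> > 0"
  shows "((\<lambda>\<tau>. put_tilt \<sigma> y \<tau>) has_real_derivative
     \<sigma>\<^sup>2 / 2 * put_tilt \<sigma> y \<tau> - ((\<sigma> / 2 - y) / \<tau> + \<sigma>) / 2 * put_gamma \<sigma> y \<tau>) (at \<tau>)"
proof -
  define E where "E = (\<lambda>\<tau>. exp (\<sigma> * y - \<sigma>\<^sup>2 / 2 + \<sigma>\<^sup>2 * \<tau> / 2))"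
  define b where "b = (\<lambda>\<tau>. (\<sigma> / 2 - y) / sqrt \<tau> - \<sigma> * sqrt \<tau>)"
  define s where "s = sqrt \<tau>"
  have s: "s > 0" "\<tau> = s * s" using assms by (auto simp: s_def)
  have E: "(E has_real_derivative E \<tau> * (\<sigma>\<^sup>2 / 2)) (at \<tau>)"
    unfolding E_def by (auto intro!: derivative_eq_intros)
  have "(b has_real_derivative - ((\<sigma> / 2 - y) / (2 * \<tau> * sqrt \<tau>)) - \<sigma> * (inverse (sqrt \<tau>) / 2)) (at \<tau>)"
    unfolding b_def using assms
    by (intro DERIV_diff DERIV_time_aux DERIV_cmult DERIV_real_sqrt) 
  hence b: "(b has_real_derivative - (((\<sigma> / 2 - y) / \<tau> + \<sigma>) / (2 * s))) (at \<tau>)"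
    by (rule DERIV_cong) (use s in \<open>auto simp: s_def[symmetric] field_simps\<close>)
  have "((\<lambda>\<tau>. E \<tau> * std_normal_cdf (b \<tau>)) has_real_derivative
      E \<tau> * (\<sigma>\<^sup>2 / 2) * std_normal_cdf (b \<tau>)
      + std_normal_density (b \<tau>) * - (((\<sigma> / 2 - y) / \<tau> + \<sigma>) / (2 * s)) * E \<tau>) (at \<tau>)"
    by (intro DERIV_mult E DERIV_std_normal_cdf b)
  also have "std_normal_density (b \<tau>) * - (((\<sigma> / 2 - y) / \<tau> + \<sigma>) / (2 * s)) * E \<tau>
      = (E \<tau> * std_normal_density (b \<tau>)) * - (((\<sigma> / 2 - y) / \<tau> + \<sigma>) / (2 * s))" by simp
  also have "E \<tau> * std_normal_density (b \<tau>) = s * put_gamma \<sigma> y \<tau>"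
    unfolding E_def b_def s_def by (rule tilt_density[OF assms])
  finally have D: "((\<lambda>\<tau>. E \<tau> * std_normal_cdf (b \<tau>)) has_real_derivative
      E \<tau> * (\<sigma>\<^sup>2 / 2) * std_normal_cdf (b \<tau>)
      + s * put_gamma \<sigma> y \<tau> * - (((\<sigma> / 2 - y) / \<tau> + \<sigma>) / (2 * s))) (at \<tau>)" .
  have eq: "put_tilt \<sigma> y = (\<lambda>\<tau>. E \<tau> * std_normal_cdf (b \<tau>))"
    by (simp add: put_tilt_def E_def b_def fun_eq_iff)
  show ?thesis unfolding eq
    by (rule DERIV_cong[OF D]) (use s(1) in \<open>simp add: field_simps\<close>)
qed

lemma DERIV_put_time:
  assumes "\<tau> > 0"
  shows "((\<lambda>\<tau>. put \<sigma> y \<tau>) has_real_derivative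
     (\<sigma> * put_gamma \<sigma> y \<tau> - \<sigma>\<^sup>2 * put_tilt \<sigma> y \<tau>) / 2) (at \<tau>)"
  unfolding put_def
proof (rule DERIV_cong[OF DERIV_diff[OF DERIV_std_normal_cdf[OF DERIV_time_aux[OF assms]]
    DERIV_put_tilt_time[OF assms]]])
qed (use assms in \<open>simp add: put_gamma_def field_simps\<close>)

lemma DERIV_put_gamma_time:
  assumes "\<tau> > 0"
  shows "((\<lambda>\<tau>. put_gamma \<sigma> y \<tau>) has_real_derivative
     ((\<sigma> / 2 - y)\<^sup>2 / \<tau>\<^sup>2 - 1 / \<tau>) / 2 * put_gamma \<sigma> y \<tau>) (at \<tau>)"
proof -
  define s where "s = sqrt \<tau>"
  have s: "s > 0" "\<tau> = s * s" using assms by (auto simp: s_def)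
  have e: "put_gamma \<sigma> y = (\<lambda>\<tau>. std_normal_density ((\<sigma> / 2 - y) / sqrt \<tau>) * (1 / sqrt \<tau>))"
    by (simp add: put_gamma_def fun_eq_iff)
  show ?thesis unfolding e
  proof (rule DERIV_cong[OF DERIV_mult[OF DERIV_std_normal_density[OF DERIV_time_aux[OF assms]]
      DERIV_time_aux[OF assms]]])
  qed (use s in \<open>simp add: s_def[symmetric] power2_eq_square field_simps\<close>)
qed

text \<open>
  The upper bound is precisely Chernoff's bound at \<open>t = \<sigma> \<surd>\<tau>\<close>.
\<close>
lemma put_tilt_bounds:
  assumes "\<sigma> \<ge> 0" "\<tau> > 0"
  shows "0 \<le> put_tilt \<sigma> y \<tau>" "put_tilt \<sigma> y \<tau> \<le> 1"
proof -
  define s where "s = sqrt \<tau>"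
  have s: "s > 0" "\<tau> = s * s" using assms by (auto simp: s_def)
  show "0 \<le> put_tilt \<sigma> y \<tau>" by (simp add: put_tilt_def std_normal_cdf_nonneg)
  have "put_tilt \<sigma> y \<tau> = exp (\<sigma> * y - \<sigma>\<^sup>2 / 2 + \<sigma>\<^sup>2 * \<tau> / 2) * std_normal_cdf ((\<sigma> / 2 - y) / s - \<sigma> * s)"
    by (simp add: put_tilt_def s_def)
  also have "\<dots> \<le> exp (\<sigma> * y - \<sigma>\<^sup>2 / 2 + \<sigma>\<^sup>2 * \<tau> / 2)
      * exp ((\<sigma> * s) * ((\<sigma> / 2 - y) / s - \<sigma> * s) + (\<sigma> * s)\<^sup>2 / 2)"
    by (intro mult_left_mono std_normal_cdf_chernoff) (use assms s in auto)
  also have "\<dots> = 1"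
    unfolding exp_add[symmetric] using s by (simp add: field_simps power2_eq_square)
  finally show "put_tilt \<sigma> y \<tau> \<le> 1" .
qed

lemma std_normal_density_moment_bounds:
  "std_normal_density a \<le> 1" "\<bar>a\<bar> * std_normal_density a \<le> 1" "a\<^sup>2 * std_normal_density a \<le> 1"
proof -
  have p: "2 \<le> sqrt (2 * pi)"
    by (rule real_le_rsqrt) (use pi_ge_two in \<open>simp add: power2_eq_square\<close>)
  have e: "1 + a\<^sup>2 / 2 \<le> exp (a\<^sup>2 / 2)" by (rule exp_ge_add_one_self)
  have k: "x * std_normal_density a \<le> 1" if "x \<le> 2 * exp (a\<^sup>2 / 2)" for x
  proof -
    have "x * std_normal_density a = x / (exp (a\<^sup>2 / 2) * sqrt (2 * pi))"
      by (simp add: std_normal_density_def exp_minus field_simps)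
    also have "\<dots> \<le> 2 * exp (a\<^sup>2 / 2) / (exp (a\<^sup>2 / 2) * sqrt (2 * pi))"
      by (rule divide_right_mono[OF that]) simp
    also have "\<dots> \<le> 1" using p by (simp add: field_simps)
    finally show ?thesis .
  qed
  have sq: "2 * \<bar>a\<bar> \<le> 1 + a\<^sup>2"
    using zero_le_power2[of "\<bar>a\<bar> - 1"] by (simp add: power2_eq_square algebra_simps)
  have z: "0 \<le> a\<^sup>2" by simp
  show "std_normal_density a \<le> 1" using k[of 1] e z by linarith
  show "\<bar>a\<bar> * std_normal_density a \<le> 1" using e z sq by (intro k) linarith
  show "a\<^sup>2 * std_normal_density a \<le> 1" using e by (intro k) linarith
qed

lemma put_gamma_bounds:
  fixes \<sigma> y \<tau> :: real
  assumes "\<tau> > 0"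
  shows "\<bar>put_gamma \<sigma> y \<tau>\<bar> \<le> 1 / sqrt \<tau>"
    and "\<bar>(\<sigma> / 2 - y) / \<tau> * put_gamma \<sigma> y \<tau>\<bar> \<le> 1 / \<tau>"
    and "\<bar>((\<sigma> / 2 - y)\<^sup>2 / \<tau>\<^sup>2 - 1 / \<tau>) * put_gamma \<sigma> y \<tau>\<bar> \<le> 2 / (\<tau> * sqrt \<tau>)"
proof -
  define s where "s = sqrt \<tau>"
  have s: "s > 0" "\<tau> = s * s" using assms by (auto simp: s_def)
  define a where "a = (\<sigma> / 2 - y) / s"
  define D where "D = std_normal_density a"
  have D0: "D \<ge> 0" by (simp add: D_def std_normal_density_def)
  note m = std_normal_density_moment_bounds[of a, folded D_def]
  have g: "put_gamma \<sigma> y \<tau> = D / s" by (simp add: put_gamma_def D_def a_def s_def)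
  have ay: "\<sigma> / 2 - y = a * s" using s by (simp add: a_def)
  show "\<bar>put_gamma \<sigma> y \<tau>\<bar> \<le> 1 / sqrt \<tau>"
    unfolding g s_def[symmetric] using m D0 s by (simp add: field_simps)
  have "(\<sigma> / 2 - y) / \<tau> * put_gamma \<sigma> y \<tau> = a * D / \<tau>"
    unfolding g ay using s by simp
  thus "\<bar>(\<sigma> / 2 - y) / \<tau> * put_gamma \<sigma> y \<tau>\<bar> \<le> 1 / \<tau>"
    using m(2) D0 assms by (simp add: abs_mult divide_right_mono)
  have "((\<sigma> / 2 - y)\<^sup>2 / \<tau>\<^sup>2 - 1 / \<tau>) * put_gamma \<sigma> y \<tau> = (a\<^sup>2 * D - D) / (\<tau> * s)"
    unfolding g ay using s by (simp add: field_simps power2_eq_square)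
  moreover have "\<bar>a\<^sup>2 * D - D\<bar> \<le> 2" using m(1,3) D0 mult_nonneg_nonneg[OF zero_le_power2[of a] D0]
      by linarith
  ultimately show "\<bar>((\<sigma> / 2 - y)\<^sup>2 / \<tau>\<^sup>2 - 1 / \<tau>) * put_gamma \<sigma> y \<tau>\<bar> \<le> 2 / (\<tau> * sqrt \<tau>)"
    unfolding s_def[symmetric] using assms s(1) by (simp add: divide_right_mono)
qed

text \<open>
  As a function of \<open>s = \<surd>\<tau>\<close> the put has a bounded derivative, and for \<open>s \<rightarrow> 0\<close> it tends to the
  payoff.
\<close>
lemma put_lipschitz_sqrt:
  assumes "\<sigma> > 0" "0 < \<tau>" "\<tau> \<le> 4"
  shows "\<bar>put \<sigma> y \<tau> - max 0 (1 - exp (\<sigma> * y - \<sigma>\<^sup>2 / 2))\<bar> \<le> (\<sigma> + 2 * \<sigma>\<^sup>2) * sqrt \<tau>"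
proof -
  define s where "s = sqrt \<tau>"
  have s: "0 < s" "s \<le> 2" "\<tau> = s\<^sup>2"
    using assms by (auto simp: s_def real_le_lsqrt)
  define h where "h = (\<lambda>s. put \<sigma> y (s\<^sup>2))"
  define h' where "h' = (\<lambda>s. s * (\<sigma> * put_gamma \<sigma> y (s\<^sup>2) - \<sigma>\<^sup>2 * put_tilt \<sigma> y (s\<^sup>2)))"
  have D: "(h has_real_derivative h' t) (at t)" if "t > 0" for t
  proof -
    have d: "((\<lambda>t. t\<^sup>2) has_real_derivative 2 * t) (at t)"
      by (auto intro!: derivative_eq_intros)
    show ?thesis unfolding h_def h'_def
      by (rule DERIV_cong[OF DERIV_chain2[OF DERIV_put_time d]]) (use that in auto)
  qed
  have B: "\<bar>h' t\<bar> \<le> \<sigma> + 2 * \<sigma>\<^sup>2" if "0 < t" "t \<le> 2" for t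
  proof -
    have "\<bar>h' t\<bar> = t * \<bar>\<sigma> * put_gamma \<sigma> y (t\<^sup>2) - \<sigma>\<^sup>2 * put_tilt \<sigma> y (t\<^sup>2)\<bar>"
      using that by (simp add: h'_def abs_mult)
    also have "\<dots> \<le> t * (\<sigma> * \<bar>put_gamma \<sigma> y (t\<^sup>2)\<bar> + \<sigma>\<^sup>2 * \<bar>put_tilt \<sigma> y (t\<^sup>2)\<bar>)"
      using that assms by (intro mult_left_mono order.trans[OF abs_triangle_ineq4]) (auto simp:
          abs_mult)
    also have "\<dots> \<le> t * (\<sigma> * (1 / t) + \<sigma>\<^sup>2 * 1)"
      using that assms put_gamma_bounds(1)[of "t\<^sup>2" \<sigma> y] put_tilt_bounds[of \<sigma> "t\<^sup>2" y]
      by (intro mult_left_mono add_mono) auto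
    also have "\<dots> = \<sigma> + t * \<sigma>\<^sup>2" using that by (simp add: field_simps)
    also have "\<dots> \<le> \<sigma> + 2 * \<sigma>\<^sup>2" using that by (intro add_left_mono mult_right_mono) auto
    finally show ?thesis .
  qed
  have L: "\<bar>h s - h t\<bar> \<le> (\<sigma> + 2 * \<sigma>\<^sup>2) * s" if "0 < t" "t < s" for t
  proof -
    have "\<exists>z>t. z < s \<and> h s - h t = (s - t) * h' z"
      by (rule MVT2) (use that D in auto)
    then obtain z where z: "t < z" "z < s" "h s - h t = (s - t) * h' z" by blast
    have "\<bar>h s - h t\<bar> = (s - t) * \<bar>h' z\<bar>" using z by (simp add: abs_mult)
    also have "\<dots> \<le> s * (\<sigma> + 2 * \<sigma>\<^sup>2)"
      using z that s assms by (intro mult_mono B) auto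
    finally show ?thesis by (simp add: mult.commute)
  qed
  have inv: "filterlim (\<lambda>t::real. inverse t) at_top (at_right 0)"
    by (rule filterlim_inverse_at_top_right)
  have ev: "\<forall>\<^sub>F t in at_right 0. t > (0::real)" by (rule eventually_at_right_less)
  have heq: "\<forall>\<^sub>F t in at_right 0. std_normal_cdf ((\<sigma> / 2 - y) * inverse t)
       - exp (\<sigma> * y - \<sigma>\<^sup>2 / 2 + \<sigma>\<^sup>2 * t\<^sup>2 / 2) * std_normal_cdf ((\<sigma> / 2 - y) * inverse t + - (\<sigma> *
           t)) = h t"
    using ev by eventually_elim (simp only: h_def put_def put_tilt_def real_sqrt_abs abs_of_pos
        divide_inverse add_uminus_conv_diff)
  have right_lim: "(F \<longlongrightarrow> F 0) (at_right 0)" if "isCont F 0" for F :: "real \<Rightarrow> real"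
    using tendsto_within_subset[OF isContD[OF that] subset_UNIV] .
  have explim: "((\<lambda>t. exp (\<sigma> * y - \<sigma>\<^sup>2 / 2 + \<sigma>\<^sup>2 * t\<^sup>2 / 2)) \<longlongrightarrow> exp (\<sigma> * y - \<sigma>\<^sup>2 / 2)) (at_right 0)"
    using right_lim[of "\<lambda>t. exp (\<sigma> * y - \<sigma>\<^sup>2 / 2 + \<sigma>\<^sup>2 * t\<^sup>2 / 2)"] by simp
  have sl: "((\<lambda>t. - (\<sigma> * t)) \<longlongrightarrow> 0) (at_right 0)"
    using right_lim[of "\<lambda>t. - (\<sigma> * t)"] by simp
  have "(h \<longlongrightarrow> max 0 (1 - exp (\<sigma> * y - \<sigma>\<^sup>2 / 2))) (at_right 0)"
  proof -
    consider "y < \<sigma> / 2" | "y = \<sigma> / 2" | "y > \<sigma> / 2" by linarith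
    thus ?thesis
    proof cases
      case 1
      have "\<sigma> * y - \<sigma>\<^sup>2 / 2 = \<sigma> * (y - \<sigma> / 2)" by (simp add: power2_eq_square algebra_simps)
      also have "\<dots> \<le> 0" using 1 assms by (intro mult_nonneg_nonpos) auto
      finally have m: "max 0 (1 - exp (\<sigma> * y - \<sigma>\<^sup>2 / 2)) = 1 - exp (\<sigma> * y - \<sigma>\<^sup>2 / 2) * 1"
        by simp
      have l1: "filterlim (\<lambda>t. (\<sigma> / 2 - y) * inverse t) at_top (at_right 0)"
        by (rule filterlim_tendsto_pos_mult_at_top[OF tendsto_const _ inv]) (use 1 in auto)
      have l2: "filterlim (\<lambda>t. (\<sigma> / 2 - y) * inverse t + - (\<sigma> * t)) at_top (at_right 0)"
        using filterlim_tendsto_add_at_top[OF sl l1] by (simp add: add.commute)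
      show ?thesis unfolding m
        by (rule Lim_transform_eventually[OF _ heq])
           (intro tendsto_diff tendsto_mult explim filterlim_compose[OF std_normal_cdf_at_top] l1 l2)
    next
      case 2
      have m: "max 0 (1 - exp (\<sigma> * y - \<sigma>\<^sup>2 / 2)) = std_normal_cdf 0 - exp (\<sigma> * y - \<sigma>\<^sup>2 / 2) *
          std_normal_cdf 0"
        unfolding 2 by (simp add: power2_eq_square)
      have c: "isCont std_normal_cdf 0" by (rule DERIV_isCont[OF std_normal_cdf_has_derivative])
      have l2: "((\<lambda>t. std_normal_cdf ((\<sigma> / 2 - y) * inverse t + - (\<sigma> * t))) \<longlongrightarrow> std_normal_cdf 0)
          (at_right 0)"
        using isCont_tendsto_compose[OF c sl] by (simp add: 2)
      show ?thesis unfolding m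
        by (rule Lim_transform_eventually[OF _ heq])
           (intro tendsto_diff tendsto_mult explim l2, simp add: 2)
    next
      case 3
      have "\<sigma> * y - \<sigma>\<^sup>2 / 2 = \<sigma> * (y - \<sigma> / 2)" by (simp add: power2_eq_square algebra_simps)
      also have "\<dots> \<ge> 0" using 3 assms by (intro mult_nonneg_nonneg) auto
      finally have m: "max 0 (1 - exp (\<sigma> * y - \<sigma>\<^sup>2 / 2)) = 0 - exp (\<sigma> * y - \<sigma>\<^sup>2 / 2) * 0"
        by simp
      have l1: "filterlim (\<lambda>t. (\<sigma> / 2 - y) * inverse t) at_bot (at_right 0)"
        by (rule filterlim_tendsto_neg_mult_at_bot[OF tendsto_const _ inv]) (use 3 in auto)
      have l2: "filterlim (\<lambda>t. (\<sigma> / 2 - y) * inverse t + - (\<sigma> * t)) at_bot (at_right 0)"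
        using filterlim_tendsto_add_at_top[OF tendsto_minus[OF sl] l1[unfolded filterlim_uminus_at_bot]]
        unfolding filterlim_uminus_at_bot by (simp only: minus_add_distrib add.commute)
      show ?thesis unfolding m
        by (rule Lim_transform_eventually[OF _ heq])
           (intro tendsto_diff tendsto_mult explim filterlim_compose[OF std_normal_cdf_at_bot] l1 l2)
    qed
  qed
  hence "((\<lambda>t. \<bar>h s - h t\<bar>) \<longlongrightarrow> \<bar>h s - max 0 (1 - exp (\<sigma> * y - \<sigma>\<^sup>2 / 2))\<bar>) (at_right 0)"
    by (intro tendsto_intros)
  moreover have "\<forall>\<^sub>F t in at_right 0. \<bar>h s - h t\<bar> \<le> (\<sigma> + 2 * \<sigma>\<^sup>2) * s"
    using eventually_at_right_real[OF s(1)] by eventually_elim (auto intro: L)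
  ultimately have "\<bar>h s - max 0 (1 - exp (\<sigma> * y - \<sigma>\<^sup>2 / 2))\<bar> \<le> (\<sigma> + 2 * \<sigma>\<^sup>2) * s"
    by (intro tendsto_upperbound[of _ _ "at_right 0"]) auto
  thus ?thesis using s by (simp add: h_def s_def[symmetric])
qed

text \<open>
  \<open>put_D2\<close>, \<open>put_D3\<close>, \<open>put_D4\<close> are the derivatives of \<open>put\<close> in \<open>y\<close> of these orders.
\<close>
definition put_D2 :: "real \<Rightarrow> real \<Rightarrow> real \<Rightarrow> real" where
  "put_D2 \<sigma> y \<tau> = - \<sigma> * (\<sigma> * put_tilt \<sigma> y \<tau> - put_gamma \<sigma> y \<tau>)"

definition put_D3 :: "real \<Rightarrow> real \<Rightarrow> real \<Rightarrow> real" where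
  "put_D3 \<sigma> y \<tau> = - \<sigma> * (\<sigma> * (\<sigma> * put_tilt \<sigma> y \<tau> - put_gamma \<sigma> y \<tau>)
      - (\<sigma> / 2 - y) / \<tau> * put_gamma \<sigma> y \<tau>)"

definition put_D4 :: "real \<Rightarrow> real \<Rightarrow> real \<Rightarrow> real" where
  "put_D4 \<sigma> y \<tau> = - \<sigma> * (\<sigma> * (\<sigma> * (\<sigma> * put_tilt \<sigma> y \<tau> - put_gamma \<sigma> y \<tau>)
      - (\<sigma> / 2 - y) / \<tau> * put_gamma \<sigma> y \<tau>)
      - ((\<sigma> / 2 - y)\<^sup>2 / \<tau>\<^sup>2 - 1 / \<tau>) * put_gamma \<sigma> y \<tau>)"

lemma DERIV_put_D2: "\<tau> > 0 \<Longrightarrow> ((\<lambda>y. - \<sigma> * put_tilt \<sigma> y \<tau>) has_real_derivative put_D2 \<sigma> y \<tau>) (at y)"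
  unfolding put_D2_def by (intro DERIV_cmult DERIV_put_tilt)

lemma DERIV_put_D3: "\<tau> > 0 \<Longrightarrow> ((\<lambda>y. put_D2 \<sigma> y \<tau>) has_real_derivative put_D3 \<sigma> y \<tau>) (at y)"
  unfolding put_D2_def put_D3_def by (intro DERIV_cmult DERIV_diff DERIV_put_tilt DERIV_put_gamma)

lemma DERIV_put_D4: "\<tau> > 0 \<Longrightarrow> ((\<lambda>y. put_D3 \<sigma> y \<tau>) has_real_derivative put_D4 \<sigma> y \<tau>) (at y)"
  unfolding put_D3_def put_D4_def
  by (intro DERIV_cmult DERIV_diff DERIV_put_tilt DERIV_put_gamma DERIV_put_gamma2)

text \<open>
  The heat equation: averaging over a normal law of variance \<open>\<tau>\<close> is the heat flow up to the time
  \<open>\<tau>\<close>.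
\<close>
lemma DERIV_put_time1: "\<tau> > 0 \<Longrightarrow> ((\<lambda>\<tau>. put \<sigma> y \<tau>) has_real_derivative put_D2 \<sigma> y \<tau> / 2) (at \<tau>)"
  by (rule DERIV_cong[OF DERIV_put_time]) (auto simp: put_D2_def algebra_simps power2_eq_square)

lemma DERIV_put_time2:
  assumes "\<tau> > 0"
  shows "((\<lambda>\<tau>. put_D2 \<sigma> y \<tau>) has_real_derivative put_D4 \<sigma> y \<tau> / 2) (at \<tau>)"
  unfolding put_D2_def
  by (rule DERIV_cong[OF DERIV_cmult[OF DERIV_diff[OF DERIV_cmult[OF DERIV_put_tilt_time]
      DERIV_put_gamma_time]]])
     (use assms in \<open>auto simp: put_D4_def field_simps power2_eq_square\<close>)

definition put_const :: "real \<Rightarrow> real" where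
  "put_const \<sigma> = 8 * \<sigma>^4 + 8 * \<sigma>^3 + 8 * \<sigma>\<^sup>2 + 8 * \<sigma>"

text \<open>
  Each derivative beyond the first costs a factor \<open>1 / \<surd>\<tau>\<close>, since the payoff is Lipschitz but
  not differentiable. Four derivatives therefore cost \<open>\<tau>\<^sup>-\<^sup>3\<^sup>/\<^sup>2\<close>.
\<close>
lemma put_D_bounds:
  assumes "\<sigma> > 0" "0 < \<tau>" "\<tau> \<le> 4"
  shows "\<bar>put_D2 \<sigma> y \<tau>\<bar> \<le> put_const \<sigma> / sqrt \<tau>"
    and "\<bar>put_D3 \<sigma> y \<tau>\<bar> \<le> put_const \<sigma> / \<tau>"
    and "\<bar>put_D4 \<sigma> y \<tau>\<bar> \<le> put_const \<sigma> / (\<tau> * sqrt \<tau>)"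
proof -
  define w where "w = 1 / sqrt \<tau>"
  have "sqrt \<tau> \<le> 2" using assms by (intro real_le_lsqrt) auto
  hence w: "1 \<le> 2 * w" using assms by (simp add: w_def field_simps)
  have ww: "1 / \<tau> = w * w" "1 / (\<tau> * sqrt \<tau>) = w * w * w" using assms by (auto simp: w_def)
  define t where "t = put_tilt \<sigma> y \<tau>"
  define g where "g = put_gamma \<sigma> y \<tau>"
  define g1 where "g1 = (\<sigma> / 2 - y) / \<tau> * put_gamma \<sigma> y \<tau>"
  define g2 where "g2 = ((\<sigma> / 2 - y)\<^sup>2 / \<tau>\<^sup>2 - 1 / \<tau>) * put_gamma \<sigma> y \<tau>"
  have t: "\<bar>t\<bar> \<le> 1" using put_tilt_bounds[of \<sigma> \<tau> y] assms by (simp add: t_def)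
  have g: "\<bar>g\<bar> \<le> w" "\<bar>g1\<bar> \<le> w * w" "\<bar>g2\<bar> \<le> 2 * (w * w * w)"
  proof -
    have e: "2 / (\<tau> * sqrt \<tau>) = 2 * (w * w * w)" unfolding ww(2)[symmetric] by simp
    show "\<bar>g\<bar> \<le> w" using put_gamma_bounds(1)[OF assms(2), of \<sigma> y] by (simp only: g_def w_def)
    show "\<bar>g1\<bar> \<le> w * w" using put_gamma_bounds(2)[OF assms(2), of \<sigma> y] by (simp only: g1_def ww(1))
    show "\<bar>g2\<bar> \<le> 2 * (w * w * w)" using put_gamma_bounds(3)[OF assms(2), of \<sigma> y] by (simp only:
        g2_def e)
  qed
  have s: "0 \<le> \<sigma>" "0 \<le> \<sigma>\<^sup>2" "0 \<le> \<sigma>^3" "0 \<le> \<sigma>^4" using assms by auto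
  have w2: "w \<le> 2 * (w * w)" using mult_right_mono[OF w, of w] w by (simp add: algebra_simps)
  have w3: "w * w \<le> 2 * (w * w * w)" using mult_right_mono[OF w, of "w*w"] by (simp add: algebra_simps)
  have B1: "\<bar>t\<bar> \<le> 8 * w" "\<bar>g\<bar> \<le> 8 * w" using t g w by linarith+
  have B2: "\<bar>t\<bar> \<le> 8 * (w * w)" "\<bar>g\<bar> \<le> 8 * (w * w)" "\<bar>g1\<bar> \<le> 8 * (w * w)"
    using t g w w2 by linarith+
  have B3: "\<bar>t\<bar> \<le> 8 * (w * w * w)" "\<bar>g\<bar> \<le> 8 * (w * w * w)"
    "\<bar>g1\<bar> \<le> 8 * (w * w * w)" "\<bar>g2\<bar> \<le> 8 * (w * w * w)"
    using t g w w2 w3 by linarith+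
  have "\<bar>put_D2 \<sigma> y \<tau>\<bar> \<le> \<sigma>\<^sup>2 * \<bar>t\<bar> + \<sigma> * \<bar>g\<bar>"
  proof -
    have "put_D2 \<sigma> y \<tau> = \<sigma> * g - \<sigma>\<^sup>2 * t"
      by (simp add: put_D2_def t_def g_def algebra_simps power2_eq_square)
    thus ?thesis using abs_triangle_ineq4[of "\<sigma> * g" "\<sigma>\<^sup>2 * t"] s by (simp add: abs_mult)
  qed
  also have "\<dots> \<le> \<sigma>\<^sup>2 * (8 * w) + \<sigma> * (8 * w)"
    using s B1 by (intro add_mono mult_left_mono)
  also have "\<dots> \<le> put_const \<sigma> * w" using s w unfolding put_const_def by (simp add: algebra_simps)
  finally show "\<bar>put_D2 \<sigma> y \<tau>\<bar> \<le> put_const \<sigma> / sqrt \<tau>" by (simp add: w_def)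
  have "\<bar>put_D3 \<sigma> y \<tau>\<bar> \<le> \<sigma>^3 * \<bar>t\<bar> + \<sigma>\<^sup>2 * \<bar>g\<bar> + \<sigma> * \<bar>g1\<bar>"
  proof -
    have "put_D3 \<sigma> y \<tau> = \<sigma>\<^sup>2 * g - \<sigma>^3 * t + \<sigma> * g1"
      unfolding put_D3_def t_def[symmetric] g1_def[symmetric]
      by (simp add: g_def algebra_simps power2_eq_square power3_eq_cube)
    moreover have "\<bar>\<sigma>\<^sup>2 * g\<bar> = \<sigma>\<^sup>2 * \<bar>g\<bar>" "\<bar>\<sigma>^3 * t\<bar> = \<sigma>^3 * \<bar>t\<bar>" "\<bar>\<sigma> * g1\<bar> = \<sigma> * \<bar>g1\<bar>"
      using s by (auto simp: abs_mult)
    ultimately show ?thesis by linarith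
  qed
  also have "\<dots> \<le> \<sigma>^3 * (8 * (w * w)) + \<sigma>\<^sup>2 * (8 * (w * w)) + \<sigma> * (8 * (w * w))"
    using s B2 by (intro add_mono mult_left_mono)
  also have "\<dots> \<le> put_const \<sigma> * (w * w)" using s w unfolding put_const_def by (simp add: algebra_simps)
  finally show "\<bar>put_D3 \<sigma> y \<tau>\<bar> \<le> put_const \<sigma> / \<tau>" by (simp add: ww(1)[symmetric])
  have "\<bar>put_D4 \<sigma> y \<tau>\<bar> \<le> \<sigma>^4 * \<bar>t\<bar> + \<sigma>^3 * \<bar>g\<bar> + \<sigma>\<^sup>2 * \<bar>g1\<bar> + \<sigma> * \<bar>g2\<bar>"
  proof -
    have "put_D4 \<sigma> y \<tau> = \<sigma>^3 * g - \<sigma>^4 * t + \<sigma>\<^sup>2 * g1 + \<sigma> * g2"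
      unfolding put_D4_def t_def[symmetric] g1_def[symmetric] g2_def[symmetric]
      by (simp add: g_def algebra_simps power2_eq_square power3_eq_cube power4_eq_xxxx)
    moreover have "\<bar>\<sigma>^3 * g\<bar> = \<sigma>^3 * \<bar>g\<bar>" "\<bar>\<sigma>^4 * t\<bar> = \<sigma>^4 * \<bar>t\<bar>"
        "\<bar>\<sigma>\<^sup>2 * g1\<bar> = \<sigma>\<^sup>2 * \<bar>g1\<bar>" "\<bar>\<sigma> * g2\<bar> = \<sigma> * \<bar>g2\<bar>"
      using s by (auto simp: abs_mult)
    ultimately show ?thesis by linarith
  qed
  also have "\<dots> \<le> \<sigma>^4 * (8 * (w * w * w)) + \<sigma>^3 * (8 * (w * w * w)) + \<sigma>\<^sup>2 * (8 * (w * w * w)) + \<sigma> *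
      (8 * (w * w * w))"
    using s B3 by (intro add_mono mult_left_mono)
  also have "\<dots> = put_const \<sigma> * (w * w * w)" unfolding put_const_def by (simp add: algebra_simps)
  finally show "\<bar>put_D4 \<sigma> y \<tau>\<bar> \<le> put_const \<sigma> / (\<tau> * sqrt \<tau>)" by (simp add: ww(2)[symmetric])
qed

lemma put_taylor_space:
  assumes "\<sigma> > 0" "0 < \<tau>" "\<tau> \<le> 4"
  shows "\<bar>put \<sigma> (y + d) \<tau> - (put \<sigma> y \<tau> - \<sigma> * put_tilt \<sigma> y \<tau> * d
      + put_D2 \<sigma> y \<tau> / 2 * d\<^sup>2 + put_D3 \<sigma> y \<tau> / 6 * d ^ 3)\<bar>
    \<le> put_const \<sigma> / (\<tau> * sqrt \<tau>) * d ^ 4"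
proof (cases "d = 0")
  case False
  define D where "D = (\<lambda>i::nat. if i = 0 then (\<lambda>y. put \<sigma> y \<tau>) else if i = 1 then (\<lambda>y. - \<sigma> * put_tilt
      \<sigma> y \<tau>)
     else if i = 2 then (\<lambda>y. put_D2 \<sigma> y \<tau>) else if i = 3 then (\<lambda>y. put_D3 \<sigma> y \<tau>) else (\<lambda>y. put_D4 \<sigma>
         y \<tau>))"
  have D0: "D 0 = (\<lambda>y. put \<sigma> y \<tau>)" by (simp add: D_def)
  have DD: "(D i has_real_derivative D (Suc i) t) (at t)" if "i < 4" for i t
  proof -
    consider "i = 0" | "i = 1" | "i = 2" | "i = 3" using \<open>i < 4\<close> by (auto simp: eval_nat_numeral
        less_Suc_eq)
    thus ?thesis using assms(2)
      by cases (auto simp: D_def intro: DERIV_put[simplified] DERIV_put_D2[simplified] DERIV_put_D3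
          DERIV_put_D4)
  qed
  have "\<exists>t. (if y + d < y then y + d < t \<and> t < y else y < t \<and> t < y + d) \<and>
      put \<sigma> (y + d) \<tau> = (\<Sum>m<4. D m y / fact m * (y + d - y) ^ m) + D 4 t / fact 4 * (y + d - y) ^ 4"
    by (rule Taylor[where a="min y (y + d)" and b="max y (y + d)"])
       (use DD False in \<open>auto simp: D0\<close>)
  then obtain t where t: "put \<sigma> (y + d) \<tau> = (\<Sum>m<4. D m y / fact m * d ^ m) + D 4 t / fact 4 * d ^ 4"
      by auto
  have "(\<Sum>m<4. D m y / fact m * d ^ m) = put \<sigma> y \<tau> - \<sigma> * put_tilt \<sigma> y \<tau> * d
      + put_D2 \<sigma> y \<tau> / 2 * d\<^sup>2 + put_D3 \<sigma> y \<tau> / 6 * d ^ 3"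
    by (simp add: D_def eval_nat_numeral lessThan_Suc fact_numeral)
  hence "\<bar>put \<sigma> (y + d) \<tau> - (put \<sigma> y \<tau> - \<sigma> * put_tilt \<sigma> y \<tau> * d
      + put_D2 \<sigma> y \<tau> / 2 * d\<^sup>2 + put_D3 \<sigma> y \<tau> / 6 * d ^ 3)\<bar> = \<bar>put_D4 \<sigma> t \<tau>\<bar> / 24 * d ^ 4"
    unfolding t by (simp add: D_def abs_mult fact_numeral)
  also have "\<dots> \<le> put_const \<sigma> / (\<tau> * sqrt \<tau>) * d ^ 4"
  proof (rule mult_right_mono)
    have "\<bar>put_D4 \<sigma> t \<tau>\<bar> / 24 \<le> \<bar>put_D4 \<sigma> t \<tau>\<bar>" by simp
    also note put_D_bounds(3)[OF assms, of t]
    finally show "\<bar>put_D4 \<sigma> t \<tau>\<bar> / 24 \<le> put_const \<sigma> / (\<tau> * sqrt \<tau>)" .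
  qed simp
  finally show ?thesis .
qed simp

lemma put_taylor_time:
  assumes "\<sigma> > 0" "0 < \<tau>" "0 \<le> \<Delta>" "\<tau> + \<Delta> \<le> 4"
  shows "\<bar>put \<sigma> y (\<tau> + \<Delta>) - (put \<sigma> y \<tau> + put_D2 \<sigma> y \<tau> / 2 * \<Delta>)\<bar>
    \<le> put_const \<sigma> / (\<tau> * sqrt \<tau>) * \<Delta>\<^sup>2"
proof (cases "\<Delta> = 0")
  case False
  define D where "D = (\<lambda>i::nat. if i = 0 then (\<lambda>t. put \<sigma> y t) else if i = 1 then (\<lambda>t. put_D2 \<sigma> y t / 2)
     else (\<lambda>t. put_D4 \<sigma> y t / 4))"
  have D0: "D 0 = (\<lambda>t. put \<sigma> y t)" by (simp add: D_def)
  have DD: "(D i has_real_derivative D (Suc i) t) (at t)" if "i < 2" "t > 0" for i t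
  proof -
    consider "i = 0" | "i = 1" using \<open>i < 2\<close> by (auto simp: eval_nat_numeral less_Suc_eq)
    thus ?thesis using that(2) DERIV_cdivide[where c=2, OF DERIV_put_time2[where \<tau>=t and \<sigma>=\<sigma> and y=y]]
      by cases (auto simp: D_def intro: DERIV_put_time1)
  qed
  have "\<exists>t. (if \<tau> + \<Delta> < \<tau> then \<tau> + \<Delta> < t \<and> t < \<tau> else \<tau> < t \<and> t < \<tau> + \<Delta>) \<and>
      put \<sigma> y (\<tau> + \<Delta>) = (\<Sum>m<2. D m \<tau> / fact m * (\<tau> + \<Delta> - \<tau>) ^ m) + D 2 t / fact 2 * (\<tau> + \<Delta> - \<tau>) ^ 2"
    by (rule Taylor[where a=\<tau> and b="\<tau> + \<Delta>"])
       (use DD False assms in \<open>auto simp: D0\<close>)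
  then obtain t where t: "put \<sigma> y (\<tau> + \<Delta>) = (\<Sum>m<2. D m \<tau> / fact m * \<Delta> ^ m) + D 2 t / fact 2 * \<Delta> ^ 2"
    and tt: "\<tau> < t" "t < \<tau> + \<Delta>" using assms by auto
  have "(\<Sum>m<2. D m \<tau> / fact m * \<Delta> ^ m) = put \<sigma> y \<tau> + put_D2 \<sigma> y \<tau> / 2 * \<Delta>"
    by (simp add: D_def eval_nat_numeral lessThan_Suc)
  hence "\<bar>put \<sigma> y (\<tau> + \<Delta>) - (put \<sigma> y \<tau> + put_D2 \<sigma> y \<tau> / 2 * \<Delta>)\<bar> = \<bar>put_D4 \<sigma> y t\<bar> / 8 * \<Delta>\<^sup>2"
    unfolding t by (simp add: D_def abs_mult)
  also have "\<dots> \<le> put_const \<sigma> / (t * sqrt t) * \<Delta>\<^sup>2"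
  proof (rule mult_right_mono)
    have "\<bar>put_D4 \<sigma> y t\<bar> / 8 \<le> \<bar>put_D4 \<sigma> y t\<bar>" by simp
    also have "\<dots> \<le> put_const \<sigma> / (t * sqrt t)" by (rule put_D_bounds(3)) (use assms tt in auto)
    finally show "\<bar>put_D4 \<sigma> y t\<bar> / 8 \<le> put_const \<sigma> / (t * sqrt t)" .
  qed simp
  also have "\<dots> \<le> put_const \<sigma> / (\<tau> * sqrt \<tau>) * \<Delta>\<^sup>2"
    using assms tt by (intro mult_right_mono divide_left_mono mult_mono) (auto simp: put_const_def)
  finally show ?thesis .
qed simp

lemma put_0_1: "put \<sigma> 0 1 = 1 - 2 * std_normal_cdf (- (\<sigma> / 2))"
  using std_normal_cdf_minus[of "\<sigma> / 2"] by (simp add: put_def put_tilt_def)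

section \<open>Exponential moments of the number of ascents\<close>

lemma exp_le_quadratic:
  fixes z :: real
  assumes "\<bar>z\<bar> \<le> 1"
  shows "exp z \<le> 1 + z + z\<^sup>2"
proof (cases "0 \<le> z")
  case True
  thus ?thesis using assms by (intro exp_bound) auto
next
  case False
  define w where "w = - z"
  have w: "0 \<le> w" "w \<le> 1" using False assms by (auto simp: w_def)
  have q: "0 \<le> 1 - w + w\<^sup>2" using w zero_le_power2[of w] by linarith
  have "1 \<le> 1 + w ^ 3" using w by simp
  also have "\<dots> = (1 + w) * (1 - w + w\<^sup>2)" by (simp add: algebra_simps power2_eq_square power3_eq_cube)
  also have "\<dots> \<le> exp w * (1 - w + w\<^sup>2)" using q exp_ge_add_one_self[of w] by (intro mult_right_mono)
      auto
  finally have "1 / exp w \<le> 1 - w + w\<^sup>2" by (simp add: field_simps)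
  thus ?thesis by (simp add: w_def exp_minus field_simps)
qed

lemma exp_cubic:
  fixes z :: real
  assumes "\<bar>z\<bar> \<le> 1"
  shows "\<bar>exp z - (1 + z + z\<^sup>2 / 2)\<bar> \<le> \<bar>z\<bar> ^ 3"
proof -
  obtain t where t: "\<bar>t\<bar> \<le> \<bar>z\<bar>" "exp z = (\<Sum>m<3. z ^ m / fact m) + exp t / fact 3 * z ^ 3"
    using Maclaurin_exp_le[of z 3] by blast
  have "exp t \<le> exp 1" using t assms by simp
  also have "exp (1::real) \<le> 3" by (rule exp_le)
  finally have e: "exp t \<le> 6" by simp
  have "exp z - (1 + z + z\<^sup>2 / 2) = exp t / 6 * z ^ 3"
    unfolding t(2) by (simp add: eval_nat_numeral)
  hence "\<bar>exp z - (1 + z + z\<^sup>2 / 2)\<bar> = \<bar>exp t / 6\<bar> * \<bar>z\<bar> ^ 3" by (simp only: abs_mult power_abs)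
  also have "\<bar>exp t / 6\<bar> = exp t / 6" by simp
  also have "exp t / 6 * \<bar>z\<bar> ^ 3 \<le> 1 * \<bar>z\<bar> ^ 3" using e by (intro mult_right_mono) auto
  finally show ?thesis by simp
qed

lemma centred_ascents_half:
  assumes "\<pi> \<in> permutations_of_set {1..n}"
  shows "\<bar>centred_ascents \<pi>\<bar> \<le> real (Suc n) / 2"
proof (cases "n = 0")
  case False
  with centred_ascents_bound[OF assms] show ?thesis by simp
next
  case True
  with assms show ?thesis by (simp add: centred_ascents_def)
qed

text \<open>
  If the centred count \<open>x\<close> moves to \<open>x \<plusminus> 1 / 2\<close>, then \<open>(k - 1) x\<close> moves to \<open>k (x \<plusminus> 1 / 2)\<close>,
  which is a change by \<open>x \<plusminus> k / 2\<close>. The mean of this change is 0; its third moment is of smaller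
  order than \<open>k\<^sup>3\<close> because \<open>x\<close> is of the order \<open>\<surd>k\<close>.
\<close>
lemma two_point_moments:
  fixes x k :: real
  assumes "k > 0"
  shows "(1 / 2 - x / k) * (x + k / 2) + (1 / 2 + x / k) * (x - k / 2) = 0"
    and "(1 / 2 - x / k) * (x + k / 2)\<^sup>2 + (1 / 2 + x / k) * (x - k / 2)\<^sup>2 = k\<^sup>2 / 4 - x\<^sup>2"
    and "(1 / 2 - x / k) * (x + k / 2) ^ 3 + (1 / 2 + x / k) * (x - k / 2) ^ 3 = x * (k\<^sup>2 / 2 - 2 *
        x\<^sup>2)"
  using assms by (simp_all add: field_simps power2_eq_square power3_eq_cube)

text \<open>
  One step replaces \<open>t\<close> by \<open>t (1 - 1 / k)\<close> and multiplies by the exponential moment of a centred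
  variable with values in \<open>[-1, 1]\<close>, which is at most \<open>exp (t\<^sup>2)\<close>.
\<close>
lemma perm_avg_exp_le:
  assumes "1 \<le> n" "\<bar>t\<bar> \<le> 1"
  shows "perm_avg n (\<lambda>\<pi>. exp (t * centred_ascents \<pi>)) \<le> exp (real n * t\<^sup>2)"
  using assms
proof (induction n arbitrary: t rule: dec_induct)
  case base
  show ?case by (simp add: perm_avg_def centred_ascents_def permutations_of_set_singleton)
next
  case (step n)
  define k where "k = real (Suc n)"
  have k: "k > 0" "k = real n + 1" by (auto simp: k_def)
  define t' where "t' = t * (real n / k)"
  have n: "real n / k \<le> 1" "0 \<le> real n / k" using k by auto
  have t'2: "\<bar>t'\<bar> \<le> \<bar>t\<bar>" unfolding t'_def abs_mult using n by (intro mult_left_le) auto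
  hence t'1: "\<bar>t'\<bar> \<le> 1" "t'\<^sup>2 \<le> t\<^sup>2" using step.prems abs_le_square_iff by auto
  have "perm_avg (Suc n) (\<lambda>\<pi>. exp (t * centred_ascents \<pi>))
     \<le> perm_avg n (\<lambda>\<pi>. exp (t\<^sup>2) * exp (t' * centred_ascents \<pi>))"
    unfolding perm_avg_ascents_step[where f="\<lambda>x. exp (t * x)"]
  proof (rule perm_avg_mono)
    fix \<pi> assume \<pi>: "\<pi> \<in> permutations_of_set {1..n}"
    define x where "x = centred_ascents \<pi>"
    define y where "y = x / k"
    have "\<bar>x\<bar> \<le> k / 2" using centred_ascents_half[OF \<pi>] by (simp add: x_def k_def)
    hence y: "\<bar>y\<bar> \<le> 1 / 2" using k by (simp add: y_def field_simps abs_le_iff)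
    have xk: "x = y * k" using k by (simp add: y_def)
    have e: "t * (x + 1 / 2) = t' * x + t * (1 / 2 + y)" "t * (x - 1 / 2) = t' * x + t * (y - 1 / 2)"
      unfolding t'_def xk using k by (simp_all add: field_simps)
    have b: "\<bar>t * (1 / 2 + y)\<bar> \<le> 1" "\<bar>t * (y - 1 / 2)\<bar> \<le> 1"
      unfolding abs_mult using y step.prems by (intro mult_le_one; auto simp: abs_le_iff)+
    have "(1 / 2 - y) * exp (t * (1 / 2 + y)) + (1 / 2 + y) * exp (t * (y - 1 / 2))
      \<le> (1 / 2 - y) * (1 + t * (1 / 2 + y) + (t * (1 / 2 + y))\<^sup>2)
       + (1 / 2 + y) * (1 + t * (y - 1 / 2) + (t * (y - 1 / 2))\<^sup>2)"
      using y b by (intro add_mono mult_left_mono exp_le_quadratic) (auto simp: abs_le_iff)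
    also have "\<dots> = 1 + t\<^sup>2 * (1 / 4 - y\<^sup>2)" by (simp add: field_simps power2_eq_square)
    also have "\<dots> \<le> 1 + t\<^sup>2 * 1" using zero_le_power2[of y]
      by (intro add_left_mono mult_left_mono) (linarith, simp)
    also have "\<dots> \<le> exp (t\<^sup>2)" using exp_ge_add_one_self[of "t\<^sup>2"] by simp
    finally have "((1 / 2 - y) * exp (t * (1 / 2 + y)) + (1 / 2 + y) * exp (t * (y - 1 / 2))) * exp
        (t' * x) \<le> exp (t\<^sup>2) * exp (t' * x)"
      by (rule mult_right_mono) simp
    thus "(1 / 2 - centred_ascents \<pi> / real (Suc n)) * exp (t * (centred_ascents \<pi> + 1 / 2))
       + (1 / 2 + centred_ascents \<pi> / real (Suc n)) * exp (t * (centred_ascents \<pi> - 1 / 2)) \<le> exp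
           (t\<^sup>2) * exp (t' * centred_ascents \<pi>)"
      unfolding x_def[symmetric] k_def[symmetric] y_def[symmetric] e exp_add by (simp add:
          algebra_simps)
  qed
  also have "\<dots> \<le> exp (t\<^sup>2) * exp (real n * t'\<^sup>2)"
    unfolding perm_avg_cmult using step.IH[OF t'1(1)] by (intro mult_left_mono) auto
  also have "\<dots> \<le> exp (t\<^sup>2) * exp (real n * t\<^sup>2)" using t'1 by (intro mult_left_mono) (auto intro:
      mult_left_mono)
  also have "\<dots> = exp (real (Suc n) * t\<^sup>2)" by (simp add: exp_add[symmetric] algebra_simps)
  finally show ?case .
qed

text \<open>
  For \<open>t\<close> of the order \<open>1 / \<surd>n\<close> the exponential moment is bounded, and \<open>x\<^sup>2\<close> is absorbed by
  exponentials with slightly changed \<open>t\<close>.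
\<close>
lemma perm_avg_square_exp_le:
  assumes "1 \<le> j" "j \<le> n" "0 \<le> \<kappa>" "(\<kappa> + 1)\<^sup>2 \<le> real n" "\<bar>t\<bar> \<le> \<kappa> / sqrt (real n)"
  shows "perm_avg j (\<lambda>\<pi>. exp (t * centred_ascents \<pi>)) \<le> exp ((\<kappa> + 1)\<^sup>2)"
    and "perm_avg j (\<lambda>\<pi>. (centred_ascents \<pi>)\<^sup>2 * exp (t * centred_ascents \<pi>)) \<le> 4 * real n * exp ((\<kappa>
        + 1)\<^sup>2)"
proof -
  define r where "r = sqrt (real n)"
  have n: "real n > 0" using assms by simp
  have r: "r > 0" "r * r = real n" using n by (auto simp: r_def)
  have r1: "\<kappa> + 1 \<le> r" unfolding r_def using assms by (intro real_le_rsqrt) auto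
  have gen: "perm_avg j (\<lambda>\<pi>. exp (u * centred_ascents \<pi>)) \<le> exp ((\<kappa> + 1)\<^sup>2)" if u: "\<bar>u\<bar> \<le> (\<kappa> + 1) /
      r" for u
  proof -
    have u1: "\<bar>u\<bar> \<le> 1" using u r1 r by (smt (verit) divide_le_eq_1)
    have "perm_avg j (\<lambda>\<pi>. exp (u * centred_ascents \<pi>)) \<le> exp (real j * u\<^sup>2)"
      by (rule perm_avg_exp_le[OF assms(1) u1])
    also have "real j * u\<^sup>2 \<le> real n * ((\<kappa> + 1) / r)\<^sup>2"
      using assms u r by (intro mult_mono) (auto simp: abs_le_square_iff[symmetric])
    also have "\<dots> = (\<kappa> + 1)\<^sup>2" using r n by (simp add: power_divide power2_eq_square[of r])
    finally show ?thesis by simp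
  qed
  have k1: "\<kappa> / r + 1 / r = (\<kappa> + 1) / r" by (simp add: add_divide_distrib)
  have tr: "\<bar>t\<bar> \<le> \<kappa> / r" using assms by (simp add: r_def)
  have pr: "0 < 1 / r" using r by simp
  show "perm_avg j (\<lambda>\<pi>. exp (t * centred_ascents \<pi>)) \<le> exp ((\<kappa> + 1)\<^sup>2)"
    using tr k1 pr by (intro gen) linarith
  have "perm_avg j (\<lambda>\<pi>. (centred_ascents \<pi>)\<^sup>2 * exp (t * centred_ascents \<pi>))
     \<le> perm_avg j (\<lambda>\<pi>. 2 * real n * (exp ((t + 1 / r) * centred_ascents \<pi>) + exp ((t - 1 / r) *
         centred_ascents \<pi>)))"
  proof (rule perm_avg_mono)
    fix \<pi>
    define x where "x = centred_ascents \<pi>"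
    define z where "z = x / r"
    have nn: "0 \<le> x\<^sup>2" by simp
    have "z\<^sup>2 \<le> 2 * (exp z + exp (- z))"
    proof -
      have "1 + \<bar>z\<bar> + \<bar>z\<bar>\<^sup>2 / 2 \<le> exp \<bar>z\<bar>" by (rule exp_lower_Taylor_quadratic) simp
      hence "z\<^sup>2 \<le> 2 * exp \<bar>z\<bar>" by simp
      also have "exp \<bar>z\<bar> \<le> exp z + exp (- z)" by (cases "z \<ge> 0") auto
      finally show ?thesis by simp
    qed
    hence "r\<^sup>2 * z\<^sup>2 \<le> real n * (2 * (exp z + exp (- z)))" using r by (simp add: power2_eq_square
        mult_left_mono)
    hence "x\<^sup>2 \<le> 2 * real n * (exp z + exp (- z))" using r by (simp add: z_def power_divide
        algebra_simps)
    hence "x\<^sup>2 * exp (t * x) \<le> 2 * real n * (exp z + exp (- z)) * exp (t * x)" by (rule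
        mult_right_mono) simp
    also have "\<dots> = 2 * real n * (exp ((t + 1 / r) * x) + exp ((t - 1 / r) * x))"
      by (simp add: z_def algebra_simps exp_add[symmetric] add_divide_distrib diff_divide_distrib)
    finally show "(centred_ascents \<pi>)\<^sup>2 * exp (t * centred_ascents \<pi>) \<le>
      2 * real n * (exp ((t + 1 / r) * centred_ascents \<pi>) + exp ((t - 1 / r) * centred_ascents \<pi>))"
          by (simp add: x_def)
  qed
  also have "\<dots> \<le> 2 * real n * (exp ((\<kappa> + 1)\<^sup>2) + exp ((\<kappa> + 1)\<^sup>2))"
    unfolding perm_avg_cmult perm_avg_add
  proof -
    have "\<bar>t + 1 / r\<bar> \<le> (\<kappa> + 1) / r" "\<bar>t - 1 / r\<bar> \<le> (\<kappa> + 1) / r"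
      using tr pr k1 by linarith+
    thus "2 * real n * (perm_avg j (\<lambda>\<pi>. exp ((t + 1 / r) * centred_ascents \<pi>))
        + perm_avg j (\<lambda>\<pi>. exp ((t - 1 / r) * centred_ascents \<pi>)))
      \<le> 2 * real n * (exp ((\<kappa> + 1)\<^sup>2) + exp ((\<kappa> + 1)\<^sup>2))"
      by (intro mult_left_mono add_mono gen) auto
  qed
  finally show "perm_avg j (\<lambda>\<pi>. (centred_ascents \<pi>)\<^sup>2 * exp (t * centred_ascents \<pi>)) \<le> 4 * real n *
      exp ((\<kappa> + 1)\<^sup>2)"
    by simp
qed

lemma perm_avg_1_ascents [simp]: "perm_avg 1 (\<lambda>\<pi>. f (centred_ascents \<pi>)) = f 0"
  "perm_avg (Suc 0) (\<lambda>\<pi>. f (centred_ascents \<pi>)) = f 0"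
  by (simp_all add: perm_avg_def centred_ascents_def permutations_of_set_singleton)

text \<open>
  The change of the martingale has conditional variance \<open>k\<^sup>2 / 4 - x\<^sup>2\<close>. The deterministic main
  part matches the growth of \<open>u\<^sup>2 k\<^sup>3 / 24\<close>, up to lower order terms.
\<close>
lemma mgf_step:
  fixes n k :: nat and x \<theta> :: real
  assumes k: "2 \<le> k" "k \<le> n" and \<theta>: "\<bar>\<theta>\<bar> \<le> 1" and x: "\<bar>x\<bar> \<le> real k / 2"
  defines "u \<equiv> \<theta> / real n"
  shows "\<bar>(1 / 2 - x / real k) * exp (u * real k * (x + 1 / 2)) + (1 / 2 + x / real k) * exp (u *
      real k * (x - 1 / 2))
      - exp (u\<^sup>2 * (real k ^ 3 - real (k - 1) ^ 3) / 24) * exp (u * real (k - 1) * x)\<bar>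
    \<le> exp (u * real (k - 1) * x) * (2 * \<bar>\<theta>\<bar> ^ 3 + \<theta>\<^sup>2 / real n + u\<^sup>2 * x\<^sup>2)"
proof -
  define j where "j = real k"
  define N where "N = real n"
  have j: "2 \<le> j" "j \<le> N" "0 < j" "0 < N" using k by (auto simp: j_def N_def)
  have kk: "real (k - 1) = j - 1" using k by (simp add: j_def of_nat_diff)
  define d where "d = u * (x + j / 2)"
  define d' where "d' = u * (x - j / 2)"
  define w where "w = 1 / 2 - x / j"
  define w' where "w' = 1 / 2 + x / j"
  define E where "E = exp (u * (j - 1) * x)"
  have w: "0 \<le> w" "0 \<le> w'" "w + w' = 1" using x j by (auto simp: w_def w'_def j_def abs_le_iff
      field_simps)
  have e: "exp (u * j * (x + 1 / 2)) = E * exp d" "exp (u * j * (x - 1 / 2)) = E * exp d'"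
    unfolding E_def d_def d'_def exp_add[symmetric] by (simp_all add: algebra_simps)
  note M = two_point_moments[OF j(3), of x, folded w_def w'_def]
  have m1: "w * d + w' * d' = 0"
  proof -
    have "w * d + w' * d' = u * (w * (x + j / 2) + w' * (x - j / 2))"
      by (simp only: d_def d'_def distrib_left mult_ac)
    thus ?thesis unfolding M by simp
  qed
  have m2: "w * d\<^sup>2 + w' * d'\<^sup>2 = u\<^sup>2 * (j\<^sup>2 / 4 - x\<^sup>2)"
  proof -
    have "w * d\<^sup>2 + w' * d'\<^sup>2 = u\<^sup>2 * (w * (x + j / 2)\<^sup>2 + w' * (x - j / 2)\<^sup>2)"
      unfolding d_def d'_def power_mult_distrib distrib_left[of "u\<^sup>2"] by (simp only: mult.left_commute)
    thus ?thesis unfolding M .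
  qed
  have uN: "\<bar>u\<bar> * N = \<bar>\<theta>\<bar>" using j by (simp add: u_def N_def[symmetric])
  have "\<bar>d\<bar> \<le> \<bar>u\<bar> * N" "\<bar>d'\<bar> \<le> \<bar>u\<bar> * N"
    unfolding d_def d'_def abs_mult using x j by (auto intro!: mult_left_mono simp: j_def[symmetric]
        abs_le_iff)
  hence d: "\<bar>d\<bar> \<le> \<bar>\<theta>\<bar>" "\<bar>d'\<bar> \<le> \<bar>\<theta>\<bar>" by (simp_all add: uN)
  define R where "R = exp d - (1 + d + d\<^sup>2 / 2)"
  define R' where "R' = exp d' - (1 + d' + d'\<^sup>2 / 2)"
  have "\<bar>R\<bar> \<le> \<bar>d\<bar> ^ 3" "\<bar>R'\<bar> \<le> \<bar>d'\<bar> ^ 3" unfolding R_def R'_def using d \<theta> by (intro exp_cubic; simp)+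
  hence RB: "\<bar>R\<bar> \<le> \<bar>\<theta>\<bar> ^ 3" "\<bar>R'\<bar> \<le> \<bar>\<theta>\<bar> ^ 3"
    using power_mono[OF d(1) abs_ge_zero, of 3] power_mono[OF d(2) abs_ge_zero, of 3] by linarith+
  define Q where "Q = u\<^sup>2 * (3 * j\<^sup>2 - 3 * j + 1) / 24"
  have Qe: "u\<^sup>2 * (real k ^ 3 - real (k - 1) ^ 3) / 24 = Q"
    unfolding Q_def kk j_def[symmetric] by (simp add: algebra_simps power2_eq_square power3_eq_cube)
  have q: "0 \<le> 3 * j\<^sup>2 - 3 * j + 1" "3 * j\<^sup>2 - 3 * j + 1 \<le> 3 * N\<^sup>2"
    using j power_mono[of j N 2] mult_right_mono[of 2 j j] by (auto simp: power2_eq_square)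
  have Q0: "0 \<le> Q" unfolding Q_def using q by simp
  have "Q \<le> u\<^sup>2 * (3 * N\<^sup>2) / 24" unfolding Q_def using q by (intro divide_right_mono
      mult_left_mono) auto
  also have "\<dots> = (\<bar>u\<bar> * N)\<^sup>2 / 8" by (simp add: power_mult_distrib)
  finally have "Q * 8 \<le> \<theta>\<^sup>2" unfolding uN by simp
  hence Q1: "Q \<le> \<theta>\<^sup>2" using Q0 by linarith
  have t2: "\<theta>\<^sup>2 \<le> \<bar>\<theta>\<bar>" "\<theta>\<^sup>2 \<le> 1" "\<theta>\<^sup>2 * \<theta>\<^sup>2 \<le> \<bar>\<theta>\<bar> ^ 3"
  proof -
    show a: "\<theta>\<^sup>2 \<le> \<bar>\<theta>\<bar>" using mult_left_le[of "\<bar>\<theta>\<bar>" "\<bar>\<theta>\<bar>"] \<theta> by (simp add: power2_eq_square)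
    show "\<theta>\<^sup>2 \<le> 1" using a \<theta> by linarith
    have "\<theta>\<^sup>2 * \<theta>\<^sup>2 \<le> \<theta>\<^sup>2 * \<bar>\<theta>\<bar>" using a by (rule mult_left_mono) simp
    thus "\<theta>\<^sup>2 * \<theta>\<^sup>2 \<le> \<bar>\<theta>\<bar> ^ 3" by (simp add: power2_eq_square power3_eq_cube abs_mult_self_eq)
  qed
  have Q2: "\<bar>exp Q - (1 + Q)\<bar> \<le> \<bar>\<theta>\<bar> ^ 3"
  proof -
    have "exp Q \<le> 1 + Q + Q\<^sup>2" using Q0 Q1 t2 by (intro exp_le_quadratic) auto
    moreover have "1 + Q \<le> exp Q" by (rule exp_ge_add_one_self)
    moreover have "Q\<^sup>2 \<le> \<theta>\<^sup>2 * \<theta>\<^sup>2" unfolding power2_eq_square[of Q] using Q0 Q1 by (intro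
        mult_mono) auto
    ultimately show ?thesis using t2(3) by linarith
  qed
  have diff: "\<bar>u\<^sup>2 * (j\<^sup>2 / 4 - x\<^sup>2) / 2 - Q\<bar> \<le> \<theta>\<^sup>2 / N + u\<^sup>2 * x\<^sup>2"
  proof -
    have "u\<^sup>2 * (j\<^sup>2 / 4 - x\<^sup>2) / 2 - Q = u\<^sup>2 * ((3 * j - 1) / 24 - x\<^sup>2 / 2)"
      unfolding Q_def by (simp add: field_simps)
    also have "\<bar>\<dots>\<bar> = u\<^sup>2 * \<bar>(3 * j - 1) / 24 - x\<^sup>2 / 2\<bar>" by (simp add: abs_mult)
    also have "\<dots> \<le> u\<^sup>2 * (N + x\<^sup>2)"
    proof (rule mult_left_mono)
      show "\<bar>(3 * j - 1) / 24 - x\<^sup>2 / 2\<bar> \<le> N + x\<^sup>2"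
      proof -
        have gen: "\<bar>a - y / 2\<bar> \<le> N + y" if "0 \<le> a" "a \<le> N" "0 \<le> y" for a y :: real
          using that j(4) by linarith
        show ?thesis by (rule gen) (use j in \<open>simp_all add: field_simps\<close>)
      qed
    qed simp
    also have "u\<^sup>2 * N = (\<bar>u\<bar> * N)\<^sup>2 / N" using j by (simp add: power2_eq_square abs_mult_self_eq
        field_simps)
    hence "u\<^sup>2 * (N + x\<^sup>2) = \<theta>\<^sup>2 / N + u\<^sup>2 * x\<^sup>2" unfolding uN by (simp add: distrib_left)
    finally show ?thesis .
  qed
  have RR: "\<bar>w * R + w' * R'\<bar> \<le> \<bar>\<theta>\<bar> ^ 3"
  proof -
    have "\<bar>w * R + w' * R'\<bar> \<le> w * \<bar>R\<bar> + w' * \<bar>R'\<bar>"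
      using w abs_triangle_ineq[of "w * R" "w' * R'"] by (simp add: abs_mult)
    also have "\<dots> \<le> w * \<bar>\<theta>\<bar> ^ 3 + w' * \<bar>\<theta>\<bar> ^ 3"
      using RB w by (intro add_mono mult_left_mono) auto
    also have "\<dots> = \<bar>\<theta>\<bar> ^ 3" using w(3) by (metis distrib_right mult_1)
    finally show ?thesis .
  qed
  have "w * exp d + w' * exp d' - exp Q
     = (w + w') - 1 + (w * d + w' * d') + (w * d\<^sup>2 + w' * d'\<^sup>2) / 2 - Q + (w * R + w' * R') - (exp Q
         - (1 + Q))"
    by (simp add: R_def R'_def algebra_simps add_divide_distrib)
  also have "\<dots> = (u\<^sup>2 * (j\<^sup>2 / 4 - x\<^sup>2) / 2 - Q) + (w * R + w' * R') - (exp Q - (1 + Q))"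
    unfolding m1 m2 w(3) by simp
  finally have "w * exp d + w' * exp d' - exp Q = \<dots>" .
  hence B: "\<bar>w * exp d + w' * exp d' - exp Q\<bar> \<le> 2 * \<bar>\<theta>\<bar> ^ 3 + \<theta>\<^sup>2 / N + u\<^sup>2 * x\<^sup>2"
    using diff RR Q2 by linarith
  have "w * (E * exp d) + w' * (E * exp d') - exp Q * E = E * (w * exp d + w' * exp d' - exp Q)"
    by (simp add: algebra_simps)
  hence "\<bar>w * (E * exp d) + w' * (E * exp d') - exp Q * E\<bar> = E * \<bar>w * exp d + w' * exp d' - exp Q\<bar>"
    by (simp add: abs_mult E_def)
  also have "\<dots> \<le> E * (2 * \<bar>\<theta>\<bar> ^ 3 + \<theta>\<^sup>2 / N + u\<^sup>2 * x\<^sup>2)" using B by (rule mult_left_mono) (simp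
      add: E_def)
  finally show ?thesis unfolding Qe unfolding kk j_def[symmetric] N_def[symmetric] e
      E_def[symmetric] w_def[symmetric] w'_def[symmetric] .
qed

text \<open>
  The mean of \<open>exp (u k X - u\<^sup>2 k\<^sup>3 / 24)\<close> with \<open>u = \<theta> / n\<close> hardly changes with \<open>k\<close>: every one
  of the \<open>n\<close> steps contributes an error of the order \<open>n\<^sup>-\<^sup>3\<^sup>/\<^sup>2\<close>.
\<close>
theorem mgf_perm_avg:
  assumes \<kappa>: "0 \<le> \<kappa>" "(\<kappa> + 1)\<^sup>2 \<le> real n" and \<theta>: "\<bar>\<theta>\<bar> \<le> \<kappa> / sqrt (real n)"
  shows "\<bar>perm_avg n (\<lambda>\<pi>. exp (\<theta> * centred_ascents \<pi>)) - exp (\<theta>\<^sup>2 * real n / 24)\<bar>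
    \<le> 8 * (\<kappa> + 1) ^ 3 * exp (2 * (\<kappa> + 1)\<^sup>2) / sqrt (real n)"
proof -
  define N where "N = real n"
  define r where "r = sqrt N"
  have "1 \<le> (\<kappa> + 1)\<^sup>2" using \<kappa> by (simp add: power2_eq_square algebra_simps)
  hence N1: "1 \<le> N" using \<kappa> unfolding N_def by linarith
  hence n: "1 \<le> n" "1 \<le> N" by (simp_all add: N_def)
  have r: "1 \<le> r" "N = r * r" using n by (auto simp: r_def)
  have kr: "\<kappa> + 1 \<le> r" unfolding r_def N_def using \<kappa> by (intro real_le_rsqrt) auto
  have tr: "\<bar>\<theta>\<bar> \<le> \<kappa> / r" using \<theta> by (simp add: r_def N_def)
  have "\<kappa> / r \<le> 1" using kr r by simp
  hence t1: "\<bar>\<theta>\<bar> \<le> 1" using tr by linarith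
  define u where "u = \<theta> / real n"
  define s where "s = (\<lambda>k::nat. u\<^sup>2 * real k ^ 3 / 24)"
  define b where "b = (\<lambda>k. perm_avg k (\<lambda>\<pi>. exp (u * real k * centred_ascents \<pi>)))"
  define X where "X = exp ((\<kappa> + 1)\<^sup>2)"
  have X: "1 \<le> X" by (simp add: X_def)
  \<comment> \<open>\<open>X\<close> bounds all exponential moments that occur, and \<open>N * r = n\<^sup>3\<^sup>/\<^sup>2\<close>.\<close>
  define err where "err = 8 * (\<kappa> + 1) ^ 3 * X / (N * r)"
  have err0: "0 \<le> err" using \<kappa> n r X by (simp add: err_def)
  have k3: "\<kappa> ^ 3 \<le> (\<kappa> + 1) ^ 3" "\<kappa>\<^sup>2 \<le> (\<kappa> + 1) ^ 3"
  proof -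
    show "\<kappa> ^ 3 \<le> (\<kappa> + 1) ^ 3" using \<kappa> by (intro power_mono) auto
    have "\<kappa>\<^sup>2 \<le> (\<kappa> + 1)\<^sup>2" using \<kappa> by (intro power_mono) auto
    also have "\<dots> \<le> (\<kappa> + 1) ^ 3" using \<kappa> by (intro power_increasing) auto
    finally show "\<kappa>\<^sup>2 \<le> (\<kappa> + 1) ^ 3" .
  qed
  have th3: "\<bar>\<theta>\<bar> ^ 3 \<le> (\<kappa> + 1) ^ 3 / (N * r)"
  proof -
    have "\<bar>\<theta>\<bar> ^ 3 \<le> (\<kappa> / r) ^ 3" using tr by (intro power_mono) auto
    also have "\<dots> = \<kappa> ^ 3 / (N * r)" using r by (simp add: power_divide power3_eq_cube)
    also have "\<dots> \<le> (\<kappa> + 1) ^ 3 / (N * r)" using k3 r by (intro divide_right_mono) auto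
    finally show ?thesis .
  qed
  have th2: "\<theta>\<^sup>2 \<le> (\<kappa> + 1) ^ 3 / N"
  proof -
    have "\<theta>\<^sup>2 \<le> (\<kappa> / r)\<^sup>2" using tr \<kappa> r by (subst abs_le_square_iff[symmetric]) simp
    also have "\<dots> = \<kappa>\<^sup>2 / N" using r by (simp add: power_divide power2_eq_square)
    also have "\<dots> \<le> (\<kappa> + 1) ^ 3 / N" using k3 n by (intro divide_right_mono) auto
    finally show ?thesis .
  qed
  have th2N: "\<theta>\<^sup>2 / N \<le> (\<kappa> + 1) ^ 3 / (N * r)"
  proof -
    have "\<theta>\<^sup>2 / N \<le> (\<kappa> + 1) ^ 3 / N / N" using th2 n by (intro divide_right_mono) auto
    also have "\<dots> = (\<kappa> + 1) ^ 3 / (N * N)" by simp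
    also have "\<dots> \<le> (\<kappa> + 1) ^ 3 / (N * r)" using r n \<kappa>
      by (intro divide_left_mono mult_left_mono mult_pos_pos) auto
    finally show ?thesis .
  qed
  have one_step: "\<bar>b k - exp (s k - s (k - 1)) * b (k - 1)\<bar> \<le> err" if k: "2 \<le> k" "k \<le> n" for k
  proof -
    obtain k' where k': "k = Suc k'" "1 \<le> k'" using k by (cases k) auto
    define t where "t = u * real (k - 1)"
    have tb: "\<bar>t\<bar> \<le> \<kappa> / sqrt (real n)"
    proof -
      have "\<bar>t\<bar> = \<bar>\<theta>\<bar> * (real (k - 1) / real n)" by (simp add: t_def u_def abs_mult)
      also have "\<dots> \<le> \<bar>\<theta>\<bar>" using k by (intro mult_left_le) auto
      finally show ?thesis using \<theta> by linarith
    qed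
    have k'n: "k' \<le> n" using k k' by simp
    note A = perm_avg_square_exp_le[OF k'(2) k'n \<kappa> tb, folded X_def N_def]
    define c where "c = 2 * \<bar>\<theta>\<bar> ^ 3 + \<theta>\<^sup>2 / N"
    have c: "0 \<le> c" "c \<le> 3 * ((\<kappa> + 1) ^ 3 / (N * r))" using th3 th2N n by (auto simp: c_def)
    have sk: "s k - s (k - 1) = u\<^sup>2 * (real k ^ 3 - real (k - 1) ^ 3) / 24"
      by (simp add: s_def right_diff_distrib diff_divide_distrib)
    have F1: "b k = perm_avg (Suc k') (\<lambda>\<pi>. (\<lambda>x. exp (u * real k * x)) (centred_ascents \<pi>))"
      by (simp only: b_def k'(1))
    have F2: "exp (s k - s (k - 1)) * b (k - 1)
        = perm_avg k' (\<lambda>\<pi>. exp (s k - s (k - 1)) * exp (t * centred_ascents \<pi>))"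
      unfolding perm_avg_cmult by (simp add: b_def t_def k'(1))
    have "\<bar>b k - exp (s k - s (k - 1)) * b (k - 1)\<bar>
       \<le> perm_avg k' (\<lambda>\<pi>. c * exp (t * centred_ascents \<pi>) + u\<^sup>2 * ((centred_ascents \<pi>)\<^sup>2 * exp (t *
           centred_ascents \<pi>)))"
      unfolding F1 F2 perm_avg_ascents_step[where f="\<lambda>x. exp (u * real k * x)"] perm_avg_diff[symmetric]
    proof (rule order.trans[OF perm_avg_abs perm_avg_mono])
      fix \<pi> assume "\<pi> \<in> permutations_of_set {1..k'}"
      hence x: "\<bar>centred_ascents \<pi>\<bar> \<le> real k / 2" using centred_ascents_half[of \<pi> k'] by (simp add: k')
      show "\<bar>(1 / 2 - centred_ascents \<pi> / real (Suc k')) * exp (u * real k * (centred_ascents \<pi> + 1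
          / 2)) +
             (1 / 2 + centred_ascents \<pi> / real (Suc k')) * exp (u * real k * (centred_ascents \<pi> - 1
                 / 2)) -
             exp (s k - s (k - 1)) * exp (t * centred_ascents \<pi>)\<bar>
         \<le> c * exp (t * centred_ascents \<pi>) + u\<^sup>2 * ((centred_ascents \<pi>)\<^sup>2 * exp (t * centred_ascents
             \<pi>))"
        using mgf_step[OF k t1 x, folded u_def] unfolding sk t_def k'(1)[symmetric] c_def N_def
        by (simp only: distrib_left distrib_right mult_ac)
    qed
    also have "\<dots> = c * perm_avg k' (\<lambda>\<pi>. exp (t * centred_ascents \<pi>))
       + u\<^sup>2 * perm_avg k' (\<lambda>\<pi>. (centred_ascents \<pi>)\<^sup>2 * exp (t * centred_ascents \<pi>))"
      by (simp only: perm_avg_add perm_avg_cmult)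
    also have "\<dots> \<le> 3 * ((\<kappa> + 1) ^ 3 / (N * r)) * X + u\<^sup>2 * (4 * N * X)"
      using c A X by (intro add_mono mult_mono mult_left_mono) (auto simp: perm_avg_def intro!:
          divide_nonneg_nonneg sum_nonneg)
    also have "u\<^sup>2 * (4 * N * X) = 4 * X * (\<theta>\<^sup>2 / N)" using n by (simp add: u_def N_def power_divide
        power2_eq_square)
    also have "\<dots> \<le> 4 * X * ((\<kappa> + 1) ^ 3 / (N * r))" using th2N X by (intro mult_left_mono) auto
    also have "3 * ((\<kappa> + 1) ^ 3 / (N * r)) * X + 4 * X * ((\<kappa> + 1) ^ 3 / (N * r)) = 7 * ((\<kappa> + 1) ^ 3
        * X / (N * r))" by simp
    also have "\<dots> \<le> err" using \<kappa> n r X by (simp add: err_def divide_right_mono)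
    finally show ?thesis by simp
  qed
  have s0: "0 \<le> s k" for k by (simp add: s_def)
  have bound: "\<bar>b k - exp (s k)\<bar> \<le> exp (s k) * (real k * err)" if "1 \<le> k" "k \<le> n" for k
    using that
  proof (induction k rule: dec_induct)
    case base
    have b1: "b 1 = 1" unfolding b_def by (subst perm_avg_1_ascents) simp
    have "exp (- s 1) \<ge> 1 - s 1" using exp_ge_add_one_self[of "- s 1"] by simp
    hence "exp (s 1) * (1 - s 1) \<le> exp (s 1) * exp (- s 1)" by (intro mult_left_mono) auto
    hence 1: "exp (s 1) - 1 \<le> exp (s 1) * s 1" by (simp add: exp_minus algebra_simps)
    have "s 1 = \<theta>\<^sup>2 / N / N / 24" by (simp add: s_def u_def N_def power_divide power2_eq_square)
    also have "\<dots> \<le> \<theta>\<^sup>2 / N / 1 / 1" using n by (intro frac_le) auto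
    also have "\<dots> \<le> 1 * ((\<kappa> + 1) ^ 3 / (N * r))" using th2N by simp
    also have "\<dots> \<le> (8 * X) * ((\<kappa> + 1) ^ 3 / (N * r))" using X \<kappa> n r by (intro mult_right_mono) auto
    also have "\<dots> = err" by (simp add: err_def)
    finally have "s 1 \<le> err" .
    hence "exp (s 1) * s 1 \<le> exp (s 1) * err" by (intro mult_left_mono) auto
    with 1 have "exp (s 1) - 1 \<le> exp (s 1) * err" by (rule order.trans)
    thus ?case unfolding b1 using s0[of 1] by simp
  next
    case (step k)
    have "b (Suc k) - exp (s (Suc k)) = (b (Suc k) - exp (s (Suc k) - s k) * b k) + exp (s (Suc k) -
        s k) * (b k - exp (s k))"
    proof -
      have es: "exp (s (Suc k) - s k) * exp (s k) = exp (s (Suc k))" by (simp add: exp_add[symmetric])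
      show ?thesis by (simp only: right_diff_distrib es)
    qed
    hence "\<bar>b (Suc k) - exp (s (Suc k))\<bar> \<le> \<bar>b (Suc k) - exp (s (Suc k) - s k) * b k\<bar> + exp (s (Suc
        k) - s k) * \<bar>b k - exp (s k)\<bar>"
      using abs_triangle_ineq[of "b (Suc k) - exp (s (Suc k) - s k) * b k" "exp (s (Suc k) - s k) *
          (b k - exp (s k))"]
      by (simp add: abs_mult)
    also have "\<dots> \<le> err + exp (s (Suc k) - s k) * (exp (s k) * (real k * err))"
      using step one_step[of "Suc k"]
      by (intro add_mono mult_left_mono) auto
    also have "\<dots> = err + exp (s (Suc k)) * (real k * err)" by (simp add: exp_diff)
    also have "\<dots> \<le> exp (s (Suc k)) * err + exp (s (Suc k)) * (real k * err)"
      using err0 s0[of "Suc k"] mult_right_mono[of 1 "exp (s (Suc k))" err] by simp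
    also have "\<dots> = exp (s (Suc k)) * (real (Suc k) * err)" by (simp add: algebra_simps)
    finally show ?case .
  qed
  have un: "u * real n = \<theta>" using n by (simp add: u_def)
  have sn: "s n = \<theta>\<^sup>2 * real n / 24" using n by (simp add: s_def u_def power_divide power2_eq_square
      power3_eq_cube)
  have bn: "b n = perm_avg n (\<lambda>\<pi>. exp (\<theta> * centred_ascents \<pi>))" by (simp only: b_def un)
  have "s n \<le> (\<kappa> + 1)\<^sup>2"
  proof -
    have "\<theta>\<^sup>2 \<le> (\<kappa> / r)\<^sup>2" using tr \<kappa> r by (subst abs_le_square_iff[symmetric]) simp
    hence "\<theta>\<^sup>2 * N \<le> (\<kappa> / r)\<^sup>2 * N" using n by (intro mult_right_mono) auto
    also have "\<dots> = \<kappa>\<^sup>2" using r by (simp add: power_divide power2_eq_square)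
    also have "\<dots> \<le> (\<kappa> + 1)\<^sup>2" using \<kappa> by (intro power_mono) auto
    finally have "\<theta>\<^sup>2 * N \<le> (\<kappa> + 1)\<^sup>2" .
    moreover have "0 \<le> \<theta>\<^sup>2 * N" using n by simp
    ultimately show ?thesis unfolding sn N_def by linarith
  qed
  hence "exp (s n) \<le> X" by (simp add: X_def)
  hence "exp (s n) * (real n * err) \<le> X * (real n * err)" using err0 by (intro mult_right_mono) auto
  also have "\<dots> = 8 * (\<kappa> + 1) ^ 3 * (X * X) / r" using n r(1) by (simp add: err_def N_def[symmetric])
  also have "X * X = exp (2 * (\<kappa> + 1)\<^sup>2)" by (simp add: X_def exp_add[symmetric])
  finally have "exp (s n) * (real n * err) \<le> 8 * (\<kappa> + 1) ^ 3 * exp (2 * (\<kappa> + 1)\<^sup>2) / r" .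
  with bound[of n] n show ?thesis unfolding bn sn r_def N_def by linarith
qed

section \<open>Normal approximation along the ascent chain\<close>

text \<open>
  Summation of \<open>n\<^sup>-\<^sup>3\<^sup>/\<^sup>2\<close> by comparison with the telescoping terms \<open>4 / \<surd>n\<close>.
\<close>
lemma inverse_three_halves_le:
  fixes n :: nat assumes "n \<ge> 1"
  shows "1 / (real n * sqrt (real n)) + 4 / sqrt (real (Suc n)) \<le> 4 / sqrt (real n)"
proof -
  define a where "a = sqrt (real n)"
  define b where "b = sqrt (real (Suc n))"
  have a: "a > 0" "a * a = real n" using assms by (auto simp: a_def)
  have b: "b > 0" "b * b = real n + 1" by (auto simp: b_def)
  have ab: "a \<le> b" by (simp add: a_def b_def)
  have n1: "1 \<le> a * a" using a assms by simp
  have "(b - a) * (b + a) = 1" using a b by (simp add: algebra_simps)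
  hence d: "b - a = 1 / (b + a)" using a b by (simp add: field_simps)
  have "b * (b + a) \<le> b * (2 * b)" using ab b by (intro mult_left_mono) auto
  also have "\<dots> = 2 * (a * a) + 2" using a b by simp
  also have "\<dots> \<le> 4 * (a * a)" using n1 by linarith
  finally have e: "b * (b + a) \<le> 4 * (a * a)" .
  have "1 / (a * a * a) = 4 / (a * (4 * (a * a)))" by simp
  also have "\<dots> \<le> 4 / (a * (b * (b + a)))"
    using e a b by (intro divide_left_mono mult_left_mono mult_pos_pos) auto
  also have "\<dots> = 4 * (b - a) / (a * b)" unfolding d using a b by (simp add: field_simps)
  also have "\<dots> = 4 / a - 4 / b" using a b by (simp add: field_simps)
  finally show ?thesis using a by (simp add: a_def b_def)
qed

text \<open>
  One step of Lindeberg's replacement. The first moments cancel; the heat equation turns the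
  change of time into the second moment, up to an error of the order \<open>(k + x\<^sup>2) / n\<^sup>3\<close>; the
  third moment is small since the chain is symmetric; the fourth order is bounded by
  \<open>put_D_bounds\<close>. The time \<open>\<tau> k\<close> is the remaining variance \<open>1 - (k / n)\<^sup>3\<close> of the rescaled
  martingale, increased by \<open>1 / n\<close> so that it never vanishes.
\<close>
lemma put_step:
  fixes n k :: nat and x \<sigma> :: real
  assumes \<sigma>: "\<sigma> > 0" and k: "2 \<le> k" "k \<le> n" and x: "\<bar>x\<bar> \<le> real k / 2"
  defines "\<rho> \<equiv> sqrt 12 / (real n * sqrt (real n))"
  defines "\<tau> \<equiv> \<lambda>k::nat. 1 + 1 / real n - (real k / real n) ^ 3"
  shows "\<bar>(1 / 2 - x / real k) * put \<sigma> (\<rho> * real k * (x + 1 / 2)) (\<tau> k)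
      + (1 / 2 + x / real k) * put \<sigma> (\<rho> * real k * (x - 1 / 2)) (\<tau> k)
      - put \<sigma> (\<rho> * real (k - 1) * x) (\<tau> (k - 1))\<bar>
    \<le> put_const \<sigma> / (\<tau> k * sqrt (\<tau> k)) * ((160 + 16 * x\<^sup>2 / real n) / (real n)\<^sup>2)"
proof -
  define N where "N = real n"
  define r where "r = sqrt N"
  define j where "j = real k"
  define t where "t = \<tau> k"
  define K where "K = put_const \<sigma>"
  have K0: "0 \<le> K" using \<sigma> by (simp add: K_def put_const_def)
  have N: "N \<ge> 2" "N > 0" using k by (auto simp: N_def)
  have r: "r > 0" "r * r = N" using N by (auto simp: r_def)
  have j: "2 \<le> j" "j \<le> N" "j > 0" using k by (auto simp: j_def N_def)
  have lam: "\<rho> = sqrt 12 / (N * r)" by (simp add: \<rho>_def N_def r_def)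
  have lam2: "\<rho>\<^sup>2 = 12 / N ^ 3" unfolding lam using r N
    by (simp add: power_divide power_mult_distrib power2_eq_square power3_eq_cube)
  have lam0: "\<rho> \<ge> 0" using r N by (simp add: lam)
  have jN: "(j / N) ^ 3 \<le> 1" using j N by (intro power_le_one) auto
  have tt: "t = 1 + 1 / N - (j / N) ^ 3" by (simp add: t_def \<tau>_def N_def j_def)
  have "0 < 1 / N" "1 / N \<le> 1" "0 \<le> (j / N) ^ 3" using N j by auto
  hence t: "0 < t" "t \<le> 2" using jN unfolding tt by linarith+
  define \<Delta> where "\<Delta> = (3 * j\<^sup>2 - 3 * j + 1) / N ^ 3"
  have kk: "real (k - 1) = j - 1" using k by (simp add: j_def of_nat_diff)
  have tau1: "\<tau> (k - 1) = t + \<Delta>"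
    unfolding t_def \<tau>_def kk N_def[symmetric] j_def[symmetric] \<Delta>_def using N
    by (simp add: power_divide power3_eq_cube power2_eq_square field_simps)
  have D0: "0 \<le> \<Delta>"
  proof -
    have "3 * j \<le> 3 * j\<^sup>2" using j by (simp add: power2_eq_square)
    thus ?thesis unfolding \<Delta>_def using N by simp
  qed
  have D1: "\<Delta> \<le> 3 / N"
  proof -
    have "3 * j\<^sup>2 - 3 * j + 1 \<le> 3 * N\<^sup>2" using j power_mono[of j N 2] by linarith
    hence "\<Delta> \<le> 3 * N\<^sup>2 / N ^ 3" unfolding \<Delta>_def using N by (intro divide_right_mono) auto
    also have "\<dots> = 3 / N" using N by (simp add: power2_eq_square power3_eq_cube)
    finally show ?thesis .
  qed
  have "3 / N \<le> 2" using N by (simp add: field_simps)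
  hence tD: "t + \<Delta> \<le> 4" using D1 t by linarith
  define y where "y = \<rho> * (j - 1) * x"
  define d where "d = \<rho> * (x + j / 2)"
  define d' where "d' = \<rho> * (x - j / 2)"
  define w where "w = 1 / 2 - x / j"
  define w' where "w' = 1 / 2 + x / j"
  have w: "0 \<le> w" "0 \<le> w'" "w + w' = 1" using x j by (auto simp: w_def w'_def j_def abs_le_iff
      field_simps)
  have yd: "\<rho> * j * (x + 1 / 2) = y + d" "\<rho> * j * (x - 1 / 2) = y + d'"
    by (simp_all add: y_def d_def d'_def algebra_simps)
  have m1: "w * d + w' * d' = 0"
    and m2: "w * d\<^sup>2 + w' * d'\<^sup>2 = \<rho>\<^sup>2 * (j\<^sup>2 / 4 - x\<^sup>2)"
    and m3: "w * d ^ 3 + w' * d' ^ 3 = \<rho> ^ 3 * (x * (j\<^sup>2 / 2 - 2 * x\<^sup>2))"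
  proof -
    define e where "e = x + j / 2"
    define e' where "e' = x - j / 2"
    note M = two_point_moments[OF j(3), of x, folded w_def w'_def e_def e'_def]
    have de: "d = \<rho> * e" "d' = \<rho> * e'" by (simp_all add: d_def d'_def e_def e'_def)
    have "w * d + w' * d' = \<rho> * (w * e + w' * e')"
      by (simp only: de distrib_left mult_ac)
    thus "w * d + w' * d' = 0" unfolding M by simp
    have "w * d\<^sup>2 + w' * d'\<^sup>2 = \<rho>\<^sup>2 * (w * e\<^sup>2 + w' * e'\<^sup>2)"
      by (simp only: de power_mult_distrib distrib_left mult_ac)
    thus "w * d\<^sup>2 + w' * d'\<^sup>2 = \<rho>\<^sup>2 * (j\<^sup>2 / 4 - x\<^sup>2)" unfolding M .
    have "w * d ^ 3 + w' * d' ^ 3 = \<rho> ^ 3 * (w * e ^ 3 + w' * e' ^ 3)"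
      by (simp only: de power_mult_distrib distrib_left mult_ac)
    thus "w * d ^ 3 + w' * d' ^ 3 = \<rho> ^ 3 * (x * (j\<^sup>2 / 2 - 2 * x\<^sup>2))" unfolding M .
  qed
  have db: "\<bar>d\<bar> \<le> \<rho> * N" "\<bar>d'\<bar> \<le> \<rho> * N"
    unfolding d_def d'_def abs_mult using x j lam0 by (auto intro!: mult_mono simp: j_def[symmetric]
        abs_le_iff)
  have l4: "(\<rho> * N) ^ 4 = 144 / N\<^sup>2"
  proof -
    have "(\<rho> * N) ^ 4 = \<rho>\<^sup>2 * \<rho>\<^sup>2 * N ^ 4" by (simp add: power_mult_distrib power2_eq_square
        power4_eq_xxxx)
    also have "\<dots> = 144 / N\<^sup>2" unfolding lam2 using N by (simp add: power2_eq_square power4_eq_xxxx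
        power3_eq_cube)
    finally show ?thesis .
  qed
  have d4: "d ^ 4 \<le> 144 / N\<^sup>2" "d' ^ 4 \<le> 144 / N\<^sup>2"
    unfolding l4[symmetric] using power_mono[OF db(1), of 4] power_mono[OF db(2), of 4] by auto
  define B where "B = put_const \<sigma> / (t * sqrt t)"
  have B0: "0 \<le> B" unfolding B_def using K0 t by (simp add: K_def)
  define A where "A = put \<sigma> y t"
  define C1 where "C1 = \<sigma> * put_tilt \<sigma> y t"
  define C2 where "C2 = put_D2 \<sigma> y t"
  define C3 where "C3 = put_D3 \<sigma> y t"
  define R where "R = put \<sigma> (y + d) t - (A - C1 * d + C2 / 2 * d\<^sup>2 + C3 / 6 * d ^ 3)"
  define R' where "R' = put \<sigma> (y + d') t - (A - C1 * d' + C2 / 2 * d'\<^sup>2 + C3 / 6 * d' ^ 3)"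
  define Q where "Q = put \<sigma> y (t + \<Delta>) - (A + C2 / 2 * \<Delta>)"
  have t4: "t \<le> 4" using t by simp
  have "\<bar>R\<bar> \<le> B * d ^ 4" "\<bar>R'\<bar> \<le> B * d' ^ 4"
    using put_taylor_space[OF \<sigma> t(1) t4] by (auto simp: R_def R'_def B_def A_def C1_def C2_def C3_def)
  hence RB: "\<bar>R\<bar> \<le> B * (144 / N\<^sup>2)" "\<bar>R'\<bar> \<le> B * (144 / N\<^sup>2)"
    using mult_left_mono[OF d4(1) B0] mult_left_mono[OF d4(2) B0] by linarith+
  have "\<bar>Q\<bar> \<le> B * \<Delta>\<^sup>2"
    using put_taylor_time[OF \<sigma> t(1) D0 tD] by (auto simp: Q_def B_def A_def C2_def)
  also have "\<Delta>\<^sup>2 \<le> (3 / N)\<^sup>2" using D0 D1 by (intro power_mono)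
  hence "B * \<Delta>\<^sup>2 \<le> B * (9 / N\<^sup>2)" using B0 by (intro mult_left_mono) (auto simp: power_divide)
  finally have QB: "\<bar>Q\<bar> \<le> B * (9 / N\<^sup>2)" .
  have st: "sqrt t > 0" "sqrt t * sqrt t = t" "sqrt t \<le> 2" using t by (auto intro: real_le_lsqrt)
  have C2B: "\<bar>C2\<bar> \<le> 2 * B"
  proof -
    have "\<bar>C2\<bar> \<le> K / sqrt t" using put_D_bounds(1)[OF \<sigma> t(1) t4] by (simp add: C2_def K_def)
    also have "\<dots> = t * B" using t st by (simp add: B_def K_def)
    also have "\<dots> \<le> 2 * B" using t B0 by (intro mult_right_mono) auto
    finally show ?thesis .
  qed
  have C3B: "\<bar>C3\<bar> \<le> 2 * B"
  proof -
    have "\<bar>C3\<bar> \<le> K / t" using put_D_bounds(2)[OF \<sigma> t(1) t4] by (simp add: C3_def K_def)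
    also have "\<dots> = sqrt t * B" using t st by (simp add: B_def K_def)
    also have "\<dots> \<le> 2 * B" using st B0 by (intro mult_right_mono) auto
    finally show ?thesis .
  qed
  have v: "\<bar>\<rho>\<^sup>2 * (j\<^sup>2 / 4 - x\<^sup>2) - \<Delta>\<bar> \<le> (3 + 12 * x\<^sup>2 / N) / N\<^sup>2"
  proof -
    have "\<rho>\<^sup>2 * (j\<^sup>2 / 4 - x\<^sup>2) - \<Delta> = (3 * j - 1 - 12 * x\<^sup>2) / N ^ 3"
      unfolding lam2 \<Delta>_def using N by (simp add: field_simps)
    hence "\<bar>\<rho>\<^sup>2 * (j\<^sup>2 / 4 - x\<^sup>2) - \<Delta>\<bar> = \<bar>3 * j - 1 - 12 * x\<^sup>2\<bar> / N ^ 3" using N by simp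
    also have "\<dots> \<le> (3 * N + 12 * x\<^sup>2) / N ^ 3"
    proof (rule divide_right_mono)
      show "\<bar>3 * j - 1 - 12 * x\<^sup>2\<bar> \<le> 3 * N + 12 * x\<^sup>2"
        using j zero_le_power2[of x] by linarith
    qed (use N in simp)
    also have "\<dots> = (3 + 12 * x\<^sup>2 / N) / N\<^sup>2" using N by (simp add: field_simps power2_eq_square
        power3_eq_cube)
    finally show ?thesis .
  qed
  have u: "\<bar>\<rho> ^ 3 * (x * (j\<^sup>2 / 2 - 2 * x\<^sup>2))\<bar> \<le> 12 * (1 + x\<^sup>2 / N) / N\<^sup>2"
  proof -
    have "x\<^sup>2 \<le> (j / 2)\<^sup>2" using x by (subst abs_le_square_iff[symmetric]) (simp add: j_def)
    hence "\<bar>j\<^sup>2 / 2 - 2 * x\<^sup>2\<bar> \<le> j\<^sup>2 / 2" using zero_le_power2[of x] by (simp add: power_divide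
        abs_le_iff)
    also have "\<dots> \<le> N\<^sup>2 / 2" using j by (simp add: power_mono)
    finally have a: "\<bar>j\<^sup>2 / 2 - 2 * x\<^sup>2\<bar> \<le> N\<^sup>2 / 2" .
    have l: "\<rho> ^ 3 \<le> 48 / (N ^ 4 * r)"
    proof -
      have "sqrt 12 \<le> (4::real)" by (rule real_le_lsqrt) auto
      hence "12 / N ^ 3 * (sqrt 12 / (N * r)) \<le> 12 / N ^ 3 * (4 / (N * r))" using N r
        by (intro mult_left_mono divide_right_mono) auto
      moreover have "\<rho> ^ 3 = 12 / N ^ 3 * (sqrt 12 / (N * r))"
        unfolding lam2[symmetric] lam[symmetric] by (simp add: power2_eq_square power3_eq_cube)
      ultimately show ?thesis using N r by (simp add: power3_eq_cube power4_eq_xxxx)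
    qed
    have "2 * \<bar>x\<bar> * r \<le> x\<^sup>2 + N" using zero_le_power2[of "\<bar>x\<bar> - r"] r
      by (simp add: power2_eq_square algebra_simps)
    hence "2 * \<bar>x\<bar> * r / (2 * N) \<le> (x\<^sup>2 + N) / (2 * N)" using N by (intro divide_right_mono) auto
    also have "(x\<^sup>2 + N) / (2 * N) = (1 + x\<^sup>2 / N) / 2" using N by (simp add: field_simps)
    also have "2 * \<bar>x\<bar> * r / (2 * N) = \<bar>x\<bar> / r" unfolding r(2)[symmetric] using r(1) by simp
    finally have xx: "\<bar>x\<bar> / r \<le> (1 + x\<^sup>2 / N) / 2" .
    have "\<bar>\<rho> ^ 3 * (x * (j\<^sup>2 / 2 - 2 * x\<^sup>2))\<bar> = \<rho> ^ 3 * (\<bar>x\<bar> * \<bar>j\<^sup>2 / 2 - 2 * x\<^sup>2\<bar>)"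
      using lam0 by (simp add: abs_mult)
    also have "\<dots> \<le> 48 / (N ^ 4 * r) * (\<bar>x\<bar> * (N\<^sup>2 / 2))"
      using l a lam0 N r by (intro mult_mono) auto
    also have "\<dots> = 24 * (\<bar>x\<bar> / r) / N\<^sup>2" using N r by (simp add: power4_eq_xxxx power2_eq_square)
    also have "\<dots> \<le> 24 * ((1 + x\<^sup>2 / N) / 2) / N\<^sup>2"
      using xx N by (intro divide_right_mono mult_left_mono) auto
    also have "24 * (z / 2) / M = 12 * z / M" for z M :: real by simp
    finally show ?thesis .
  qed
  have "w * put \<sigma> (y + d) t + w' * put \<sigma> (y + d') t - put \<sigma> y (t + \<Delta>)
    = (w + w') * A - A - C1 * (w * d + w' * d') + C2 / 2 * ((w * d\<^sup>2 + w' * d'\<^sup>2) - \<Delta>)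
      + C3 / 6 * (w * d ^ 3 + w' * d' ^ 3) + (w * R + w' * R') - Q"
    by (simp add: R_def R'_def Q_def algebra_simps)
  also have "\<dots> = C2 / 2 * (\<rho>\<^sup>2 * (j\<^sup>2 / 4 - x\<^sup>2) - \<Delta>) + C3 / 6 * (\<rho> ^ 3 * (x * (j\<^sup>2 / 2 - 2 * x\<^sup>2)))
      + (w * R + w' * R') - Q"
    unfolding m1 m2 m3 w(3) by simp
  finally have main: "w * put \<sigma> (y + d) t + w' * put \<sigma> (y + d') t - put \<sigma> y (t + \<Delta>) = \<dots>" .
  have b1: "\<bar>C2 / 2 * (\<rho>\<^sup>2 * (j\<^sup>2 / 4 - x\<^sup>2) - \<Delta>)\<bar> \<le> B * ((3 + 12 * x\<^sup>2 / N) / N\<^sup>2)"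
    unfolding abs_mult using C2B v B0 by (intro mult_mono) auto
  have b2: "\<bar>C3 / 6 * (\<rho> ^ 3 * (x * (j\<^sup>2 / 2 - 2 * x\<^sup>2)))\<bar> \<le> (B / 3) * (12 * (1 + x\<^sup>2 / N) / N\<^sup>2)"
    unfolding abs_mult[of "C3 / 6"] using C3B u B0 by (intro mult_mono) auto
  have b3: "\<bar>w * R + w' * R'\<bar> \<le> B * (144 / N\<^sup>2)"
  proof -
    have "\<bar>w * R + w' * R'\<bar> \<le> w * \<bar>R\<bar> + w' * \<bar>R'\<bar>"
      using w abs_triangle_ineq[of "w * R" "w' * R'"] by (simp add: abs_mult)
    also have "\<dots> \<le> w * (B * (144 / N\<^sup>2)) + w' * (B * (144 / N\<^sup>2))"
      using RB w by (intro add_mono mult_left_mono) auto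
    also have "\<dots> = B * (144 / N\<^sup>2)" using w(3) by (metis distrib_right mult_1)
    finally show ?thesis .
  qed
  have "\<bar>w * put \<sigma> (y + d) t + w' * put \<sigma> (y + d') t - put \<sigma> y (t + \<Delta>)\<bar>
      \<le> B * ((3 + 12 * x\<^sup>2 / N) / N\<^sup>2) + (B / 3) * (12 * (1 + x\<^sup>2 / N) / N\<^sup>2) + B * (144 / N\<^sup>2) + B
          * (9 / N\<^sup>2)"
    unfolding main using b1 b2 b3 QB by linarith
  also have "\<dots> = B * ((160 + 16 * x\<^sup>2 / N) / N\<^sup>2)"
    using N by (simp add: field_simps)
  finally show ?thesis
    unfolding kk tau1 t_def[symmetric] j_def[symmetric] N_def[symmetric] yd y_def[symmetric]
      w_def[symmetric] w'_def[symmetric] B_def[symmetric] .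
qed

text \<open>
  The errors of the steps add up to \<open>O(n\<^sup>-\<^sup>1\<^sup>/\<^sup>2)\<close> because \<open>\<tau> k \<ge> (n - k + 1) / n\<close>.
\<close>
theorem put_perm_avg:
  assumes \<sigma>: "\<sigma> > 0" and n: "1 \<le> n"
  shows "\<bar>perm_avg n (\<lambda>\<pi>. put \<sigma> (sqrt 12 / sqrt (real n) * centred_ascents \<pi>) (1 / real n))
     - put \<sigma> 0 (1 + 1 / real n - 1 / real n ^ 3)\<bar> \<le> 656 * put_const \<sigma> / sqrt (real n)"
proof -
  define \<rho> where "\<rho> = sqrt 12 / (real n * sqrt (real n))"
  define \<tau> where "\<tau> = (\<lambda>k::nat. 1 + 1 / real n - (real k / real n) ^ 3)"
  define F where "F = (\<lambda>k::nat. perm_avg k (\<lambda>\<pi>. put \<sigma> (\<rho> * real k * centred_ascents \<pi>) (\<tau> k)))"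
  define M where "M = 164 * put_const \<sigma> / sqrt (real n)"
  have K0: "0 \<le> put_const \<sigma>" using \<sigma> by (simp add: put_const_def)
  have M0: "0 \<le> M" using K0 by (simp add: M_def)
  have err: "\<bar>F k - F (k - 1)\<bar> \<le> M * (1 / (real (n - k + 1) * sqrt (real (n - k + 1))))"
    if k: "2 \<le> k" "k \<le> n" for k
  proof -
    obtain k' where k': "k = Suc k'" "1 \<le> k'" using k by (cases k) auto
    define B where "B = put_const \<sigma> / (\<tau> k * sqrt (\<tau> k))"
    define f where "f = (\<lambda>x. put \<sigma> (\<rho> * real k * x) (\<tau> k))"
    define N where "N = real n"
    define j where "j = real (n - k + 1)"
    have j: "j = N - real k + 1" "1 \<le> j" using k by (auto simp: j_def N_def)
    have N: "N \<ge> 2" using k by (auto simp: N_def)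
    \<comment> \<open>Since a cube of a number in \<open>[0, 1]\<close> is at most the number, \<open>\<tau> k \<ge> (n - k + 1) / n\<close>.\<close>
    have "(real k / N) ^ 3 \<le> (real k / N) ^ 1"
      by (rule power_decreasing) (use k in \<open>auto simp: N_def\<close>)
    hence tj: "j / N \<le> \<tau> k" using N unfolding j(1) \<tau>_def N_def[symmetric] by (simp add: field_simps)
    have jN: "0 < j / N" using j N by simp
    have B0: "0 \<le> B" unfolding B_def using tj jN K0 by simp
    have "\<bar>F k - F (k - 1)\<bar> \<le> perm_avg k' (\<lambda>\<pi>. B * ((160 + 16 * (centred_ascents \<pi>)\<^sup>2 / N) / N\<^sup>2))"
    proof -
      have E: "F k - F (k - 1) = perm_avg k' (\<lambda>\<pi>. (1 / 2 - centred_ascents \<pi> / real (Suc k')) * f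
          (centred_ascents \<pi> + 1 / 2)
                     + (1 / 2 + centred_ascents \<pi> / real (Suc k')) * f (centred_ascents \<pi> - 1 / 2)
                     - put \<sigma> (\<rho> * real (k - 1) * centred_ascents \<pi>) (\<tau> (k - 1)))"
      proof -
        have F1: "F k = perm_avg (Suc k') (\<lambda>\<pi>. f (centred_ascents \<pi>))"
          by (simp only: F_def f_def k'(1))
        have F2: "F (k - 1) = perm_avg k' (\<lambda>\<pi>. put \<sigma> (\<rho> * real (k - 1) * centred_ascents \<pi>) (\<tau> (k -
            1)))"
          by (simp add: F_def k'(1))
        show ?thesis unfolding F1 F2 perm_avg_ascents_step perm_avg_diff ..
      qed
      show ?thesis unfolding E
      proof (rule order.trans[OF perm_avg_abs perm_avg_mono])
        fix \<pi> assume "\<pi> \<in> permutations_of_set {1..k'}"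
        hence "\<bar>centred_ascents \<pi>\<bar> \<le> real k / 2" using centred_ascents_half[of \<pi> k'] by (simp add: k')
        from put_step[OF \<sigma> k this, folded \<rho>_def, folded \<tau>_def]
        show "\<bar>(1 / 2 - centred_ascents \<pi> / real (Suc k')) * f (centred_ascents \<pi> + 1 / 2)
                     + (1 / 2 + centred_ascents \<pi> / real (Suc k')) * f (centred_ascents \<pi> - 1 / 2)
                     - put \<sigma> (\<rho> * real (k - 1) * centred_ascents \<pi>) (\<tau> (k - 1))\<bar>
          \<le> B * ((160 + 16 * (centred_ascents \<pi>)\<^sup>2 / N) / N\<^sup>2)"
          unfolding f_def B_def N_def k'(1)[symmetric] \<tau>_def .
      qed
    qed
    also have "\<dots> = B / N\<^sup>2 * (160 + 16 / N * perm_avg k' (\<lambda>\<pi>. (centred_ascents \<pi>)\<^sup>2))"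
    proof -
      have "perm_avg k' (\<lambda>\<pi>. B * ((160 + 16 * (centred_ascents \<pi>)\<^sup>2 / N) / N\<^sup>2))
        = perm_avg k' (\<lambda>\<pi>. B / N\<^sup>2 * (160 + 16 / N * (centred_ascents \<pi>)\<^sup>2))"
        by (rule perm_avg_cong) simp
      thus ?thesis by (simp only: perm_avg_cmult perm_avg_add perm_avg_const)
    qed
    also have "\<dots> \<le> B / N\<^sup>2 * 164"
    proof (rule mult_left_mono)
      have "perm_avg k' (\<lambda>\<pi>. (centred_ascents \<pi>)\<^sup>2) \<le> N / 4"
        using perm_avg_ascents_square[of k'] k k' by (simp add: N_def)
      hence "16 / N * perm_avg k' (\<lambda>\<pi>. (centred_ascents \<pi>)\<^sup>2) \<le> 16 / N * (N / 4)"
        using N by (intro mult_left_mono) auto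
      also have "\<dots> = 4" using N by simp
      finally show "160 + 16 / N * perm_avg k' (\<lambda>\<pi>. (centred_ascents \<pi>)\<^sup>2) \<le> 164" by simp
    qed (use B0 in simp)
    also have "\<dots> \<le> put_const \<sigma> / (j / N * sqrt (j / N)) / N\<^sup>2 * 164"
      unfolding B_def using tj jN K0
      by (intro mult_right_mono divide_right_mono divide_left_mono mult_mono mult_pos_pos) auto
    also have "\<dots> = M * (1 / (j * sqrt j))"
    proof -
      define r where "r = sqrt N"
      have r: "r > 0" "N = r * r" using N by (auto simp: r_def)
      have sq: "sqrt (j / N) = sqrt j / r" by (simp add: real_sqrt_divide r_def)
      have "0 < j" "0 < sqrt j" using j(2) by auto
      thus ?thesis unfolding sq M_def N_def[symmetric] r_def[symmetric] unfolding r(2) using r(1)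
        by (simp add: divide_simps power2_eq_square)
    qed
    finally show ?thesis unfolding j_def .
  qed
  \<comment> \<open>The accumulated error is bounded by a telescoping majorant, see \<open>inverse_three_halves_le\<close>.\<close>
  have bound: "\<bar>F k - F 1\<bar> \<le> M * (4 / sqrt (real (n - k + 1)))" if "1 \<le> k" "k \<le> n" for k
    using that
  proof (induction k rule: dec_induct)
    case base
    show ?case using M0 by simp
  next
    case (step k)
    define j where "j = n - Suc k + 1"
    have j: "n - k + 1 = Suc j" "1 \<le> j" using step by (auto simp: j_def)
    have "\<bar>F (Suc k) - F k\<bar> \<le> M * (1 / (real j * sqrt (real j)))"
      using err[of "Suc k"] step.hyps step.prems by (simp add: j_def)
    moreover have "\<bar>F k - F 1\<bar> \<le> M * (4 / sqrt (real (Suc j)))"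
      unfolding j(1)[symmetric] by (rule step.IH) (use step.prems in simp)
    moreover have "M * (1 / (real j * sqrt (real j))) + M * (4 / sqrt (real (Suc j))) \<le> M * (4 /
        sqrt (real j))"
      unfolding distrib_left[symmetric] by (intro mult_left_mono inverse_three_halves_le j M0)
    ultimately have "\<bar>F (Suc k) - F 1\<bar> \<le> M * (4 / sqrt (real j))" by linarith
    thus ?case by (simp only: j_def)
  qed
  have r: "\<rho> * real n = sqrt 12 / sqrt (real n)" using n by (simp add: \<rho>_def)
  have tn: "\<tau> n = 1 / real n" using n by (simp add: \<tau>_def)
  have "F n = perm_avg n (\<lambda>\<pi>. put \<sigma> (sqrt 12 / sqrt (real n) * centred_ascents \<pi>) (1 / real n))"
    by (simp only: F_def r tn)
  moreover have "F 1 = put \<sigma> 0 (1 + 1 / real n - 1 / real n ^ 3)"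
    unfolding F_def by (subst perm_avg_1_ascents) (simp add: \<tau>_def power_divide)
  moreover have "\<bar>F n - F 1\<bar> \<le> 656 * put_const \<sigma> / sqrt (real n)"
    using bound[of n] n by (simp add: M_def)
  ultimately show ?thesis by simp
qed

text \<open>
  At the end the time \<open>1 / n\<close> is replaced by 0, at the start \<open>1 + 1 / n - 1 / n\<^sup>3\<close> by 1. The
  sign \<open>s\<close> covers both a bias to ascents and a bias to descents.
\<close>
theorem put_payoff_perm_avg:
  assumes \<sigma>: "\<sigma> > 0" and n: "1 \<le> n" and s: "s = 1 \<or> s = -1"
  shows "\<bar>perm_avg n (\<lambda>\<pi>. max 0 (1 - exp (\<sigma> * (s * (sqrt 12 / sqrt (real n)) * centred_ascents \<pi>) -
      \<sigma>\<^sup>2 / 2)))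
     - (1 - 2 * std_normal_cdf (- (\<sigma> / 2)))\<bar> \<le> (658 * put_const \<sigma> + \<sigma> + 2 * \<sigma>\<^sup>2) / sqrt (real n)"
proof -
  define r where "r = sqrt (real n)"
  have r: "1 \<le> r" "real n = r * r" using n by (auto simp: r_def)
  have K0: "0 \<le> put_const \<sigma>" using \<sigma> by (simp add: put_const_def)
  define g where "g = (\<lambda>x. max 0 (1 - exp (\<sigma> * (sqrt 12 / r * x) - \<sigma>\<^sup>2 / 2)))"
  define A where "A = perm_avg n (\<lambda>\<pi>. g (centred_ascents \<pi>))"
  define P where "P = perm_avg n (\<lambda>\<pi>. put \<sigma> (sqrt 12 / r * centred_ascents \<pi>) (1 / real n))"
  have 1: "perm_avg n (\<lambda>\<pi>. max 0 (1 - exp (\<sigma> * (s * (sqrt 12 / sqrt (real n)) * centred_ascents \<pi>) -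
      \<sigma>\<^sup>2 / 2))) = A"
    using s
  proof
    assume "s = -1"
    hence "perm_avg n (\<lambda>\<pi>. max 0 (1 - exp (\<sigma> * (s * (sqrt 12 / sqrt (real n)) * centred_ascents \<pi>) -
        \<sigma>\<^sup>2 / 2)))
      = perm_avg n (\<lambda>\<pi>. g (- centred_ascents \<pi>))" by (simp add: g_def r_def)
    thus ?thesis unfolding A_def using perm_avg_minus_ascents[OF n, of g] by simp
  qed (simp add: A_def g_def r_def)
  have "\<bar>P - A\<bar> \<le> perm_avg n (\<lambda>\<pi>. (\<sigma> + 2 * \<sigma>\<^sup>2) * (1 / r))"
    unfolding P_def A_def perm_avg_diff[symmetric]
  proof (rule order.trans[OF perm_avg_abs perm_avg_mono])
    fix \<pi>
    have "sqrt (1 / real n) = 1 / r" by (simp add: r_def real_sqrt_divide)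
    thus "\<bar>put \<sigma> (sqrt 12 / r * centred_ascents \<pi>) (1 / real n) - g (centred_ascents \<pi>)\<bar> \<le> (\<sigma> + 2 *
        \<sigma>\<^sup>2) * (1 / r)"
      using put_lipschitz_sqrt[OF \<sigma>, of "1 / real n" "sqrt 12 / r * centred_ascents \<pi>"] n
      by (simp add: g_def divide_le_eq)
  qed
  hence 2: "\<bar>P - A\<bar> \<le> (\<sigma> + 2 * \<sigma>\<^sup>2) / r" by simp
  have 3: "\<bar>P - put \<sigma> 0 (1 + 1 / real n - 1 / real n ^ 3)\<bar> \<le> 656 * put_const \<sigma> / r"
    using put_perm_avg[OF \<sigma> n] by (simp add: P_def r_def)
  define \<Delta> where "\<Delta> = 1 / real n - 1 / real n ^ 3"
  have n1: "1 / real n ^ 3 \<le> 1 / real n"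
    using n self_le_power[of "real n" 3] by (intro divide_left_mono) auto
  have "1 / real n \<le> 1 / r" using r by (simp add: field_simps)
  moreover have "1 / r \<le> 1" using r by simp
  moreover have "0 \<le> 1 / real n ^ 3" by simp
  ultimately have D: "0 \<le> \<Delta>" "\<Delta> \<le> 1 / r" "\<Delta> \<le> 1" using n1 unfolding \<Delta>_def by linarith+
  have "\<bar>put \<sigma> 0 (1 + \<Delta>) - (put \<sigma> 0 1 + put_D2 \<sigma> 0 1 / 2 * \<Delta>)\<bar> \<le> put_const \<sigma> * \<Delta>\<^sup>2"
    using put_taylor_time[OF \<sigma>, of 1 \<Delta> 0] D by simp
  moreover have "put_const \<sigma> * \<Delta>\<^sup>2 \<le> put_const \<sigma> * (1 / r)"
    using D K0 by (intro mult_left_mono) (auto simp: power2_eq_square intro: order.trans[OF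
        mult_left_le])
  moreover have "\<bar>put_D2 \<sigma> 0 1 / 2 * \<Delta>\<bar> \<le> put_const \<sigma> * (1 / r)"
    unfolding abs_mult using put_D_bounds(1)[OF \<sigma>, of 1 0] D K0 by (intro mult_mono) auto
  ultimately have 4: "\<bar>put \<sigma> 0 (1 + \<Delta>) - put \<sigma> 0 1\<bar> \<le> 2 * (put_const \<sigma> * (1 / r))" by linarith
  have e: "1 + 1 / real n - 1 / real n ^ 3 = 1 + \<Delta>" by (simp add: \<Delta>_def)
  have "\<bar>A - put \<sigma> 0 1\<bar> \<le> (\<sigma> + 2 * \<sigma>\<^sup>2) / r + 656 * put_const \<sigma> / r + 2 * (put_const \<sigma> * (1 / r))"
    using 2 3 4 unfolding e by linarith
  also have "\<dots> = (658 * put_const \<sigma> + \<sigma> + 2 * \<sigma>\<^sup>2) / r" using r by (simp add: field_simps)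
  finally show ?thesis unfolding 1 put_0_1 r_def .
qed

section \<open>Total variation distance\<close>

text \<open>
  A density \<open>L\<close> that is, up to the factor \<open>exp \<eta>\<close>, proportional to \<open>R\<close> is close in \<open>L\<^sup>1\<close> to the
  normalisation of \<open>R\<close>. The unknown factor \<open>\<kappa>\<close> is controlled by the two normalisations, and the
  product of \<open>R\<close> and \<open>\<eta>\<close> by their second moments.
\<close>
lemma perm_avg_tilt_perturbation:
  assumes L: "\<And>\<pi>. \<pi> \<in> permutations_of_set {1..n} \<Longrightarrow> L \<pi> = \<kappa> * R \<pi> * exp (\<eta> \<pi>)"
    and R0: "\<And>\<pi>. \<pi> \<in> permutations_of_set {1..n} \<Longrightarrow> 0 \<le> R \<pi>"
    and \<eta>: "\<And>\<pi>. \<pi> \<in> permutations_of_set {1..n} \<Longrightarrow> \<bar>\<eta> \<pi>\<bar> \<le> B"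
    and \<kappa>: "\<kappa> > 0" and L1: "perm_avg n L = 1" and M: "1 \<le> perm_avg n R"
    and D: "perm_avg n (\<lambda>\<pi>. (R \<pi>)\<^sup>2) \<le> D" and e: "perm_avg n (\<lambda>\<pi>. (\<eta> \<pi>)\<^sup>2) \<le> \<epsilon>\<^sup>2" "\<epsilon> > 0"
  shows "perm_avg n (\<lambda>\<pi>. \<bar>L \<pi> - R \<pi> / perm_avg n R\<bar>) \<le> exp (2 * B) * (D + 1) * \<epsilon>"
proof -
  define M where "M = perm_avg n R"
  have M1: "1 \<le> M" using M by (simp add: M_def)
  define E where "E = perm_avg n (\<lambda>\<pi>. R \<pi> * \<bar>\<eta> \<pi>\<bar>)"
  have "E \<le> perm_avg n (\<lambda>\<pi>. \<epsilon> / 2 * (R \<pi>)\<^sup>2 + 1 / (2 * \<epsilon>) * (\<eta> \<pi>)\<^sup>2)"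
    unfolding E_def
  proof (rule perm_avg_mono)
    fix \<pi>
    have "0 \<le> (\<epsilon> * R \<pi> - \<bar>\<eta> \<pi>\<bar>)\<^sup>2" by simp
    hence "2 * \<epsilon> * (R \<pi> * \<bar>\<eta> \<pi>\<bar>) \<le> \<epsilon>\<^sup>2 * (R \<pi>)\<^sup>2 + (\<eta> \<pi>)\<^sup>2"
      by (simp add: power2_diff power_mult_distrib mult_ac)
    thus "R \<pi> * \<bar>\<eta> \<pi>\<bar> \<le> \<epsilon> / 2 * (R \<pi>)\<^sup>2 + 1 / (2 * \<epsilon>) * (\<eta> \<pi>)\<^sup>2"
      using e(2) by (simp add: field_simps power2_eq_square)
  qed
  also have "\<dots> = \<epsilon> / 2 * perm_avg n (\<lambda>\<pi>. (R \<pi>)\<^sup>2) + 1 / (2 * \<epsilon>) * perm_avg n (\<lambda>\<pi>. (\<eta> \<pi>)\<^sup>2)"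
    by (simp only: perm_avg_add perm_avg_cmult)
  also have "\<dots> \<le> \<epsilon> / 2 * D + 1 / (2 * \<epsilon>) * \<epsilon>\<^sup>2"
    using D e by (intro add_mono mult_left_mono) auto
  also have "\<dots> = (D + 1) * \<epsilon> / 2" using e(2) by (simp add: field_simps power2_eq_square)
  finally have EB: "E \<le> (D + 1) * \<epsilon> / 2" .
  have E0: "0 \<le> E" unfolding E_def perm_avg_def using R0 by (auto intro!: divide_nonneg_nonneg
      sum_nonneg)
  have "\<kappa> * exp (- B) * M \<le> perm_avg n L"
    unfolding M_def perm_avg_cmult[symmetric]
  proof (rule perm_avg_mono)
    fix \<pi> assume \<pi>: "\<pi> \<in> permutations_of_set {1..n}"
    have "exp (- B) \<le> exp (\<eta> \<pi>)" using \<eta>[OF \<pi>] by simp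
    hence "\<kappa> * R \<pi> * exp (- B) \<le> \<kappa> * R \<pi> * exp (\<eta> \<pi>)" using \<kappa> R0[OF \<pi>] by (intro mult_left_mono) auto
    thus "\<kappa> * exp (- B) * R \<pi> \<le> L \<pi>" unfolding L[OF \<pi>] by (simp add: mult_ac)
  qed
  moreover have "\<kappa> * exp (- B) * 1 \<le> \<kappa> * exp (- B) * M" using M1 \<kappa> by (intro mult_left_mono) auto
  ultimately have "\<kappa> * exp (- B) * 1 \<le> 1" unfolding L1 by linarith
  hence kB: "\<kappa> \<le> exp B" by (simp add: exp_minus field_simps)
  have d: "perm_avg n (\<lambda>\<pi>. \<bar>L \<pi> - \<kappa> * R \<pi>\<bar>) \<le> exp (2 * B) * E"
  proof -
    have "perm_avg n (\<lambda>\<pi>. \<bar>L \<pi> - \<kappa> * R \<pi>\<bar>) \<le> perm_avg n (\<lambda>\<pi>. \<kappa> * exp B * (R \<pi> * \<bar>\<eta> \<pi>\<bar>))"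
    proof (rule perm_avg_mono)
      fix \<pi> assume \<pi>: "\<pi> \<in> permutations_of_set {1..n}"
      have b: "\<bar>exp z - 1\<bar> \<le> exp B * \<bar>z\<bar>" if "\<bar>z\<bar> \<le> B" for z :: real
      proof (cases "0 \<le> z")
        case True
        have "1 - z \<le> exp (- z)" using exp_ge_add_one_self[of "- z"] by simp
        hence "(1 - z) * exp z \<le> exp (- z) * exp z" by (rule mult_right_mono) simp
        hence "exp z - 1 \<le> exp z * z" by (simp add: exp_minus algebra_simps)
        also have "\<dots> \<le> exp B * z" using True that by (intro mult_right_mono) auto
        finally show ?thesis using True by simp
      next
        case False
        have "1 + z \<le> exp z" by (rule exp_ge_add_one_self)
        moreover have "1 * (- z) \<le> exp B * (- z)" using False that by (intro mult_right_mono) auto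
        moreover have "exp z \<le> 1" "\<bar>z\<bar> = - z" using False by auto
        ultimately show ?thesis by (simp only: \<open>\<bar>z\<bar> = - z\<close>)
      qed
      have "L \<pi> - \<kappa> * R \<pi> = \<kappa> * R \<pi> * (exp (\<eta> \<pi>) - 1)" unfolding L[OF \<pi>] by (simp add: algebra_simps)
      hence "\<bar>L \<pi> - \<kappa> * R \<pi>\<bar> = \<kappa> * R \<pi> * \<bar>exp (\<eta> \<pi>) - 1\<bar>" using \<kappa> R0[OF \<pi>] by (simp add: abs_mult)
      also have "\<dots> \<le> \<kappa> * R \<pi> * (exp B * \<bar>\<eta> \<pi>\<bar>)" using \<kappa> R0[OF \<pi>] b[OF \<eta>[OF \<pi>]] by (intro
          mult_left_mono) auto
      finally show "\<bar>L \<pi> - \<kappa> * R \<pi>\<bar> \<le> \<kappa> * exp B * (R \<pi> * \<bar>\<eta> \<pi>\<bar>)" by (simp add: mult_ac)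
    qed
    also have "\<dots> = \<kappa> * exp B * E" unfolding E_def perm_avg_cmult ..
    also have "\<dots> \<le> exp B * exp B * E" using kB E0 by (intro mult_right_mono) auto
    also have "exp B * exp B = exp (2 * B)" by (simp add: exp_add[symmetric])
    finally show ?thesis .
  qed
  have "\<bar>1 - \<kappa> * M\<bar> = \<bar>perm_avg n (\<lambda>\<pi>. L \<pi> - \<kappa> * R \<pi>)\<bar>"
    unfolding perm_avg_diff perm_avg_cmult L1 M_def ..
  also have "\<dots> \<le> exp (2 * B) * E" using perm_avg_abs d by (rule order.trans)
  finally have km: "\<bar>1 - \<kappa> * M\<bar> \<le> exp (2 * B) * E" .
  have "perm_avg n (\<lambda>\<pi>. \<bar>L \<pi> - R \<pi> / M\<bar>) \<le> perm_avg n (\<lambda>\<pi>. \<bar>L \<pi> - \<kappa> * R \<pi>\<bar> + \<bar>1 - \<kappa> * M\<bar> / M * R \<pi>)"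
  proof (rule perm_avg_mono)
    fix \<pi> assume \<pi>: "\<pi> \<in> permutations_of_set {1..n}"
    define t where "t = (1 - \<kappa> * M) / M * R \<pi>"
    have lt: "L \<pi> - R \<pi> / M = (L \<pi> - \<kappa> * R \<pi>) - t" using M1 by (simp add: t_def field_simps)
    have ta: "\<bar>t\<bar> = \<bar>1 - \<kappa> * M\<bar> / M * R \<pi>" using M1 R0[OF \<pi>] by (simp add: t_def abs_mult)
    show "\<bar>L \<pi> - R \<pi> / M\<bar> \<le> \<bar>L \<pi> - \<kappa> * R \<pi>\<bar> + \<bar>1 - \<kappa> * M\<bar> / M * R \<pi>"
      unfolding lt ta[symmetric] by (rule abs_triangle_ineq4)
  qed
  also have "\<dots> = perm_avg n (\<lambda>\<pi>. \<bar>L \<pi> - \<kappa> * R \<pi>\<bar>) + \<bar>1 - \<kappa> * M\<bar> / M * M"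
    unfolding perm_avg_add perm_avg_cmult M_def ..
  also have "\<dots> \<le> exp (2 * B) * E + exp (2 * B) * E"
  proof -
    have "\<bar>1 - \<kappa> * M\<bar> / M * M = \<bar>1 - \<kappa> * M\<bar>" using M1 by simp
    thus ?thesis using add_mono[OF d km] by simp
  qed
  also have "\<dots> \<le> exp (2 * B) * ((D + 1) * \<epsilon> / 2) + exp (2 * B) * ((D + 1) * \<epsilon> / 2)"
    using EB by (intro add_mono mult_left_mono) auto
  finally show ?thesis unfolding M_def by (simp add: algebra_simps)
qed

text \<open>
  Since the density \<open>L\<close> has mean 1, half of its \<open>L\<^sup>1\<close> distance from 1 is the mean of its
  positive deficit, which is a bounded Lipschitz function of the logarithm of \<open>L\<close>.
\<close>
lemma tv_dist_perm_avg:
  fixes p :: real and m n :: nat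
  assumes "m \<ge> 1"
  defines "L \<equiv> \<lambda>\<pi>. fact n * pmf (shelf_shuffle p n m) \<pi>"
  shows "perm_avg n L = 1"
    and "tv_dist n (shelf_shuffle p n m) (uniform_perm n) = perm_avg n (\<lambda>\<pi>. max 0 (1 - L \<pi>))"
proof -
  have "(\<Sum>\<pi>\<in>permutations_of_set {1..n}. pmf (shelf_shuffle p n m) \<pi>) = 1"
    by (rule sum_pmf_eq_1) (use set_pmf_shelf_shuffle[OF assms(1)] in auto)
  thus L1: "perm_avg n L = 1" by (simp add: perm_avg_def L_def sum_distrib_left[symmetric])
  have u: "pmf (uniform_perm n) \<pi> = 1 / fact n" if "\<pi> \<in> permutations_of_set {1..n}" for \<pi>
    using that unfolding uniform_perm_def by (subst pmf_of_set) (auto simp: card_permutations_of_set)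
  have "tv_dist n (shelf_shuffle p n m) (uniform_perm n) = perm_avg n (\<lambda>\<pi>. 1 / 2 * \<bar>L \<pi> - 1\<bar>)"
  proof -
    have "(\<Sum>\<pi>\<in>permutations_of_set {1..n}. \<bar>pmf (shelf_shuffle p n m) \<pi> - pmf (uniform_perm n) \<pi>\<bar>)
      = (\<Sum>\<pi>\<in>permutations_of_set {1..n}. \<bar>L \<pi> - 1\<bar> / fact n)"
    proof (rule sum.cong[OF refl])
      fix \<pi> assume \<pi>: "\<pi> \<in> permutations_of_set {1..n}"
      have "pmf (shelf_shuffle p n m) \<pi> - pmf (uniform_perm n) \<pi> = (L \<pi> - 1) / fact n"
        unfolding u[OF \<pi>] L_def by (simp add: field_simps)
      thus "\<bar>pmf (shelf_shuffle p n m) \<pi> - pmf (uniform_perm n) \<pi>\<bar> = \<bar>L \<pi> - 1\<bar> / fact n" by simp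
    qed
    thus ?thesis unfolding tv_dist_def perm_avg_cmult by (simp add: perm_avg_def sum_divide_distrib)
  qed
  also have "\<dots> = perm_avg n (\<lambda>\<pi>. max 0 (1 - L \<pi>) + 1 / 2 * (L \<pi> - 1))"
    by (rule perm_avg_cong) (auto simp: max_def abs_if field_simps)
  also have "\<dots> = perm_avg n (\<lambda>\<pi>. max 0 (1 - L \<pi>))"
    unfolding perm_avg_add perm_avg_cmult perm_avg_diff L1 by simp
  finally show "tv_dist n (shelf_shuffle p n m) (uniform_perm n) = perm_avg n (\<lambda>\<pi>. max 0 (1 - L \<pi>))" .
qed

lemma eventually_imp_bound_all:
  fixes f :: "nat \<Rightarrow> real"
  assumes "\<And>n. n \<ge> n0 \<Longrightarrow> \<bar>f n\<bar> \<le> C / sqrt (real n)"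
  shows "\<exists>C'. \<forall>n\<ge>1. \<bar>f n\<bar> \<le> C' * real n powr (- 1 / 2)"
proof -
  define C' where "C' = \<bar>C\<bar> + (\<Sum>n<n0. \<bar>f n\<bar> * sqrt (real n))"
  have S: "0 \<le> (\<Sum>n<n0. \<bar>f n\<bar> * sqrt (real n))" by (intro sum_nonneg) auto
  show ?thesis
  proof (intro exI[of _ C'] allI impI)
    fix n :: nat assume n: "1 \<le> n"
    have pw: "real n powr (- 1 / 2) = 1 / sqrt (real n)"
      using n by (simp add: powr_minus powr_half_sqrt[symmetric] inverse_eq_divide)
    have "\<bar>f n\<bar> \<le> C' / sqrt (real n)"
    proof (cases "n \<ge> n0")
      case True
      have "C / sqrt (real n) \<le> C' / sqrt (real n)" using S by (intro divide_right_mono) (auto simp: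
          C'_def)
      thus ?thesis using assms[OF True] by linarith
    next
      case False
      hence "\<bar>f n\<bar> * sqrt (real n) \<le> (\<Sum>n<n0. \<bar>f n\<bar> * sqrt (real n))"
        by (intro member_le_sum[of n "{..<n0}" "\<lambda>n. \<bar>f n\<bar> * sqrt (real n)"]) auto
      hence "\<bar>f n\<bar> * sqrt (real n) \<le> C'" by (simp add: C'_def)
      thus ?thesis using n by (simp add: pos_le_divide_eq)
    qed
    thus "\<bar>f n\<bar> \<le> C' * real n powr (- 1 / 2)"
      by (simp only: pw times_divide_eq_right mult_1_right)
  qed
qed

text \<open>
  The three terms of the constant come from the replacement of the density by a tilt, from the
  normalisation of the tilt, and from the normal approximation.
\<close>
lemma shelf_tv_bound:
  fixes p c :: real
  assumes prob: "0 \<le> p" "p \<le> 1" "p \<noteq> 1 / 2" and c: "c > 0"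
    and size: "2 \<le> n" "3 \<le> c * sqrt (real n)" "(1 / c + 1)\<^sup>2 \<le> real n"
  defines "\<sigma> \<equiv> \<bar>2 * p - 1\<bar> / (2 * sqrt 3 * c)"
  defines "m \<equiv> nat \<lfloor>c * real n powr (3 / 2)\<rfloor>"
  shows "\<bar>tv_dist n (shelf_shuffle p n m) (uniform_perm n) - (1 - 2 * std_normal_cdf (- (\<sigma> / 2)))\<bar>
    \<le> (exp (144 / c\<^sup>2) * (exp (4 / c\<^sup>2) + 1) * (90 / c\<^sup>2)
       + 8 * (1 / c + 1) ^ 3 * exp (2 * (1 / c + 1)\<^sup>2)
       + (658 * put_const \<sigma> + \<sigma> + 2 * \<sigma>\<^sup>2)) / sqrt (real n)"
proof -
  define r where "r = sqrt (real n)"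
  have n1: "1 \<le> n" using size by simp
  have r: "1 \<le> r" "real n = r * r" using size by (auto simp: r_def)
  define \<delta> where "\<delta> = 1 / (c * r)"
  define K where "K = 9 / c\<^sup>2"
  have K0: "0 < K" using c by (simp add: K_def)
  define \<theta> where "\<theta> = (2 * p - 1) * \<delta>"
  have sr: "shelf_ratio p \<delta> K n m"
    unfolding \<delta>_def K_def m_def r_def by (rule shelf_ratio_holds[OF prob(1,2) c n1 size(2)])
  interpret shelf_ratio p \<delta> K n m by (rule sr)
  have m1: "1 \<le> m" using n_less_m by simp
  have "2 * p - 1 \<noteq> 0"
  proof
    assume "2 * p - 1 = 0"
    hence "p = 1 / 2" by linarith
    with assms(3) show False ..
  qed
  hence \<sigma>: "\<sigma> > 0" using c by (simp add: \<sigma>_def)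
  obtain \<kappa> \<eta> where
    dens: "\<And>\<pi>. \<pi> \<in> permutations_of_set {1..n} \<Longrightarrow>
      fact n * pmf (shelf_shuffle p n m) \<pi> = \<kappa> * exp (\<theta> * centred_ascents \<pi>) * exp (\<eta> \<pi>)"
    and eta: "\<And>\<pi>. \<pi> \<in> permutations_of_set {1..n} \<Longrightarrow>
      \<bar>\<eta> \<pi>\<bar> \<le> 2 * K / real n * (\<bar>centred_ascents \<pi>\<bar> + \<bar>centred_valleys \<pi>\<bar> + 2)"
    and \<kappa>: "\<kappa> > 0"
    unfolding \<theta>_def by (rule shelf_density[OF sr size(1)]) blast
  define L where "L = (\<lambda>\<pi>. fact n * pmf (shelf_shuffle p n m) \<pi>)"
  define R where "R = (\<lambda>\<pi>. exp (\<theta> * centred_ascents \<pi>))"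
  define M where "M = perm_avg n R"
  note tv = tv_dist_perm_avg[OF m1, where n=n and p=p, folded L_def]
  have th: "\<bar>\<theta>\<bar> \<le> 1 / c / r"
  proof -
    have "\<bar>2 * p - 1\<bar> \<le> 1" using prob by (simp add: abs_le_iff)
    hence "\<bar>2 * p - 1\<bar> * \<delta> \<le> 1 * \<delta>" using c r by (intro mult_right_mono) (auto simp: \<delta>_def)
    thus ?thesis using c r by (simp add: \<theta>_def abs_mult \<delta>_def)
  qed
  have cr: "1 / c / r \<le> 1 / 3" using size(2) c r by (simp add: field_simps r_def[symmetric])
  have M1: "1 \<le> M"
  proof -
    have "perm_avg n (\<lambda>\<pi>. 1 + \<theta> * centred_ascents \<pi>) \<le> M"
      unfolding M_def R_def by (intro perm_avg_mono exp_ge_add_one_self)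
    thus ?thesis unfolding perm_avg_add perm_avg_cmult by (simp add: perm_avg_ascents_mean[OF n1])
  qed
  have D: "perm_avg n (\<lambda>\<pi>. (R \<pi>)\<^sup>2) \<le> exp (4 / c\<^sup>2)"
  proof -
    have "perm_avg n (\<lambda>\<pi>. (R \<pi>)\<^sup>2) = perm_avg n (\<lambda>\<pi>. exp (2 * \<theta> * centred_ascents \<pi>))"
      by (simp add: R_def exp_double[symmetric] mult.assoc)
    also have "\<dots> \<le> exp (real n * (2 * \<theta>)\<^sup>2)"
      by (rule perm_avg_exp_le[OF n1]) (use th cr in linarith)
    also have "real n * (2 * \<theta>)\<^sup>2 \<le> real n * (2 * (1 / c / r))\<^sup>2"
    proof (rule mult_left_mono)
      have "0 \<le> 1 / c / r" using c r by simp
      hence "\<bar>2 * \<theta>\<bar> \<le> \<bar>2 * (1 / c / r)\<bar>" using th by linarith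
      thus "(2 * \<theta>)\<^sup>2 \<le> (2 * (1 / c / r))\<^sup>2" by (rule abs_le_square_iff[THEN iffD1])
    qed simp
    also have "\<dots> = 4 / c\<^sup>2" using r c by (simp add: power_divide power2_eq_square)
    finally show ?thesis by simp
  qed
  \<comment> \<open>The counts deviate by at most \<open>n\<close>, so \<open>\<eta>\<close> is bounded uniformly in \<open>n\<close>.\<close>
  define B where "B = 8 * K"
  have etaB: "\<bar>\<eta> \<pi>\<bar> \<le> B" if \<pi>: "\<pi> \<in> permutations_of_set {1..n}" for \<pi>
  proof -
    note P = pmf_shelf_shuffle_shelf_coeff[OF m1 prob(1,2) \<pi> n1]
    have "\<bar>centred_ascents \<pi>\<bar> \<le> real n" using centred_ascents_bound[OF \<pi> n1] by simp
    moreover have "\<bar>centred_valleys \<pi>\<bar> \<le> real n"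
    proof -
      have "real (valleys \<pi>) \<le> real n" using P by simp
      moreover have "3 * centred_valleys \<pi> = 3 * real (valleys \<pi>) - real n + 2"
        using length_perm[OF \<pi>] by (simp add: centred_valleys_def field_simps)
      moreover have "2 \<le> real n" "0 \<le> real (valleys \<pi>)" using size by auto
      ultimately show ?thesis by (intro abs_leI) linarith+
    qed
    moreover have "2 \<le> real n" using size by simp
    ultimately have "\<bar>centred_ascents \<pi>\<bar> + \<bar>centred_valleys \<pi>\<bar> + 2 \<le> 3 * real n" by linarith
    hence "2 * K / real n * (\<bar>centred_ascents \<pi>\<bar> + \<bar>centred_valleys \<pi>\<bar> + 2) \<le> 2 * K / real n * (3 *
        real n)"
      using K0 by (intro mult_left_mono) auto
    also have "\<dots> = 6 * K" using size by simp
    finally show ?thesis using eta[OF \<pi>] K0 unfolding B_def by linarith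
  qed
  \<comment> \<open>The root mean square of \<open>\<eta>\<close>: it is \<open>2 K / n\<close> times a variable with second moment at most \<open>25 n\<close>.\<close>
  define \<epsilon> where "\<epsilon> = 10 * K / r"
  have e0: "\<epsilon> > 0" using K0 r by (simp add: \<epsilon>_def)
  have e: "perm_avg n (\<lambda>\<pi>. (\<eta> \<pi>)\<^sup>2) \<le> \<epsilon>\<^sup>2"
  proof -
    define A where "A = (2 * K / real n)\<^sup>2"
    have "perm_avg n (\<lambda>\<pi>. (\<eta> \<pi>)\<^sup>2)
      \<le> perm_avg n (\<lambda>\<pi>. A * (3 * ((centred_ascents \<pi>)\<^sup>2 + (centred_valleys \<pi>)\<^sup>2 + 4)))"
    proof (rule perm_avg_mono)
      fix \<pi> assume \<pi>: "\<pi> \<in> permutations_of_set {1..n}"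
      define x where "x = \<bar>centred_ascents \<pi>\<bar>"
      define z where "z = \<bar>centred_valleys \<pi>\<bar>"
      have "(\<eta> \<pi>)\<^sup>2 \<le> (2 * K / real n * (x + z + 2))\<^sup>2"
        using power_mono[OF eta[OF \<pi>] abs_ge_zero, of 2] by (simp add: x_def z_def)
      also have "\<dots> = A * (x + z + 2)\<^sup>2" by (simp only: A_def power_mult_distrib)
      also have "(x + z + 2)\<^sup>2 \<le> 3 * (x\<^sup>2 + z\<^sup>2 + 4)"
      proof -
        have "0 \<le> (x - z)\<^sup>2 + (x - 2)\<^sup>2 + (z - 2)\<^sup>2" by simp
        thus ?thesis by (simp add: power2_eq_square algebra_simps)
      qed
      hence "A * (x + z + 2)\<^sup>2 \<le> A * (3 * (x\<^sup>2 + z\<^sup>2 + 4))" by (intro mult_left_mono) (auto simp: A_def)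
      finally show "(\<eta> \<pi>)\<^sup>2 \<le> A * (3 * ((centred_ascents \<pi>)\<^sup>2 + (centred_valleys \<pi>)\<^sup>2 + 4))"
        by (simp add: x_def z_def)
    qed
    also have "\<dots> = A * (3 * (perm_avg n (\<lambda>\<pi>. (centred_ascents \<pi>)\<^sup>2) + perm_avg n (\<lambda>\<pi>.
        (centred_valleys \<pi>)\<^sup>2) + 4))"
      by (simp only: perm_avg_cmult perm_avg_add perm_avg_const)
    also have "\<dots> \<le> A * (25 * real n)"
    proof (rule mult_left_mono)
      have "4 * perm_avg n (\<lambda>\<pi>. (centred_ascents \<pi>)\<^sup>2) \<le> real n + 1"
        using perm_avg_ascents_square[of n] by (simp add: field_simps)
      moreover have "perm_avg n (\<lambda>\<pi>. (centred_valleys \<pi>)\<^sup>2) \<le> real n" by (rule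
          perm_avg_valleys_square[OF n1])
      moreover have "2 \<le> real n" using size by simp
      moreover have "3 * (x + z + 4) \<le> 25 * N" if "4 * x \<le> N + 1" "z \<le> N" "2 \<le> N" for x z N :: real
        using that by (simp add: algebra_simps)
      ultimately show "3 * (perm_avg n (\<lambda>\<pi>. (centred_ascents \<pi>)\<^sup>2) + perm_avg n (\<lambda>\<pi>.
          (centred_valleys \<pi>)\<^sup>2) + 4) \<le> 25 * real n"
        by blast
    qed (simp add: A_def)
    also have "\<dots> = \<epsilon>\<^sup>2" unfolding A_def \<epsilon>_def r(2) using r(1) by (simp add: power2_eq_square
        field_simps)
    finally show ?thesis .
  qed
  have pert: "perm_avg n (\<lambda>\<pi>. \<bar>L \<pi> - R \<pi> / M\<bar>) \<le> exp (2 * B) * (exp (4 / c\<^sup>2) + 1) * \<epsilon>"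
    unfolding M_def
    by (rule perm_avg_tilt_perturbation[where \<eta>=\<eta> and \<kappa>=\<kappa>])
       (use dens etaB \<kappa> tv(1) M1 D e e0 in \<open>auto simp: L_def R_def M_def\<close>)
  have th2: "\<theta>\<^sup>2 * real n / 24 = \<sigma>\<^sup>2 / 2"
    unfolding \<theta>_def \<delta>_def \<sigma>_def r(2) using c r(1)
    by (simp add: power_divide power_mult_distrib power2_eq_square)
  define T where "T = exp (\<sigma>\<^sup>2 / 2)"
  have T1: "1 \<le> T" by (simp add: T_def)
  have mgf: "\<bar>M - T\<bar> \<le> 8 * (1 / c + 1) ^ 3 * exp (2 * (1 / c + 1)\<^sup>2) / r"
    using mgf_perm_avg[OF _ size(3), of \<theta>] th c unfolding M_def R_def T_def th2 r_def by simp
  have norm: "perm_avg n (\<lambda>\<pi>. \<bar>R \<pi> / M - R \<pi> / T\<bar>) \<le> \<bar>M - T\<bar>"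
  proof -
    have "perm_avg n (\<lambda>\<pi>. \<bar>R \<pi> / M - R \<pi> / T\<bar>) = perm_avg n (\<lambda>\<pi>. \<bar>1 / M - 1 / T\<bar> * R \<pi>)"
    proof (rule perm_avg_cong)
      fix \<pi>
      have "R \<pi> / M - R \<pi> / T = (1 / M - 1 / T) * R \<pi>" by (simp add: algebra_simps)
      thus "\<bar>R \<pi> / M - R \<pi> / T\<bar> = \<bar>1 / M - 1 / T\<bar> * R \<pi>" by (simp add: abs_mult R_def)
    qed
    also have "\<dots> = \<bar>1 / M - 1 / T\<bar> * M" unfolding perm_avg_cmult M_def ..
    also have "\<dots> = \<bar>M - T\<bar> / T"
    proof -
      have "(1 / M - 1 / T) * M = (T - M) / T" using M1 T1 by (simp add: field_simps)
      hence "\<bar>1 / M - 1 / T\<bar> * \<bar>M\<bar> = \<bar>T - M\<bar> / \<bar>T\<bar>" by (simp only: abs_mult[symmetric]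
          abs_divide[symmetric])
      thus ?thesis using M1 T1 by (simp add: abs_minus_commute)
    qed
    also have "\<dots> \<le> \<bar>M - T\<bar> / 1" using T1 by (intro divide_left_mono) auto
    finally show ?thesis by simp
  qed
  define G where "G = perm_avg n (\<lambda>\<pi>. max 0 (1 - R \<pi> / T))"
  have close: "\<bar>perm_avg n (\<lambda>\<pi>. max 0 (1 - L \<pi>)) - G\<bar> \<le> perm_avg n (\<lambda>\<pi>. \<bar>L \<pi> - R \<pi> / M\<bar> + \<bar>R \<pi> / M -
      R \<pi> / T\<bar>)"
    unfolding G_def perm_avg_diff[symmetric]
    by (rule order.trans[OF perm_avg_abs perm_avg_mono]) (auto simp: max_def abs_if)
  \<comment> \<open>The constants match: \<open>\<sigma> s \<surd>(12 / n) = \<theta>\<close>.\<close>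
  define s where "s = (if 2 * p - 1 > 0 then 1 else - 1 :: real)"
  have G: "G = perm_avg n (\<lambda>\<pi>. max 0 (1 - exp (\<sigma> * (s * (sqrt 12 / sqrt (real n)) * centred_ascents
      \<pi>) - \<sigma>\<^sup>2 / 2)))"
    unfolding G_def
  proof (rule perm_avg_cong)
    fix \<pi>
    have s12: "sqrt 12 = 2 * sqrt (3::real)"
      using real_sqrt_mult[of 4 3] by simp
    have "\<bar>2 * p - 1\<bar> * s = 2 * p - 1" by (simp add: s_def)
    moreover have "\<sigma> * (s * (sqrt 12 / r)) = (\<bar>2 * p - 1\<bar> * s) / (c * r)"
      unfolding \<sigma>_def s12 using c r by simp
    ultimately have "\<sigma> * (s * (sqrt 12 / r)) = \<theta>" by (simp add: \<theta>_def \<delta>_def)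
    hence "\<sigma> * (s * (sqrt 12 / r) * centred_ascents \<pi>) = \<theta> * centred_ascents \<pi>" by (metis mult.assoc)
    hence "R \<pi> / T = exp (\<sigma> * (s * (sqrt 12 / sqrt (real n)) * centred_ascents \<pi>) - \<sigma>\<^sup>2 / 2)"
      by (simp add: R_def T_def exp_diff r_def)
    thus "max 0 (1 - R \<pi> / T) = max 0 (1 - exp (\<sigma> * (s * (sqrt 12 / sqrt (real n)) * centred_ascents
        \<pi>) - \<sigma>\<^sup>2 / 2))" by simp
  qed
  have pay: "\<bar>G - (1 - 2 * std_normal_cdf (- (\<sigma> / 2)))\<bar> \<le> (658 * put_const \<sigma> + \<sigma> + 2 * \<sigma>\<^sup>2) / r"
    unfolding G r_def by (rule put_payoff_perm_avg[OF \<sigma> n1]) (simp add: s_def)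
  have eB: "exp (2 * B) * (exp (4 / c\<^sup>2) + 1) * \<epsilon> = exp (144 / c\<^sup>2) * (exp (4 / c\<^sup>2) + 1) * (90 /
      c\<^sup>2) / r"
    by (simp add: B_def K_def \<epsilon>_def)
  have "\<bar>perm_avg n (\<lambda>\<pi>. max 0 (1 - L \<pi>)) - (1 - 2 * std_normal_cdf (- (\<sigma> / 2)))\<bar>
    \<le> exp (144 / c\<^sup>2) * (exp (4 / c\<^sup>2) + 1) * (90 / c\<^sup>2) / r + 8 * (1 / c + 1) ^ 3 * exp (2 * (1 / c
        + 1)\<^sup>2) / r
      + (658 * put_const \<sigma> + \<sigma> + 2 * \<sigma>\<^sup>2) / r"
    using close[unfolded perm_avg_add] pert[unfolded eB] norm mgf pay by linarith
  thus ?thesis unfolding tv(2) r_def L_def by (simp only: add_divide_distrib)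
qed

theorem theorem1p5:
  fixes p c :: real and m :: "nat \<Rightarrow> nat"
  assumes p: "0 < p" "p < 1" "p \<noteq> 1 / 2"
    and c: "c > 0"
    and m: "\<And>n. m n = nat \<lfloor>c * real n powr (3 / 2)\<rfloor>"
  shows "\<exists>C::real. \<forall>n::nat. m n \<ge> 1 \<longrightarrow>
    \<bar>tv_dist n (shelf_shuffle p n (m n)) (uniform_perm n)
      - (1 - 2 * std_normal_cdf (- (\<bar>2 * p - 1\<bar> / (4 * sqrt 3 * c))))\<bar>
    \<le> C * real n powr (- 1 / 2)"
proof -
  \<comment> \<open>From \<open>n0\<close> on all assumptions of \<open>shelf_tv_bound\<close> hold; the finitely many smaller \<open>n\<close> only
      enlarge the constant.\<close>
  define n0 where "n0 = max 2 (max (nat \<lceil>(3 / c)\<^sup>2\<rceil>) (nat \<lceil>(1 / c + 1)\<^sup>2\<rceil>))"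
  define f where "f = (\<lambda>n. tv_dist n (shelf_shuffle p n (m n)) (uniform_perm n)
      - (1 - 2 * std_normal_cdf (- (\<bar>2 * p - 1\<bar> / (4 * sqrt 3 * c)))))"
  define \<sigma> where "\<sigma> = \<bar>2 * p - 1\<bar> / (2 * sqrt 3 * c)"
  have half: "\<sigma> / 2 = \<bar>2 * p - 1\<bar> / (4 * sqrt 3 * c)" by (simp add: \<sigma>_def)
  have "\<exists>C'. \<forall>n\<ge>1. \<bar>f n\<bar> \<le> C' * real n powr (- 1 / 2)"
  proof (rule eventually_imp_bound_all)
    fix n assume n: "n0 \<le> n"
    have n3: "2 \<le> n" "(3 / c)\<^sup>2 \<le> real n" "(1 / c + 1)\<^sup>2 \<le> real n"
      using n unfolding n0_def by linarith+
    have "3 / c \<le> sqrt (real n)" using n3(2) by (rule real_le_rsqrt)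
    hence "3 \<le> c * sqrt (real n)" using c by (simp add: field_simps)
    from shelf_tv_bound[OF _ _ p(3) c n3(1) this n3(3)] p
    show "\<bar>f n\<bar> \<le> (exp (144 / c\<^sup>2) * (exp (4 / c\<^sup>2) + 1) * (90 / c\<^sup>2)
       + 8 * (1 / c + 1) ^ 3 * exp (2 * (1 / c + 1)\<^sup>2)
       + (658 * put_const \<sigma> + \<sigma> + 2 * \<sigma>\<^sup>2)) / sqrt (real n)"
      unfolding f_def half[symmetric] \<sigma>_def m by simp
  qed
  then obtain C' where C': "\<And>n. n \<ge> 1 \<Longrightarrow> \<bar>f n\<bar> \<le> C' * real n powr (- 1 / 2)" by blast
  show ?thesis
  proof (intro exI[of _ C'] allI impI)
    fix n assume "m n \<ge> 1"
    hence "n \<ge> 1" unfolding m by (cases "n = 0") auto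
    from C'[OF this] show "\<bar>tv_dist n (shelf_shuffle p n (m n)) (uniform_perm n)
      - (1 - 2 * std_normal_cdf (- (\<bar>2 * p - 1\<bar> / (4 * sqrt 3 * c))))\<bar> \<le> C' * real n powr (- 1 / 2)"
      by (simp add: f_def)
  qed
qed

end
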